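(* Let $\mathcal{A}$ and $\mathcal{B}$ be unital finite-dimensional complex algebras, each equipped with the unique Hausdorff vector topology. Let $\mathrm{Max}(\mathcal{A})=\{\mathcal{M}_1,\ldots,\mathcal{M}_p\}$ and $\mathrm{Max}(\mathcal{B})=\{\mathcal{N}_1,\ldots,\mathcal{N}_q\}$ be the sets of all maximal ideals of $\mathcal{A}$ and $\mathcal{B}$ (listed without repetition), and define $$k_i:=\sqrt{\dim(\mathcal{A}/\mathcal{M}_i)}\quad\text{and}\quad m_j:=\sqrt{\dim(\mathcal{B}/\mathcal{N}_j)}\qquad(1\le i\le p,\ 1\le j\le q),$$ which are positive integers. For each $1\le j\le q$ consider the linear Diophantine equation $$k_1x_1^j+\cdots+k_px_p^j=m_j \qquad (E_j)$$ in the unknowns $(x_1^j,\ldots,x_p^j)$ (the superscript $j$ is an index, not a power). Then the following holds: (a) There exists a continuous spectrum-shrinking map $\phi:\mathcal{A}\to\mathcal{B}$ if and only if for each $1\le j\le q$ the equation $(E_j)$ has a non-negative integer solution $(x_1^j,\ldots,x_p^j)\in\mathbb{N}_0^p$. (b) There exists a continuous spectrum-preserving map $\phi:\mathcal{A}\to\mathcal{B}$ if and only if there exists a family $\{(x_1^j,\ldots,x_p^j):1\le j\le q\}$, where for each $j$ the tuple $(x_1^j,\ldots,x_p^j)\in\mathbb{N}_0^p$ is a non-negative integer solution to $(E_j)$, with the property that for each $1\le i\le p$ there exists some $1\le j\le q$ with $x_i^j>0$. (c) If every continuous spectrum-shrinking map $\phi:\mathcal{A}\to\mathcal{B}$ is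 spectrum-preserving, then any family $\{(x_1^j,\ldots,x_p^j):1\le j\le q\}$, where for each $j$ the tuple $(x_1^j,\ldots,x_p^j)\in\mathbb{N}_0^p$ is a non-negative integer solution to $(E_j)$, satisfies that for each $1\le i\le p$ there exists some $1\le j\le q$ with $x_i^j>0$. The converse of this implication holds when $\mathcal{A}$ is isomorphic to a structural matrix algebra.
   Context: All algebras are associative; ideals are two-sided; dimensions are over $\mathbb{C}$; $\mathbb{N}_0=\{0,1,2,\ldots\}$. For a unital finite-dimensional complex algebra $\mathcal{A}$ with identity $1_{\mathcal{A}}$ and $a\in\mathcal{A}$, the spectrum of $a$ is $\mathrm{sp}(a)=\{\lambda\in\mathbb{C}:\lambda 1_{\mathcal{A}}-a \text{ is not invertible in }\mathcal{A}\}$. A (not necessarily linear) map $\phi:\mathcal{A}\to\mathcal{B}$ is spectrum-shrinking if $\mathrm{sp}(\phi(a))\subseteq\mathrm{sp}(a)$ for all $a\in\mathcal{A}$, and spectrum-preserving if $\mathrm{sp}(\phi(a))=\mathrm{sp}(a)$ for all $a\in\mathcal{A}$, where the spectra are computed in the respective algebras. That $k_i$ and $m_j$ are positive integers follows since any simple finite-dimensional unital complex algebra is isomorphic to a full matrix algebra $M_n(\mathbb{C})$ for some $n \geq 1$. A structural matrix algebra (SMA) is a unital subalgebra of $M_n(\mathbb{C})$, for some $n\ge 1$, that is linearly spanned by a set of matrix units $E_{ij}$; equivalently, a subalgebra of $M_n(\mathbb{C})$ containing all diagonal matrices. *)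

theory Defs
  imports
    "HOL-Analysis.Analysis"
    "HOL-Algebra.QuotRing"
    "Jordan_Normal_Form.VS_Connect"
begin

text \<open>
  An algebra is a carrier-based \<open>module\<close> record over the ring record \<open>class_ring\<close> of the complex
  numbers; the type \<open>module\<close> extends the ring record, so the ideals, units and quotients of HOL-Algebra
  apply to it directly. The locale \<open>ring\<close> neither demands commutativity nor excludes the zero algebra.
\<close>

abbreviation complex_field :: "complex ring" where
  "complex_field \<equiv> class_ring"

type_synonym 'a complex_alg = "(complex, 'a) module"

locale fd_complex_algebra =
  vectorspace complex_field A + ring A for A :: "'a complex_alg" (structure) +
  assumes fin_dim: "fin_dim"
    and smult_mult_left: "\<lbrakk>x \<in> carrier A; y \<in> carrier A\<rbrakk> \<Longrightarrow> c \<odot>\<^bsub>A\<^esub> (x \<otimes>\<^bsub>A\<^esub> y) = (c \<odot>\<^bsub>A\<^esub> x) \<otimes>\<^bsub>A\<^esub> y"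
    and smult_mult_right: "\<lbrakk>x \<in> carrier A; y \<in> carrier A\<rbrakk> \<Longrightarrow> c \<odot>\<^bsub>A\<^esub> (x \<otimes>\<^bsub>A\<^esub> y) = x \<otimes>\<^bsub>A\<^esub> (c \<odot>\<^bsub>A\<^esub> y)"

definition hausdorff_vector_topology :: "'a complex_alg \<Rightarrow> 'a topology \<Rightarrow> bool" where
  "hausdorff_vector_topology A T \<longleftrightarrow>
     topspace T = carrier A \<and> Hausdorff_space T \<and>
     continuous_map (prod_topology T T) T (\<lambda>(x, y). x \<oplus>\<^bsub>A\<^esub> y) \<and>
     continuous_map (prod_topology euclidean T) T (\<lambda>(c, x). c \<odot>\<^bsub>A\<^esub> x)"

definition spectrum_in :: "'a complex_alg \<Rightarrow> 'a \<Rightarrow> complex set" where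
  "spectrum_in A a = {c. c \<odot>\<^bsub>A\<^esub> \<one>\<^bsub>A\<^esub> \<ominus>\<^bsub>A\<^esub> a \<notin> Units A}"

definition spectrum_shrinking :: "'a complex_alg \<Rightarrow> 'b complex_alg \<Rightarrow> ('a \<Rightarrow> 'b) \<Rightarrow> bool" where
  "spectrum_shrinking A B \<phi> \<longleftrightarrow> (\<forall>a \<in> carrier A. spectrum_in B (\<phi> a) \<subseteq> spectrum_in A a)"

definition spectrum_preserving :: "'a complex_alg \<Rightarrow> 'b complex_alg \<Rightarrow> ('a \<Rightarrow> 'b) \<Rightarrow> bool" where
  "spectrum_preserving A B \<phi> \<longleftrightarrow> (\<forall>a \<in> carrier A. spectrum_in B (\<phi> a) = spectrum_in A a)"

definition Max_ideals :: "'a complex_alg \<Rightarrow> 'a set set" where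
  "Max_ideals A = {I. maximalideal I A}"

text \<open>
  The quotient ring \<open>A Quot I\<close> with the scalar action \<open>c (I + x) = I + c x\<close>, written as a union over
  the representatives \<open>x\<close> of a coset in the same way as the library's \<open>rcoset_mult\<close>.
\<close>

definition quotient_algebra :: "'a complex_alg \<Rightarrow> 'a set \<Rightarrow> 'a set complex_alg" where
  "quotient_algebra A I =
     ring.extend (A Quot I) (module.fields (\<lambda>c X. \<Union>x\<in>X. I +>\<^bsub>A\<^esub> (c \<odot>\<^bsub>A\<^esub> x)))"

definition alg_dim :: "'a complex_alg \<Rightarrow> nat" where
  "alg_dim A = vectorspace.dim complex_field A"

definition solves_linear_eq :: "nat \<Rightarrow> (nat \<Rightarrow> real) \<Rightarrow> real \<Rightarrow> (nat \<Rightarrow> nat) \<Rightarrow> bool" where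
  "solves_linear_eq p k m x \<longleftrightarrow> (\<Sum>i = 1..p. k i * real (x i)) = m"

definition matrix_algebra :: "nat \<Rightarrow> complex mat complex_alg" where
  "matrix_algebra n = module_mat TYPE(complex) n n"

definition matrix_unit :: "nat \<Rightarrow> nat \<Rightarrow> nat \<Rightarrow> complex mat" where
  "matrix_unit n i j = mat n n (\<lambda>(a, b). if a = i \<and> b = j then 1 else 0)"

definition structural_matrix_algebra :: "nat \<Rightarrow> complex mat set \<Rightarrow> bool" where
  "structural_matrix_algebra n S \<longleftrightarrow>
     1 \<le> n \<and> 1\<^sub>m n \<in> S \<and> (\<forall>X \<in> S. \<forall>Y \<in> S. X * Y \<in> S) \<and>
     (\<exists>P \<subseteq> {..<n} \<times> {..<n}.
        S = module.span complex_field (matrix_algebra n) ((\<lambda>(i, j). matrix_unit n i j) ` P))"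

definition algebra_iso :: "'a complex_alg \<Rightarrow> 'b complex_alg \<Rightarrow> ('a \<Rightarrow> 'b) set" where
  "algebra_iso A B = ring_iso A B \<inter> module_hom complex_field A B"

definition isomorphic_to_SMA :: "'a complex_alg \<Rightarrow> bool" where
  "isomorphic_to_SMA A \<longleftrightarrow>
     (\<exists>n S. structural_matrix_algebra n S \<and>
        algebra_iso A ((matrix_algebra n)\<lparr>carrier := S\<rparr>) \<noteq> {})"

end

theory Submission
  imports
    Defs
    "Jordan_Normal_Form.Schur_Decomposition"
    "Jordan_Normal_Form.Spectral_Radius"
begin

text \<open>
  Why the theorem holds. For each maximal ideal of a finite-dimensional complex algebra there is an
  irreducible matrix representation with that ideal as kernel. By Burnside's theorem it maps onto a
  full matrix algebra, of size the square root of the dimension of the quotient. Together these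
  representations \<open>\<pi>\<^sub>1, \<dots>, \<pi>\<^sub>p\<close> are surjective onto all tuples of matrices, and an element is a unit if and only
  if all its blocks \<open>\<pi>\<^sub>i a\<close> are invertible. So the spectrum of \<open>a\<close> is the set of eigenvalues of its blocks
  (\<open>irreducible_reps_of_maximal_ideals\<close>, \<open>irreducible_reps_jointly_surjective\<close>,
  \<open>alg_dim_quotient_by_rep_kernel\<close>, \<open>spectrum_eq_char_poly_roots\<close>).

  Solutions give maps. If \<open>m\<^sub>j = k\<^sub>1 x\<^sub>1 + \<dots> + k\<^sub>p x\<^sub>p\<close>, the block diagonal matrix with \<open>x\<^sub>i\<close> copies of \<open>\<pi>\<^sub>i a\<close> has
  the size of the \<open>j\<close>-th block of \<open>B\<close>. A linear section of the block map of \<open>B\<close> lifts these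
  matrices to a continuous linear map, whose spectrum is the union of the spectra of the blocks of \<open>a\<close>
  that are used (\<open>block_relation_realizable\<close>).

  Maps give solutions. Let \<open>\<phi>\<close> be continuous and spectrum-shrinking and let \<open>\<psi> a\<close> be the \<open>j\<close>-th block of
  \<open>\<phi> a\<close>. Along a path on which the spectrum of the argument is constant, the characteristic polynomial of \<open>\<psi>\<close>
  is continuous with finitely many possible values, hence constant. Such paths lead from any element to a
  diagonal one with the same eigenvalues, and they permute the eigenvalues within a block. On
  diagonal elements with pairwise distinct eigenvalues, a connected set, the multiplicity with which each
  eigenvalue of \<open>a\<close> occurs in \<open>\<psi> a\<close> is locally constant. So these multiplicities are numbers \<open>x\<^sub>i\<close> that depend on the
  block alone, and \<open>char_poly (\<psi> a)\<close> is the product of the \<open>char_poly (\<pi>\<^sub>i a) ^ x\<^sub>i\<close> for every \<open>a\<close>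
  (\<open>char_poly_of_spectrum_shrinking\<close>). Degrees give the equation \<open>m\<^sub>j = k\<^sub>1 x\<^sub>1 + \<dots> + k\<^sub>p x\<^sub>p\<close>.

  In both directions the spectrum of \<open>\<phi> a\<close> consists of the eigenvalues of the blocks \<open>\<pi>\<^sub>i a\<close> with \<open>x\<^sub>i > 0\<close> for some
  \<open>j\<close>, so \<open>\<phi>\<close> preserves spectra exactly when every \<open>i\<close> has a positive multiplicity (\<open>block_relation_spectrum\<close>). All
  parts of the theorem follow from this dictionary between maps and families of solutions.
\<close>

unbundle no vec_syntax
hide_const (open) Determinants.det Finite_Cartesian_Product.row Finite_Cartesian_Product.column
  Finite_Cartesian_Product.transpose Polynomial.order Finite_Cartesian_Product.mat Finite_Cartesian_Product.vec


section \<open>Invertible frames adapted to subspaces\<close>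

lemma det_nonzero_inverse:
  fixes P :: "'a :: field mat"
  assumes P: "P \<in> carrier_mat n n" "det P \<noteq> 0"
  obtains Q where "Q \<in> carrier_mat n n" "P * Q = 1\<^sub>m n" "Q * P = 1\<^sub>m n"
    "\<forall>v\<in>carrier_vec n. P *\<^sub>v (Q *\<^sub>v v) = v"
proof -
  obtain Q where Q: "Q \<in> carrier_mat n n" "P * Q = 1\<^sub>m n" "Q * P = 1\<^sub>m n"
    using det_non_zero_imp_unit[OF P, of "()"] by (auto simp: Units_def ring_mat_def)
  moreover have "P *\<^sub>v (Q *\<^sub>v v) = v" if "v \<in> carrier_vec n" for v
    using that P Q by (metis assoc_mult_mat_vec one_mult_mat_vec)
  ultimately show thesis using that by blast
qed

lemma mult_mat_zero_vec:
  "P \<in> carrier_mat n m \<Longrightarrow> P *\<^sub>v 0\<^sub>v m = (0\<^sub>v n :: 'a :: comm_ring_1 vec)"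
  by (intro eq_vecI) auto

lemma mult_mat_entry:
  fixes X Y :: "'a :: comm_ring_1 mat"
  assumes "X \<in> carrier_mat n k" "Y \<in> carrier_mat k m" "a < n" "b < m"
  shows "(X * Y) $$ (a, b) = (\<Sum>j<k. X $$ (a, j) * Y $$ (j, b))"
  using assms by (simp add: scalar_prod_def atLeast0LessThan)

lemma nonzero_mat_entry:
  fixes X :: "'a :: zero mat"
  assumes "X \<in> carrier_mat n m" "X \<noteq> 0\<^sub>m n m"
  obtains i j where "i < n" "j < m" "X $$ (i, j) \<noteq> 0"
  using assms by (metis carrier_matD eq_matI index_zero_mat)

lemma mult_mat_unit_vec:
  fixes P :: "'a :: comm_ring_1 mat"
  assumes "P \<in> carrier_mat n m" "s < m"
  shows "P *\<^sub>v unit_vec m s = col P s"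
  using assms by (intro eq_vecI) auto

text \<open>
  Steinitz exchange for invertible matrices: a vector whose coordinate at some position \<open>i \<ge> r\<close> does
  not vanish can become column \<open>r\<close> without disturbing the earlier columns. Maximality arguments over
  the number of good leading columns then replace a dimension theory of subspaces.
\<close>

lemma exchange_column:
  fixes P :: "'a :: field mat"
  assumes P: "P \<in> carrier_mat n n" "det P \<noteq> 0" and c: "c \<in> carrier_vec n"
    and i: "r \<le> i" "i < n" "c $ i \<noteq> 0"
  obtains P' where "P' \<in> carrier_mat n n" "det P' \<noteq> 0" "\<And>s. s < r \<Longrightarrow> col P' s = col P s"
    "col P' r = P *\<^sub>v c"
proof -
  have r: "r < n" using i by simp
  \<comment> \<open>\<open>E\<close> sends \<open>e\<^sub>r\<close> to \<open>c\<close>, \<open>e\<^sub>i\<close> to \<open>e\<^sub>r\<close>, and fixes the other basis vectors; \<open>i = r\<close> is allowed\<close>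
  define E where "E = mat n n (\<lambda>(a, s). if s = r then c $ a else if s = i then (if a = r then 1 else 0)
      else if a = s then 1 else 0)"
  have E: "E \<in> carrier_mat n n" by (simp add: E_def)
  have Ev: "(E *\<^sub>v v) $ a = c $ a * v $ r + (if a = r then (if i = r then 0 else v $ i)
      else if a = i then 0 else v $ a)" if v: "v \<in> carrier_vec n" and a: "a < n" for v a
  proof -
    have "(E *\<^sub>v v) $ a = (\<Sum>s<n. E $$ (a, s) * v $ s)"
      using E v a by (simp add: scalar_prod_def atLeast0LessThan)
    also have "\<dots> = (\<Sum>s<n. (if s = r then c $ a * v $ s else 0)
        + (if s = i then (if a = r \<and> i \<noteq> r then v $ s else 0) else 0)
        + (if s = a then (if a \<noteq> r \<and> a \<noteq> i then v $ s else 0) else 0))"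
      using a by (intro sum.cong) (auto simp: E_def)
    also have "\<dots> = c $ a * v $ r + (if a = r then (if i = r then 0 else v $ i)
      else if a = i then 0 else v $ a)"
      using a r i by (simp add: sum.distrib)
    finally show ?thesis .
  qed
  have "det E \<noteq> 0"
  proof
    assume "det E = 0"
    then obtain v where v: "v \<in> carrier_vec n" "v \<noteq> 0\<^sub>v n" "E *\<^sub>v v = 0\<^sub>v n"
      using det_0_iff_vec_prod_zero[OF E] by auto
    have eq: "c $ a * v $ r + (if a = r then (if i = r then 0 else v $ i)
      else if a = i then 0 else v $ a) = 0" if "a < n" for a
      using Ev[OF v(1) that] v(3) that by simp
    have vr: "v $ r = 0" using eq[of i] i by (auto split: if_splits)
    have vi: "v $ i = 0" using eq[of r] r vr by (auto split: if_splits)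
    have "v $ a = 0" if "a < n" for a using eq[OF that] vr vi by (auto split: if_splits)
    then show False using v by auto
  qed
  have colE: "col E s = (if s = r then c else if s = i then unit_vec n r else unit_vec n s)" if "s < n" for s
    using that c by (intro eq_vecI) (auto simp: E_def unit_vec_def)
  show thesis
  proof (rule that[of "P * E"])
    show "P * E \<in> carrier_mat n n" using P E by simp
    show "det (P * E) \<noteq> 0" using det_mult[OF P(1) E] P \<open>det E \<noteq> 0\<close> by simp
    have colPE: "col (P * E) s = P *\<^sub>v col E s" if "s < n" for s
      using P E that by (intro col_mult2) auto
    show "col (P * E) s = col P s" if "s < r" for s
      using colPE[of s] colE[of s] that r i P by (simp add: mult_mat_unit_vec)
    show "col (P * E) r = P *\<^sub>v c" using colPE[OF r] colE[OF r] by simp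
  qed
qed

definition vec_subspace :: "nat \<Rightarrow> 'a :: field vec set \<Rightarrow> bool" where
  "vec_subspace n W \<longleftrightarrow> W \<subseteq> carrier_vec n \<and> 0\<^sub>v n \<in> W \<and> (\<forall>v\<in>W. \<forall>w\<in>W. v + w \<in> W) \<and>
    (\<forall>c. \<forall>v\<in>W. c \<cdot>\<^sub>v v \<in> W)"

lemma subspace_contains_leading_combinations:
  fixes P :: "'a :: field mat"
  assumes P: "P \<in> carrier_mat n n" and W: "vec_subspace n W" and cols: "\<And>s. s < r \<Longrightarrow> col P s \<in> W"
    and "r \<le> n" and c: "c \<in> carrier_vec n" "\<And>i. r \<le> i \<Longrightarrow> i < n \<Longrightarrow> c $ i = 0"
  shows "P *\<^sub>v c \<in> W"
  using \<open>r \<le> n\<close> cols c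
proof (induction r arbitrary: c)
  case 0
  have "c = 0\<^sub>v n" using 0 by auto
  moreover have "P *\<^sub>v 0\<^sub>v n = 0\<^sub>v n" using P by (intro eq_vecI) auto
  ultimately show ?case using W by (auto simp: vec_subspace_def)
next
  case (Suc r)
  define c' where "c' = c - c $ r \<cdot>\<^sub>v unit_vec n r"
  have c': "c' \<in> carrier_vec n" using Suc by (simp add: c'_def)
  have "c = c' + c $ r \<cdot>\<^sub>v unit_vec n r"
    using Suc.prems by (intro eq_vecI) (auto simp: c'_def)
  then have "P *\<^sub>v c = P *\<^sub>v c' + c $ r \<cdot>\<^sub>v col P r"
    using P c' Suc.prems by (metis Suc_le_eq mult_mat_unit_vec mult_add_distrib_mat_vec mult_mat_vec
        smult_carrier_vec unit_vec_carrier)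
  moreover have "P *\<^sub>v c' \<in> W"
  proof (rule Suc.IH)
    show "c' $ i = 0" if "r \<le> i" "i < n" for i
      using Suc.prems that by (cases "i = r") (auto simp: c'_def unit_vec_def)
  qed (use Suc.prems c' in auto)
  ultimately show ?case using Suc.prems W by (auto simp: vec_subspace_def)
qed

text \<open>
  Choose an invertible \<open>P\<close> with as many leading columns in \<open>W\<close> as possible. A vector of \<open>W\<close> outside
  their span could be exchanged in, against maximality. So \<open>r\<close> is the dimension of \<open>W\<close>, and membership
  in \<open>W\<close> is the vanishing of the last \<open>n - r\<close> coordinates with respect to \<open>P\<close>.
\<close>

lemma subspace_adapted_frame:
  fixes W :: "'a :: field vec set"
  assumes W: "vec_subspace n W"
  obtains P r where "P \<in> carrier_mat n n" "det P \<noteq> 0" "r \<le> n"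
    "\<And>c. c \<in> carrier_vec n \<Longrightarrow> P *\<^sub>v c \<in> W \<longleftrightarrow> (\<forall>i. r \<le> i \<longrightarrow> i < n \<longrightarrow> c $ i = 0)"
proof -
  define ok where "ok r \<longleftrightarrow> r \<le> n \<and> (\<exists>P \<in> carrier_mat n n. det P \<noteq> 0 \<and> (\<forall>s<r. col P s \<in> W))" for r
  have "ok 0" by (auto simp: ok_def intro!: bexI[of _ "1\<^sub>m n"])
  moreover have "\<forall>r. ok r \<longrightarrow> r \<le> n" by (simp add: ok_def)
  ultimately obtain r where r: "ok r" and max: "\<And>s. ok s \<Longrightarrow> s \<le> r"
    using Nat.ex_has_greatest_nat[of ok 0 n] by blast
  then obtain P where P: "P \<in> carrier_mat n n" "det P \<noteq> 0" "\<And>s. s < r \<Longrightarrow> col P s \<in> W" and "r \<le> n"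
    by (auto simp: ok_def)
  show thesis
  proof (rule that[of P r])
    fix c :: "'a vec" assume c: "c \<in> carrier_vec n"
    show "P *\<^sub>v c \<in> W \<longleftrightarrow> (\<forall>i. r \<le> i \<longrightarrow> i < n \<longrightarrow> c $ i = 0)"
    proof
      assume PcW: "P *\<^sub>v c \<in> W"
      show "\<forall>i. r \<le> i \<longrightarrow> i < n \<longrightarrow> c $ i = 0"
      proof (intro allI impI, rule ccontr)
        fix i assume i: "r \<le> i" "i < n" "c $ i \<noteq> 0"
        obtain P' where P': "P' \<in> carrier_mat n n" "det P' \<noteq> 0" "\<And>s. s < r \<Longrightarrow> col P' s = col P s"
          "col P' r = P *\<^sub>v c" using exchange_column[OF P(1,2) c i] by blast
        have "ok (Suc r)"
          using P' P(3) PcW i by (auto simp: ok_def less_Suc_eq intro!: bexI[of _ P'])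
        then show False using max[of "Suc r"] by simp
      qed
    next
      assume "\<forall>i. r \<le> i \<longrightarrow> i < n \<longrightarrow> c $ i = 0"
      then show "P *\<^sub>v c \<in> W"
        using subspace_contains_leading_combinations[OF P(1) W P(3) \<open>r \<le> n\<close> c] by auto
    qed
  qed (use P \<open>r \<le> n\<close> in auto)
qed


section \<open>Burnside's theorem on transitive matrix algebras\<close>

definition matrix_subspace :: "nat \<Rightarrow> complex mat set \<Rightarrow> bool" where
  "matrix_subspace n S \<longleftrightarrow> S \<subseteq> carrier_mat n n \<and> 0\<^sub>m n n \<in> S \<and> (\<forall>X\<in>S. \<forall>Y\<in>S. X + Y \<in> S) \<and>
     (\<forall>c. \<forall>X\<in>S. c \<cdot>\<^sub>m X \<in> S)"

definition transitive_on_vectors :: "nat \<Rightarrow> complex mat set \<Rightarrow> bool" where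
  "transitive_on_vectors n S \<longleftrightarrow>
     (\<forall>v\<in>carrier_vec n. v \<noteq> 0\<^sub>v n \<longrightarrow> (\<forall>w\<in>carrier_vec n. \<exists>T\<in>S. T *\<^sub>v v = w))"

lemma kernel_is_vec_subspace:
  assumes "T \<in> carrier_mat n n"
  shows "vec_subspace n {v \<in> carrier_vec n. T *\<^sub>v v = 0\<^sub>v n}"
  unfolding vec_subspace_def using assms
  by (auto simp: mult_add_distrib_mat_vec mult_mat_vec) 

lemma orbit_is_vec_subspace:
  assumes S: "matrix_subspace n S" and v: "v \<in> carrier_vec n"
  shows "vec_subspace n {T *\<^sub>v v | T. T \<in> S}"
proof -
  have Sc: "T \<in> carrier_mat n n" if "T \<in> S" for T using S that by (auto simp: matrix_subspace_def)
  have "0\<^sub>m n n *\<^sub>v v = 0\<^sub>v n" using v by (intro eq_vecI) auto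
  moreover have "T *\<^sub>v v + T' *\<^sub>v v = (T + T') *\<^sub>v v" if "T \<in> S" "T' \<in> S" for T T'
    using Sc[OF that(1)] Sc[OF that(2)] v by (simp add: add_mult_distrib_mat_vec[of _ n n])
  moreover have "c \<cdot>\<^sub>v (T *\<^sub>v v) = (c \<cdot>\<^sub>m T) *\<^sub>v v" if "T \<in> S" for c T
    using Sc[OF that] v by (intro eq_vecI) auto
  ultimately show ?thesis
    using S Sc v unfolding vec_subspace_def matrix_subspace_def
    by (auto intro!: mult_mat_vec_carrier[of _ n n]) metis+
qed

lemma matrix_subspace_transpose:
  assumes S: "matrix_subspace n S"
  shows "matrix_subspace n (transpose_mat ` S)"
proof -
  have SC: "X \<in> carrier_mat n n" if "X \<in> S" for X
    using S that by (auto simp: matrix_subspace_def)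
  have "transpose_mat X + transpose_mat Y \<in> transpose_mat ` S" if "X \<in> S" "Y \<in> S" for X Y
  proof (rule image_eqI)
    show "transpose_mat X + transpose_mat Y = transpose_mat (X + Y)"
      using SC[OF that(1)] SC[OF that(2)] by (intro eq_matI) auto
    show "X + Y \<in> S" using S that by (simp add: matrix_subspace_def)
  qed
  moreover have "c \<cdot>\<^sub>m transpose_mat X \<in> transpose_mat ` S" if "X \<in> S" for c X
  proof (rule image_eqI)
    show "c \<cdot>\<^sub>m transpose_mat X = transpose_mat (c \<cdot>\<^sub>m X)" by (intro eq_matI) auto
    show "c \<cdot>\<^sub>m X \<in> S" using S that by (simp add: matrix_subspace_def)
  qed
  moreover have "0\<^sub>m n n \<in> transpose_mat ` S"
  proof (rule image_eqI)
    show "0\<^sub>m n n = transpose_mat (0\<^sub>m n n :: complex mat)" by (intro eq_matI) auto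
    show "0\<^sub>m n n \<in> S" using S by (simp add: matrix_subspace_def)
  qed
  ultimately show ?thesis using SC by (auto simp: matrix_subspace_def)
qed

text \<open>
  An element \<open>T0 \<noteq> 0\<close> with kernel of the largest possible dimension \<open>r\<close> works. In a frame \<open>P\<close> whose first
  \<open>r\<close> columns lie in the kernel of \<open>T0\<close>, the product \<open>T * T0\<close> has zeros in the first \<open>r\<close> columns; an eigenvector
  of its lower right block, with eigenvalue \<open>c\<close>, gives a vector \<open>u\<close> outside the span of these columns such that
  \<open>T *\<^sub>v (T0 *\<^sub>v u) - c \<cdot>\<^sub>v u\<close> is in that span. So \<open>T0 * T * T0 - c \<cdot>\<^sub>m T0\<close> vanishes on the first \<open>r\<close> columns and
  also at \<open>u\<close>; having a larger kernel, it must be zero.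
\<close>

lemma minimal_rank_element:
  assumes S: "matrix_subspace n S" and mult: "\<And>X Y. X \<in> S \<Longrightarrow> Y \<in> S \<Longrightarrow> X * Y \<in> S"
    and nz: "X \<in> S" "X \<noteq> 0\<^sub>m n n"
  obtains T0 where "T0 \<in> S" "T0 \<noteq> 0\<^sub>m n n" "\<And>T. T \<in> S \<Longrightarrow> \<exists>c. T0 * T * T0 = c \<cdot>\<^sub>m T0"
proof -
  have SC: "S \<subseteq> carrier_mat n n" using S by (simp add: matrix_subspace_def)
  \<comment> \<open>\<open>ok r\<close>: some nonzero element of \<open>S\<close> has a kernel of dimension at least \<open>r\<close>\<close>
  define ok where "ok r \<longleftrightarrow> r \<le> n \<and> (\<exists>P \<in> carrier_mat n n. \<exists>T0\<in>S. T0 \<noteq> 0\<^sub>m n n \<and> det P \<noteq> 0 \<and>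
      (\<forall>s<r. T0 *\<^sub>v col P s = 0\<^sub>v n))" for r
  have "ok 0" using nz unfolding ok_def by (intro conjI bexI[of _ "1\<^sub>m n"] bexI[of _ X]) auto
  moreover have "\<forall>r. ok r \<longrightarrow> r \<le> n" by (simp add: ok_def)
  ultimately obtain r where r: "ok r" and max: "\<And>s. ok s \<Longrightarrow> s \<le> r"
    using Nat.ex_has_greatest_nat[of ok 0 n] by blast
  then obtain P T0 where P: "P \<in> carrier_mat n n" "det P \<noteq> 0" and "r \<le> n"
    and T0: "T0 \<in> S" "T0 \<noteq> 0\<^sub>m n n" "\<And>s. s < r \<Longrightarrow> T0 *\<^sub>v col P s = 0\<^sub>v n"
    by (auto simp: ok_def)
  have T0c: "T0 \<in> carrier_mat n n" using T0 SC by auto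
  obtain Q where Q: "Q \<in> carrier_mat n n" "P * Q = 1\<^sub>m n" "Q * P = 1\<^sub>m n"
    and PQv': "\<forall>v\<in>carrier_vec n. P *\<^sub>v (Q *\<^sub>v v) = v" by (rule det_nonzero_inverse[OF P(1,2)])
  note PQv = bspec[OF PQv']
  have T0P: "T0 *\<^sub>v (P *\<^sub>v e) = 0\<^sub>v n" if "e \<in> carrier_vec n" "\<And>i. r \<le> i \<Longrightarrow> i < n \<Longrightarrow> e $ i = 0" for e
  proof -
    have "P *\<^sub>v e \<in> {v \<in> carrier_vec n. T0 *\<^sub>v v = 0\<^sub>v n}"
      using T0(3) P \<open>r \<le> n\<close> that
      by (intro subspace_contains_leading_combinations[OF P(1) kernel_is_vec_subspace[OF T0c] _ \<open>r \<le> n\<close>]) auto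
    then show ?thesis by simp
  qed
  have "r < n"
  proof (rule ccontr)
    assume "\<not> r < n"
    obtain i j where ij: "i < n" "j < n" "T0 $$ (i, j) \<noteq> 0" by (rule nonzero_mat_entry[OF T0c T0(2)])
    have "T0 *\<^sub>v (P *\<^sub>v (Q *\<^sub>v unit_vec n j)) = 0\<^sub>v n" using \<open>\<not> r < n\<close> Q by (intro T0P) auto
    then have "T0 *\<^sub>v unit_vec n j = 0\<^sub>v n" using PQv by simp
    moreover have "(T0 *\<^sub>v unit_vec n j) $ i \<noteq> 0" using ij T0c by (simp add: mult_mat_unit_vec)
    ultimately show False using ij(1) by simp
  qed
  show thesis
  proof (rule that[OF T0(1,2)])
    fix T assume T: "T \<in> S"
    have Tc: "T \<in> carrier_mat n n" using T SC by auto
    define M where "M = Q * (T * T0 * P)"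
    have M: "M \<in> carrier_mat n n" using Q P(1) Tc T0c by (simp add: M_def)
    define N where "N = mat (n - r) (n - r) (\<lambda>(i, j). M $$ (i + r, j + r))"
    have N: "N \<in> carrier_mat (n - r) (n - r)" by (simp add: N_def)
    obtain c where "eigenvalue N c"
      using spectrum_non_empty[OF N] \<open>r < n\<close> by (auto simp: spectrum_def)
    then obtain v where v: "v \<in> carrier_vec (n - r)" "v \<noteq> 0\<^sub>v (n - r)" "N *\<^sub>v v = c \<cdot>\<^sub>v v"
      using N by (auto simp: eigenvalue_def eigenvector_def)
    define e where "e = vec n (\<lambda>i. if i < r then 0 else v $ (i - r))"
    have e: "e \<in> carrier_vec n" by (simp add: e_def)
    obtain i\<^sub>0 where i0: "i\<^sub>0 < n - r" "v $ i\<^sub>0 \<noteq> 0" using v(1,2) by (metis carrier_vecD eq_vecI index_zero_vec)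
    have i: "r \<le> i\<^sub>0 + r" "i\<^sub>0 + r < n" "e $ (i\<^sub>0 + r) \<noteq> 0" using i0 by (auto simp: e_def)
    define u where "u = P *\<^sub>v e"
    have u: "u \<in> carrier_vec n" using P(1) e by (simp add: u_def)
    have "(M *\<^sub>v e + (- c) \<cdot>\<^sub>v e) $ i = 0" if i: "r \<le> i" "i < n" for i
    proof -
      have "(M *\<^sub>v e) $ i = (\<Sum>j<r + (n - r). M $$ (i, j) * e $ j)"
        using i M e \<open>r < n\<close> by (simp add: scalar_prod_def atLeast0LessThan)
      also have "\<dots> = (\<Sum>j<n - r. M $$ (i, r + j) * e $ (r + j))"
      proof -
        have "(\<Sum>j<r + k. M $$ (i, j) * e $ j) = (\<Sum>j<k. M $$ (i, r + j) * e $ (r + j))" if "r + k \<le> n" for k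
          using that by (induction k) (auto simp: e_def)
        from this[of "n - r"] show ?thesis using \<open>r < n\<close> by simp
      qed
      also have "\<dots> = (N *\<^sub>v v) $ (i - r)"
        using i v(1) by (simp add: N_def e_def scalar_prod_def atLeast0LessThan add.commute)
      also have "\<dots> = c * e $ i" using i v by (simp add: e_def)
      finally show ?thesis using i e M by simp
    qed
    then have "T0 *\<^sub>v (P *\<^sub>v (M *\<^sub>v e + (- c) \<cdot>\<^sub>v e)) = 0\<^sub>v n" using M e by (intro T0P) auto
    moreover have "P *\<^sub>v (M *\<^sub>v e + (- c) \<cdot>\<^sub>v e) = T *\<^sub>v (T0 *\<^sub>v u) + (- c) \<cdot>\<^sub>v u"
    proof -
      have "P *\<^sub>v (M *\<^sub>v e) = T *\<^sub>v (T0 *\<^sub>v u)"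
        unfolding M_def u_def using P(1) Q(1) Tc T0c e PQv
        by (simp add: assoc_mult_mat_vec[of _ n n _ n])
      then show ?thesis using P(1) M e by (simp add: u_def mult_add_distrib_mat_vec[of _ n n] mult_mat_vec[of _ n n])
    qed
    ultimately have T0u: "T0 *\<^sub>v (T *\<^sub>v (T0 *\<^sub>v u)) + (- c) \<cdot>\<^sub>v (T0 *\<^sub>v u) = 0\<^sub>v n"
      using T0c Tc u by (simp add: mult_add_distrib_mat_vec[of _ n n] mult_mat_vec[of _ n n])
    define T1 where "T1 = T0 * T * T0 + (- c) \<cdot>\<^sub>m T0"
    have T1: "T1 \<in> S" using S T0(1) T mult by (auto simp: T1_def matrix_subspace_def)
    have T1v: "T1 *\<^sub>v v = T0 *\<^sub>v (T *\<^sub>v (T0 *\<^sub>v v)) + (- c) \<cdot>\<^sub>v (T0 *\<^sub>v v)" if "v \<in> carrier_vec n" for v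
    proof -
      have "((- c) \<cdot>\<^sub>m T0) *\<^sub>v v = (- c) \<cdot>\<^sub>v (T0 *\<^sub>v v)"
        using T0c that by (intro eq_vecI) auto
      then show ?thesis unfolding T1_def using T0c Tc that
        by (subst add_mult_distrib_mat_vec[of _ n n]) (auto simp: assoc_mult_mat_vec[of _ n n _ n])
    qed
    have "T1 = 0\<^sub>m n n"
    proof (rule ccontr)
      assume ne: "T1 \<noteq> 0\<^sub>m n n"
      obtain P' where P': "P' \<in> carrier_mat n n" "det P' \<noteq> 0" "\<And>s. s < r \<Longrightarrow> col P' s = col P s"
        "col P' r = P *\<^sub>v e" using exchange_column[OF P e i] by blast
      have "T1 *\<^sub>v col P' s = 0\<^sub>v n" if "s < Suc r" for s
      proof (cases "s = r")
        case True
        show ?thesis unfolding True P'(4) using T1v[OF u] T0u by (simp add: u_def)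
      next
        case False
        then have s: "s < r" using that by simp
        have "col P s \<in> carrier_vec n" using s P i by auto
        moreover have "T0 *\<^sub>v (T *\<^sub>v 0\<^sub>v n) = 0\<^sub>v n"
          using mult_mat_zero_vec[OF Tc] mult_mat_zero_vec[OF T0c] by simp
        ultimately show ?thesis using T1v[of "col P s"] P'(3)[OF s] T0(3)[OF s] by auto
      qed
      then have "ok (Suc r)" unfolding ok_def using P' T1 ne i by (intro conjI bexI[of _ P'] bexI[of _ T1]) auto
      then show False using max[of "Suc r"] by simp
    qed
    show "\<exists>c. T0 * T * T0 = c \<cdot>\<^sub>m T0"
    proof (intro exI[of _ c] eq_matI)
      fix i j assume "i < dim_row (c \<cdot>\<^sub>m T0)" "j < dim_col (c \<cdot>\<^sub>m T0)"
      then have "T1 $$ (i, j) = 0" "i < n" "j < n" using \<open>T1 = 0\<^sub>m n n\<close> T0c by auto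
      then show "(T0 * T * T0) $$ (i, j) = (c \<cdot>\<^sub>m T0) $$ (i, j)"
        using T0c Tc by (simp add: T1_def)
    qed (use T0c Tc in auto)
  qed
qed

text \<open>
  The matrix \<open>T0\<close> of the previous lemma has rank one: by transitivity every \<open>T0 *\<^sub>v w\<close> is of the form
  \<open>T0 * T *\<^sub>v (T0 *\<^sub>v v)\<close>, hence a multiple of \<open>T0 *\<^sub>v v\<close>. So \<open>T0\<close> is the product of a column \<open>y\<close> and a row \<open>f\<close>.
  Transitivity on columns carries \<open>y\<close> to any basis vector. It also gives transitivity on rows, since a
  proper subspace of rows would be annihilated by some \<open>x \<noteq> 0\<close>. Multiplying \<open>T0\<close> from both sides
  therefore yields all matrix units. That the identity matrix is among the conclusions
  is what identifies images of ideals.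
\<close>

theorem burnside_transitive_algebra:
  assumes S: "matrix_subspace n S" and mult: "\<And>X Y. X \<in> S \<Longrightarrow> Y \<in> S \<Longrightarrow> X * Y \<in> S"
    and trans: "transitive_on_vectors n S"
  shows "S = carrier_mat n n"
proof (cases "n = 0")
  case True
  have "X = 0\<^sub>m n n" if "X \<in> carrier_mat n n" for X :: "complex mat"
    using that True by (intro eq_matI) auto
  then show ?thesis using S by (auto simp: matrix_subspace_def)
next
  case False
  then have n: "n > 0" by simp
  have SC: "S \<subseteq> carrier_mat n n" using S by (simp add: matrix_subspace_def)
  obtain X where "X \<in> S" "X *\<^sub>v unit_vec n 0 = unit_vec n 0"
    using trans n unfolding transitive_on_vectors_def by (metis unit_vec_carrier unit_vec_nonzero)
  moreover have "0\<^sub>m n n *\<^sub>v unit_vec n 0 = (0\<^sub>v n :: complex vec)" by (intro eq_vecI) auto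
  ultimately have "X \<in> S" "X \<noteq> 0\<^sub>m n n" using unit_vec_nonzero[OF n, where ?'a = complex] by metis+
  then obtain T0 where T0: "T0 \<in> S" "T0 \<noteq> 0\<^sub>m n n" "\<And>T. T \<in> S \<Longrightarrow> \<exists>c. T0 * T * T0 = c \<cdot>\<^sub>m T0"
    using minimal_rank_element[OF S mult] by blast
  have T0c: "T0 \<in> carrier_mat n n" using T0 SC by auto
  obtain i\<^sub>0 s\<^sub>0 where i0: "i\<^sub>0 < n" "s\<^sub>0 < n" "T0 $$ (i\<^sub>0, s\<^sub>0) \<noteq> 0"
    by (rule nonzero_mat_entry[OF T0c T0(2)])
  define y where "y = col T0 s\<^sub>0"
  have "y $ i\<^sub>0 \<noteq> 0" using T0c i0 by (simp add: y_def)
  then have y: "y \<in> carrier_vec n" "y \<noteq> 0\<^sub>v n" using T0c i0(1) by (auto simp: y_def[symmetric]) (auto simp: y_def)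
  have "\<exists>c. \<forall>a<n. T0 $$ (a, t) = c * y $ a" if t: "t < n" for t
  proof -
    obtain T where T: "T \<in> S" "T *\<^sub>v y = unit_vec n t"
      using trans y unfolding transitive_on_vectors_def by (metis unit_vec_carrier)
    obtain c where c: "T0 * T * T0 = c \<cdot>\<^sub>m T0" using T0(3)[OF T(1)] by blast
    have Tc: "T \<in> carrier_mat n n" using T SC by auto
    have "col (T0 * T * T0) s\<^sub>0 = (T0 * T) *\<^sub>v y"
      unfolding y_def using T0c Tc i0 by (intro col_mult2) auto
    also have "\<dots> = col T0 t"
      using T0c Tc y T(2) t by (simp add: assoc_mult_mat_vec[of _ n n _ n] mult_mat_unit_vec)
    finally have "col T0 t = col (c \<cdot>\<^sub>m T0) s\<^sub>0" using c by simp
    then have "T0 $$ (a, t) = c * y $ a" if "a < n" for a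
    proof -
      have "T0 $$ (a, t) = col T0 t $ a" using that T0c t by simp
      also have "\<dots> = col (c \<cdot>\<^sub>m T0) s\<^sub>0 $ a" using \<open>col T0 t = _\<close> by simp
      also have "\<dots> = c * y $ a" using that T0c i0 by (simp add: y_def)
      finally show ?thesis .
    qed
    then show ?thesis by blast
  qed
  then obtain g where g: "\<And>t a. t < n \<Longrightarrow> a < n \<Longrightarrow> T0 $$ (a, t) = g t * y $ a" by metis
  define f where "f = vec n g"
  have f: "f \<in> carrier_vec n" "f $ s\<^sub>0 \<noteq> 0" using g[OF i0(2,1)] i0 by (auto simp: f_def)
  have T0fy: "T0 $$ (a, t) = y $ a * f $ t" if "a < n" "t < n" for a t
    using g[OF that(2,1)] that by (simp add: f_def)

  \<comment> \<open>rows are handled as columns of transposes: \<open>W\<close> is the orbit of the row \<open>f\<close>\<close>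
  define W where "W = {T *\<^sub>v f | T. T \<in> transpose_mat ` S}"
  have W: "vec_subspace n W" unfolding W_def by (rule orbit_is_vec_subspace[OF matrix_subspace_transpose[OF S] f(1)])
  have Wfull: "v \<in> W" if v: "v \<in> carrier_vec n" for v
  proof -
    obtain P r where P: "P \<in> carrier_mat n n" "det P \<noteq> 0" "r \<le> n"
      and PW: "\<And>c. c \<in> carrier_vec n \<Longrightarrow> P *\<^sub>v c \<in> W \<longleftrightarrow> (\<forall>i. r \<le> i \<longrightarrow> i < n \<longrightarrow> c $ i = 0)"
      using subspace_adapted_frame[OF W] by blast
    obtain Q where Q: "Q \<in> carrier_mat n n" "P * Q = 1\<^sub>m n" "Q * P = 1\<^sub>m n"
      and PQv': "\<forall>v\<in>carrier_vec n. P *\<^sub>v (Q *\<^sub>v v) = v" by (rule det_nonzero_inverse[OF P(1,2)])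
    note PQv = bspec[OF PQv']
    have "r = n"
    proof (rule ccontr)
      assume "r \<noteq> n"
      then have r: "r < n" using P by simp
      define x where "x = row Q r"
      have x: "x \<in> carrier_vec n" using Q r by (simp add: x_def)
      have "x \<bullet> col P r = 1"
        using index_mult_mat(1)[of r Q r P] r P(1) Q by (simp add: x_def)
      then have "x \<noteq> 0\<^sub>v n" using P r by auto
      then obtain T where T: "T \<in> S" "T *\<^sub>v x = unit_vec n s\<^sub>0"
        using trans x unfolding transitive_on_vectors_def by (metis unit_vec_carrier)
      have Tc: "T \<in> carrier_mat n n" using T SC by auto
      define w where "w = transpose_mat T *\<^sub>v f"
      have w: "w \<in> W" "w \<in> carrier_vec n" using T Tc f by (auto simp: w_def W_def)
      have "(Q *\<^sub>v w) $ r = 0" using PW[of "Q *\<^sub>v w"] PQv[OF w(2)] w Q r by auto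
      then have "x \<bullet> w = 0" using Q r by (simp add: x_def)
      moreover have "x \<bullet> w = f \<bullet> (T *\<^sub>v x)"
        unfolding w_def using x f Tc
        by (metis comm_scalar_prod mult_mat_vec_carrier transpose_carrier_mat transpose_vec_mult_scalar)
      moreover have "f \<bullet> (T *\<^sub>v x) = f $ s\<^sub>0" using f i0 T by simp
      ultimately show False using f by simp
    qed
    then have "P *\<^sub>v (Q *\<^sub>v v) \<in> W" using PW[of "Q *\<^sub>v v"] Q v by auto
    then show ?thesis using PQv[OF v] by simp
  qed

  have unit: "mat n n (\<lambda>p. if p = (a, b) then c else 0) \<in> S" if ab: "a < n" "b < n" for a b c
  proof -
    obtain T where T: "T \<in> S" "T *\<^sub>v y = unit_vec n a"
      using trans y unfolding transitive_on_vectors_def by (metis unit_vec_carrier)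
    obtain T' where T': "T' \<in> S" "transpose_mat T' *\<^sub>v f = unit_vec n b"
      using Wfull[of "unit_vec n b"] by (auto simp: W_def)
    have Tc: "T \<in> carrier_mat n n" "T' \<in> carrier_mat n n" using T T' SC by auto
    define Z where "Z = T0 * T'"
    have Z: "Z \<in> carrier_mat n n" using T0c Tc by (simp add: Z_def)
    have Zy: "Z $$ (k, j) = y $ k * (transpose_mat T' *\<^sub>v f) $ j" if "k < n" "j < n" for k j
      using that Tc T0c f by (simp add: Z_def scalar_prod_def T0fy sum_distrib_left mult_ac)
    have "(T * Z) $$ (i, j) = (if (i, j) = (a, b) then 1 else 0)" if ij: "i < n" "j < n" for i j
    proof -
      have "(T * Z) $$ (i, j) = (\<Sum>k<n. T $$ (i, k) * Z $$ (k, j))"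
        using ij Tc Z by (simp add: scalar_prod_def atLeast0LessThan)
      also have "\<dots> = (T *\<^sub>v y) $ i * (transpose_mat T' *\<^sub>v f) $ j"
        using ij Tc y Zy by (simp add: scalar_prod_def atLeast0LessThan sum_distrib_right mult_ac)
      also have "\<dots> = (if (i, j) = (a, b) then 1 else 0)" using T(2) T'(2) ij ab by simp
      finally show ?thesis .
    qed
    then have "mat n n (\<lambda>p. if p = (a, b) then c else 0) = c \<cdot>\<^sub>m (T * Z)"
      using Tc Z by (intro eq_matI) (auto simp del: index_mult_mat(1))
    moreover have "Z \<in> S" using T'(1) T0(1) mult by (simp add: Z_def)
    ultimately show ?thesis using T(1) mult S by (auto simp: matrix_subspace_def)
  qed
  have "X \<in> S" if X: "X \<in> carrier_mat n n" for X
  proof -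
    have "mat n n (\<lambda>p. if p \<in> F then X $$ p else 0) \<in> S" if "finite F" "F \<subseteq> {..<n} \<times> {..<n}" for F
      using that
    proof (induction F)
      case empty
      have "mat n n (\<lambda>p. if p \<in> {} then X $$ p else 0) = 0\<^sub>m n n" by (intro eq_matI) auto
      then show ?case using S by (simp add: matrix_subspace_def)
    next
      case (insert q F)
      obtain a b where q: "q = (a, b)" "a < n" "b < n" using insert by auto
      have "mat n n (\<lambda>p. if p \<in> insert q F then X $$ p else 0) =
          mat n n (\<lambda>p. if p = (a, b) then X $$ (a, b) else 0) + mat n n (\<lambda>p. if p \<in> F then X $$ p else 0)"
        using insert q by (intro eq_matI) auto
      then show ?case using insert unit[OF q(2,3)] S by (auto simp: matrix_subspace_def)
    qed
    from this[of "{..<n} \<times> {..<n}"] have "mat n n (\<lambda>p. if p \<in> {..<n} \<times> {..<n} then X $$ p else 0) \<in> S" by simp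
    moreover have "mat n n (\<lambda>p. if p \<in> {..<n} \<times> {..<n} then X $$ p else 0) = X" using X by (intro eq_matI) auto
    ultimately show ?thesis by simp
  qed
  then show ?thesis using SC by auto
qed


section \<open>Matrix representations and the regular representation\<close>

definition linear_functional :: "'a complex_alg \<Rightarrow> ('a \<Rightarrow> complex) \<Rightarrow> bool" where
  "linear_functional A f \<longleftrightarrow> (\<forall>x\<in>carrier A. \<forall>y\<in>carrier A. f (x \<oplus>\<^bsub>A\<^esub> y) = f x + f y) \<and>
     (\<forall>c. \<forall>x\<in>carrier A. f (c \<odot>\<^bsub>A\<^esub> x) = c * f x)"

text \<open>
  A basis \<open>b\<close> of the algebra together with its dual basis \<open>f\<close>.
\<close>

definition coordinate_system :: "'a complex_alg \<Rightarrow> nat \<Rightarrow> (nat \<Rightarrow> 'a) \<Rightarrow> (nat \<Rightarrow> 'a \<Rightarrow> complex) \<Rightarrow> bool" where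
  "coordinate_system A N b f \<longleftrightarrow> (\<forall>i<N. b i \<in> carrier A \<and> linear_functional A (f i)) \<and>
     (\<forall>x\<in>carrier A. x = (\<Oplus>\<^bsub>A\<^esub>i\<in>{..<N}. f i x \<odot>\<^bsub>A\<^esub> b i)) \<and>
     (\<forall>i<N. \<forall>j<N. f i (b j) = (if i = j then 1 else 0))"

lemma coordinate_systemD:
  assumes "coordinate_system A N b f"
  shows "i < N \<Longrightarrow> b i \<in> carrier A" "i < N \<Longrightarrow> linear_functional A (f i)"
    "x \<in> carrier A \<Longrightarrow> x = (\<Oplus>\<^bsub>A\<^esub>i\<in>{..<N}. f i x \<odot>\<^bsub>A\<^esub> b i)"
    "i < N \<Longrightarrow> j < N \<Longrightarrow> f i (b j) = (if i = j then 1 else 0)"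
  using assms unfolding coordinate_system_def by blast+

definition matrix_rep :: "'a complex_alg \<Rightarrow> nat \<Rightarrow> ('a \<Rightarrow> complex mat) \<Rightarrow> bool" where
  "matrix_rep A n \<rho> \<longleftrightarrow> (\<forall>a\<in>carrier A. \<rho> a \<in> carrier_mat n n) \<and> \<rho> \<one>\<^bsub>A\<^esub> = 1\<^sub>m n \<and>
     (\<forall>a\<in>carrier A. \<forall>b\<in>carrier A. \<rho> (a \<oplus>\<^bsub>A\<^esub> b) = \<rho> a + \<rho> b \<and> \<rho> (a \<otimes>\<^bsub>A\<^esub> b) = \<rho> a * \<rho> b) \<and>
     (\<forall>c. \<forall>a\<in>carrier A. \<rho> (c \<odot>\<^bsub>A\<^esub> a) = c \<cdot>\<^sub>m \<rho> a)"

lemma matrix_repD: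
  assumes "matrix_rep A n \<rho>"
  shows "a \<in> carrier A \<Longrightarrow> \<rho> a \<in> carrier_mat n n" "\<rho> \<one>\<^bsub>A\<^esub> = 1\<^sub>m n"
    "a \<in> carrier A \<Longrightarrow> b \<in> carrier A \<Longrightarrow> \<rho> (a \<oplus>\<^bsub>A\<^esub> b) = \<rho> a + \<rho> b"
    "a \<in> carrier A \<Longrightarrow> b \<in> carrier A \<Longrightarrow> \<rho> (a \<otimes>\<^bsub>A\<^esub> b) = \<rho> a * \<rho> b"
    "a \<in> carrier A \<Longrightarrow> \<rho> (c \<odot>\<^bsub>A\<^esub> a) = c \<cdot>\<^sub>m \<rho> a"
  using assms by (auto simp: matrix_rep_def)

definition rep_kernel :: "'a complex_alg \<Rightarrow> nat \<Rightarrow> ('a \<Rightarrow> complex mat) \<Rightarrow> 'a set" where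
  "rep_kernel A n \<rho> = {a \<in> carrier A. \<rho> a = 0\<^sub>m n n}"

text \<open>
  Irreducibility is expressed by orbits: every nonzero vector is cyclic.
\<close>

definition irreducible_rep :: "'a complex_alg \<Rightarrow> nat \<Rightarrow> ('a \<Rightarrow> complex mat) \<Rightarrow> bool" where
  "irreducible_rep A n \<rho> \<longleftrightarrow> matrix_rep A n \<rho> \<and> n > 0 \<and> transitive_on_vectors n (\<rho> ` carrier A)"

context fd_complex_algebra
begin

lemma scalar_smult_closed [simp, intro]: "x \<in> carrier A \<Longrightarrow> c \<odot> x \<in> carrier A"
  using smult_closed[of c x] by simp

lemma linear_functional_sum:
  assumes f: "linear_functional A f" and "finite I" "\<And>i. i \<in> I \<Longrightarrow> x i \<in> carrier A"
  shows "f (\<Oplus>i\<in>I. c i \<odot> x i) = (\<Sum>i\<in>I. c i * f (x i))"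
  using assms(2,3)
proof (induction I)
  case empty
  have "f (0 \<odot> \<zero>) = 0 * f \<zero>" using f zero_closed unfolding linear_functional_def by blast
  moreover have "0 \<odot> \<zero> = \<zero>" using smult_l_null[of \<zero>] by simp
  ultimately show ?case by simp
next
  case (insert i I)
  have "(\<Oplus>i\<in>insert i I. c i \<odot> x i) = c i \<odot> x i \<oplus> (\<Oplus>i\<in>I. c i \<odot> x i)"
    using insert by (intro finsum_insert) auto
  then show ?case using insert f by (simp add: linear_functional_def finsum_closed Pi_def)
qed

lemma coordinates_exist:
  obtains N b f where "coordinate_system A N b f"
proof -
  obtain \<beta> where \<beta>: "finite \<beta>" "basis \<beta>" using finite_basis_exists[OF fin_dim] by blast
  have \<beta>C: "\<beta> \<subseteq> carrier A" using \<beta>(2) by (simp add: basis_def)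
  have uniq: "\<exists>!a. a \<in> \<beta> \<rightarrow>\<^sub>E UNIV \<and> lincomb a \<beta> = v" if "v \<in> carrier A" for v
    using basis_criterion[OF \<beta>(1) \<beta>C] \<beta>(2) that by auto
  define co where "co v = (THE a. a \<in> \<beta> \<rightarrow>\<^sub>E UNIV \<and> lincomb a \<beta> = v)" for v
  have co: "co v \<in> \<beta> \<rightarrow>\<^sub>E UNIV" "lincomb (co v) \<beta> = v" if "v \<in> carrier A" for v
    using theI'[OF uniq[OF that]] by (auto simp: co_def)
  have co_eq: "co v x = a x" if "v \<in> carrier A" "lincomb a \<beta> = v" "x \<in> \<beta>" for v a x
  proof -
    have "lincomb (restrict a \<beta>) \<beta> = lincomb a \<beta>"
      unfolding lincomb_def using \<beta>C by (intro finsum_cong') auto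
    then have "restrict a \<beta> = co v" using uniq[OF that(1)] co[OF that(1)] that(2) by (metis (no_types, lifting) UNIV_I restrict_PiE_iff)
    then show ?thesis using that(3) by (metis restrict_apply')
  qed
  obtain g where g: "bij_betw g {..<card \<beta>} \<beta>"
    using ex_bij_betw_nat_finite[OF \<beta>(1)] by (metis atLeast0LessThan)
  have gC: "g i \<in> carrier A" "g i \<in> \<beta>" if "i < card \<beta>" for i
    using g that \<beta>C by (auto simp: bij_betw_def)
  have "coordinate_system A (card \<beta>) g (\<lambda>i v. co v (g i))"
    unfolding coordinate_system_def
  proof (intro conjI allI impI ballI)
    show "g i \<in> carrier A" if "i < card \<beta>" for i using gC that by simp
    show "linear_functional A (\<lambda>v. co v (g i))" if i: "i < card \<beta>" for i
      unfolding linear_functional_def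
    proof (intro conjI ballI allI)
      fix x y assume xy: "x \<in> carrier A" "y \<in> carrier A"
      have "lincomb (\<lambda>w. co x w + co y w) \<beta> = lincomb (co x) \<beta> \<oplus> lincomb (co y) \<beta>"
        using lincomb_sum[OF \<beta>(1) \<beta>C, of "co x" "co y"] by simp
      then show "co (x \<oplus> y) (g i) = co x (g i) + co y (g i)"
        using co_eq[of "x \<oplus> y" "\<lambda>w. co x w + co y w"] co(2) xy gC[OF i] by simp
    next
      fix c x assume x: "x \<in> carrier A"
      have "lincomb (\<lambda>w. c * co x w) \<beta> = c \<odot> lincomb (co x) \<beta>"
        using lincomb_smult[OF \<beta>C, of "co x" c] by simp
      then show "co (c \<odot> x) (g i) = c * co x (g i)"
        using co_eq[of "c \<odot> x" "\<lambda>w. c * co x w"] co(2) x gC[OF i] by simp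
    qed
    show "x = (\<Oplus>i\<in>{..<card \<beta>}. co x (g i) \<odot> g i)" if x: "x \<in> carrier A" for x
    proof -
      have "x = (\<Oplus>v\<in>g ` {..<card \<beta>}. co x v \<odot> v)"
        using co(2)[OF x] g by (simp add: lincomb_def bij_betw_def)
      also have "\<dots> = (\<Oplus>i\<in>{..<card \<beta>}. co x (g i) \<odot> g i)"
        using g \<beta>C by (intro finsum_reindex) (auto simp: bij_betw_def)
      finally show ?thesis .
    qed
    show "co (g j) (g i) = (if i = j then 1 else 0)" if ij: "i < card \<beta>" "j < card \<beta>" for i j
    proof -
      have "lincomb (\<lambda>w. if w = g j then 1 else 0) \<beta> = (\<Oplus>w\<in>\<beta>. if g j = w then w else \<zero>)"
        unfolding lincomb_def using \<beta>C smult_l_null smult_one by (intro finsum_cong') auto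
      also have "\<dots> = g j" using finsum_singleton[of "g j" \<beta> "\<lambda>w. w"] gC[OF ij(2)] \<beta> \<beta>C by auto
      finally have "co (g j) (g i) = (if g i = g j then 1 else 0)"
        using co_eq[of "g j" "\<lambda>w. if w = g j then 1 else 0" "g i"] gC ij by simp
      then show ?thesis using g ij by (auto simp: bij_betw_def inj_on_def)
    qed
  qed
  then show thesis by (rule that)
qed

lemma matrix_rep_zero: "matrix_rep A n \<rho> \<Longrightarrow> \<rho> \<zero> = 0\<^sub>m n n"
proof -
  assume \<rho>: "matrix_rep A n \<rho>"
  have "\<zero> = 0 \<odot> \<zero>" using smult_l_null[of \<zero>] by simp
  then have "\<rho> \<zero> = 0 \<cdot>\<^sub>m \<rho> \<zero>" using matrix_repD(5)[OF \<rho>, of \<zero> 0] by simp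
  also have "\<dots> = 0\<^sub>m n n" using matrix_repD(1)[OF \<rho>, of \<zero>] by (intro eq_matI) auto
  finally show ?thesis .
qed

lemma uminus_eq_smult: "x \<in> carrier A \<Longrightarrow> \<ominus> x = (- 1) \<odot> x"
  using smult_l_minus[of 1 x] smult_one[of x] by (simp add: class_ring_simps)

lemma matrix_rep_minus:
  assumes \<rho>: "matrix_rep A n \<rho>" and "a \<in> carrier A" "b \<in> carrier A"
  shows "\<rho> (a \<ominus> b) = \<rho> a - \<rho> b"
proof -
  have "\<rho> (a \<ominus> b) = \<rho> a + (- 1) \<cdot>\<^sub>m \<rho> b"
    unfolding a_minus_def using assms by (simp add: matrix_repD[OF \<rho>] uminus_eq_smult)
  then show ?thesis using matrix_repD(1)[OF \<rho>] assms(2,3) by (intro eq_matI) auto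
qed

lemma matrix_rep_unit:
  assumes \<rho>: "matrix_rep A n \<rho>" and a: "a \<in> Units A"
  shows "det (\<rho> a) \<noteq> 0"
proof -
  obtain b where b: "b \<in> carrier A" "a \<otimes> b = \<one>" "a \<in> carrier A" using a by (auto simp: Units_def)
  then have "\<rho> a * \<rho> b = 1\<^sub>m n" using matrix_repD[OF \<rho>] by metis
  then have "det (\<rho> a) * det (\<rho> b) = 1"
    using det_mult[of "\<rho> a" n "\<rho> b"] b matrix_repD(1)[OF \<rho>] by simp
  then show ?thesis by auto
qed

text \<open>
  Left multiplication in coordinates. A nonzero determinant makes \<open>x \<mapsto> a \<otimes> x\<close> onto, which gives a
  right inverse of \<open>a\<close>; that it is also a left inverse follows from the same fact for square matrices,
  because the regular representation is faithful.
\<close>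

lemma regular_representation:
  obtains n \<rho> where "matrix_rep A n \<rho>" "\<And>a. a \<in> carrier A \<Longrightarrow> a \<in> Units A \<longleftrightarrow> det (\<rho> a) \<noteq> 0"
proof -
  obtain N b f where cs: "coordinate_system A N b f" by (rule coordinates_exist)
  note b = coordinate_systemD(1)[OF cs] and f = coordinate_systemD(2)[OF cs]
    and rep = coordinate_systemD(3)[OF cs] and fb = coordinate_systemD(4)[OF cs]
  define \<rho> where "\<rho> a = mat N N (\<lambda>(i, j). f i (a \<otimes> b j))" for a
  define vc where "vc x = vec N (\<lambda>i. f i x)" for x
  have \<rho>c: "\<rho> a \<in> carrier_mat N N" for a by (simp add: \<rho>_def)
  have vcc: "vc x \<in> carrier_vec N" for x by (simp add: vc_def)
  have vc_inj: "x = y" if "vc x = vc y" "x \<in> carrier A" "y \<in> carrier A" for x y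
  proof -
    have "f i x = f i y" if "i < N" for i
      using arg_cong[OF \<open>vc x = vc y\<close>, of "\<lambda>v. v $ i"] that by (simp add: vc_def)
    then have "(\<Oplus>i\<in>{..<N}. f i x \<odot> b i) = (\<Oplus>i\<in>{..<N}. f i y \<odot> b i)"
      using b by (intro finsum_cong') auto
    then show ?thesis using rep that by metis
  qed
  have action: "\<rho> a *\<^sub>v vc x = vc (a \<otimes> x)" if a: "a \<in> carrier A" and x: "x \<in> carrier A" for a x
  proof (rule eq_vecI)
    fix i assume "i < dim_vec (vc (a \<otimes> x))"
    then have i: "i < N" by (simp add: vc_def)
    have "a \<otimes> x = (\<Oplus>j\<in>{..<N}. a \<otimes> (f j x \<odot> b j))"
      using rep[OF x] finsum_rdistr[of "{..<N}" a "\<lambda>j. f j x \<odot> b j"] a b by auto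
    also have "\<dots> = (\<Oplus>j\<in>{..<N}. f j x \<odot> (a \<otimes> b j))"
      using a b smult_mult_right by (intro finsum_cong') auto
    finally have "f i (a \<otimes> x) = (\<Sum>j<N. f j x * f i (a \<otimes> b j))"
      using linear_functional_sum[OF f[OF i], of "{..<N}" "\<lambda>j. a \<otimes> b j" "\<lambda>j. f j x"] a b by simp
    then show "(\<rho> a *\<^sub>v vc x) $ i = vc (a \<otimes> x) $ i"
      using i by (simp add: \<rho>_def vc_def scalar_prod_def atLeast0LessThan mult.commute)
  qed (simp add: \<rho>_def vc_def)
  have col\<rho>: "col (\<rho> a) j = vc (a \<otimes> b j)" if "j < N" for a j
    using that by (intro eq_vecI) (auto simp: \<rho>_def vc_def)
  have \<rho>d: "dim_row (\<rho> a) = N" "dim_col (\<rho> a) = N" for a by (simp_all add: \<rho>_def)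
  have mult: "\<rho> (a \<otimes> c) = \<rho> a * \<rho> c" if a: "a \<in> carrier A" and c: "c \<in> carrier A" for a c
  proof (rule eq_matI)
    fix i j assume "i < dim_row (\<rho> a * \<rho> c)" "j < dim_col (\<rho> a * \<rho> c)"
    then have ij: "i < N" "j < N" by (simp_all add: \<rho>d)
    have "\<rho> (a \<otimes> c) $$ (i, j) = vc (a \<otimes> (c \<otimes> b j)) $ i"
      using ij a c b by (simp add: \<rho>_def vc_def m_assoc)
    also have "\<dots> = (\<rho> a *\<^sub>v col (\<rho> c) j) $ i" using action a c b ij by (simp add: col\<rho>)
    also have "\<dots> = (\<rho> a * \<rho> c) $$ (i, j)" using ij \<rho>d by (metis index_mult_mat(1) index_mult_mat_vec)
    finally show "\<rho> (a \<otimes> c) $$ (i, j) = (\<rho> a * \<rho> c) $$ (i, j)" .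
  qed (simp_all add: \<rho>d)
  have "\<rho> \<one> = 1\<^sub>m N" using b fb by (intro eq_matI) (auto simp: \<rho>_def)
  moreover have "\<rho> (a \<oplus> c) = \<rho> a + \<rho> c" if "a \<in> carrier A" "c \<in> carrier A" for a c
    using that b f by (intro eq_matI) (auto simp: \<rho>_def l_distr linear_functional_def)
  moreover have "\<rho> (c \<odot> a) = c \<cdot>\<^sub>m \<rho> a" if "a \<in> carrier A" for c a
    using that b f by (intro eq_matI) (auto simp: \<rho>_def linear_functional_def smult_mult_left[symmetric])
  ultimately have \<rho>: "matrix_rep A N \<rho>"
    using mult \<rho>c unfolding matrix_rep_def by simp
  show thesis
  proof (rule that[OF \<rho>])
    fix a assume a: "a \<in> carrier A"
    show "a \<in> Units A \<longleftrightarrow> det (\<rho> a) \<noteq> 0"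
    proof
      assume d: "det (\<rho> a) \<noteq> 0"
      obtain Q where Q: "Q \<in> carrier_mat N N" "\<rho> a * Q = 1\<^sub>m N" "Q * \<rho> a = 1\<^sub>m N"
        using det_nonzero_inverse[OF \<rho>c d] by blast
      define v where "v = Q *\<^sub>v vc \<one>"
      have v: "v \<in> carrier_vec N" using Q vcc by (simp add: v_def)
      define x where "x = (\<Oplus>i\<in>{..<N}. v $ i \<odot> b i)"
      have x: "x \<in> carrier A" unfolding x_def using b by (intro finsum_closed) auto
      have "vc x = v"
      proof (rule eq_vecI)
        fix i assume "i < dim_vec v"
        then have i: "i < N" using v by simp
        have "f i x = (\<Sum>j<N. v $ j * f i (b j))"
          unfolding x_def using b by (intro linear_functional_sum[OF f[OF i]]) auto
        also have "\<dots> = (\<Sum>j<N. if j = i then v $ j else 0)" using fb i by (intro sum.cong) auto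
        finally show "vc x $ i = v $ i" using i by (simp add: vc_def)
      qed (use v vcc in auto)
      then have "vc (a \<otimes> x) = \<rho> a *\<^sub>v (Q *\<^sub>v vc \<one>)" using action[OF a x] by (simp add: v_def)
      also have "\<dots> = vc \<one>" using Q \<rho>c vcc by (metis assoc_mult_mat_vec one_mult_mat_vec)
      finally have ax: "a \<otimes> x = \<one>" using vc_inj a x by blast
      then have "\<rho> a * \<rho> x = 1\<^sub>m N" using matrix_repD(2,4)[OF \<rho>] a x by metis
      then have "\<rho> x * \<rho> a = 1\<^sub>m N" using \<rho>c mat_mult_left_right_inverse by blast
      then have "\<rho> (x \<otimes> a) *\<^sub>v vc \<one> = vc \<one>" using matrix_repD(4)[OF \<rho>] a x vcc by simp
      then have "vc (x \<otimes> a) = vc \<one>" using action[of "x \<otimes> a" \<one>] a x by simp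
      then have "x \<otimes> a = \<one>" using vc_inj a x by blast
      then show "a \<in> Units A" using a x ax by (auto simp: Units_def)
    qed (rule matrix_rep_unit[OF \<rho>])
  qed
qed

end


section \<open>Composition factors of a representation\<close>

context fd_complex_algebra
begin

lemma ideal_smult_closed:
  assumes I: "ideal I A" and x: "x \<in> I"
  shows "c \<odot> x \<in> I"
proof -
  have xA: "x \<in> carrier A" using ideal.Icarr[OF I x] .
  have "c \<odot> x = (c \<odot> \<one>) \<otimes> x" using smult_mult_left[of \<one> x c] xA by simp
  then show ?thesis using ideal.I_l_closed[OF I x, of "c \<odot> \<one>"] by simp
qed

lemma ideal_zero: "ideal I A \<Longrightarrow> \<zero> \<in> I"
  by (simp add: additive_subgroup.zero_closed ideal.axioms(1))

lemma ideal_add: "ideal I A \<Longrightarrow> x \<in> I \<Longrightarrow> y \<in> I \<Longrightarrow> x \<oplus> y \<in> I"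
  by (simp add: additive_subgroup.a_closed ideal.axioms(1))

lemma rep_image_of_ideal:
  assumes \<rho>: "matrix_rep A n \<rho>" and J: "ideal J A"
  shows "matrix_subspace n (\<rho> ` J)"
    and "X \<in> \<rho> ` J \<Longrightarrow> Y \<in> \<rho> ` J \<Longrightarrow> X * Y \<in> \<rho> ` J"
proof -
  have JA: "x \<in> carrier A" if "x \<in> J" for x using ideal.Icarr[OF J that] .
  show "matrix_subspace n (\<rho> ` J)"
    unfolding matrix_subspace_def
  proof (intro conjI ballI allI)
    show "\<rho> ` J \<subseteq> carrier_mat n n" using matrix_repD(1)[OF \<rho>] JA by auto
    show "0\<^sub>m n n \<in> \<rho> ` J" using ideal_zero[OF J] matrix_rep_zero[OF \<rho>] by force
    show "X + Y \<in> \<rho> ` J" if "X \<in> \<rho> ` J" "Y \<in> \<rho> ` J" for X Y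
      using that ideal_add[OF J] matrix_repD(3)[OF \<rho> JA JA, symmetric] by auto
    show "k \<cdot>\<^sub>m X \<in> \<rho> ` J" if "X \<in> \<rho> ` J" for k X
      using that ideal_smult_closed[OF J] matrix_repD(5)[OF \<rho> JA, symmetric] by auto
  qed
  show "X * Y \<in> \<rho> ` J" if "X \<in> \<rho> ` J" "Y \<in> \<rho> ` J" for X Y
    using that ideal.I_l_closed[OF J _ JA] matrix_repD(4)[OF \<rho> JA JA, symmetric] by auto
qed

lemma matrix_rep_conjugate:
  assumes \<rho>: "matrix_rep A n \<rho>" and P: "P \<in> carrier_mat n n" "Q \<in> carrier_mat n n" "P * Q = 1\<^sub>m n" "Q * P = 1\<^sub>m n"
  shows "matrix_rep A n (\<lambda>a. Q * \<rho> a * P)"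
proof -
  have c: "\<rho> a \<in> carrier_mat n n" if "a \<in> carrier A" for a using matrix_repD(1)[OF \<rho> that] .
  have "Q * \<rho> (a \<oplus> b) * P = Q * \<rho> a * P + Q * \<rho> b * P" if "a \<in> carrier A" "b \<in> carrier A" for a b
    using c[OF that(1)] c[OF that(2)] P matrix_repD(3)[OF \<rho> that]
    by (simp add: mult_add_distrib_mat[of _ n n] add_mult_distrib_mat[of _ n n])
  moreover have "Q * \<rho> (a \<otimes> b) * P = (Q * \<rho> a * P) * (Q * \<rho> b * P)" if "a \<in> carrier A" "b \<in> carrier A" for a b
  proof -
    have "(Q * \<rho> a * P) * (Q * \<rho> b * P) = Q * \<rho> a * (P * Q) * (\<rho> b * P)"
      using c[OF that(1)] c[OF that(2)] P(1,2)
      by (simp add: assoc_mult_mat[of _ n n _ n _ n])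
    also have "\<dots> = Q * (\<rho> a * \<rho> b) * P"
      using c[OF that(1)] c[OF that(2)] P by (simp add: assoc_mult_mat[of _ n n _ n _ n])
    finally show ?thesis using matrix_repD(4)[OF \<rho> that] by simp
  qed
  moreover have "Q * \<rho> (k \<odot> a) * P = k \<cdot>\<^sub>m (Q * \<rho> a * P)" if "a \<in> carrier A" for k a
    using c[OF that] P(1,2) matrix_repD(5)[OF \<rho> that] 
    by (simp add: mult_smult_distrib[of _ n n _ n] mult_smult_assoc_mat[of _ n n _ n])
  moreover have "Q * \<rho> \<one> * P = 1\<^sub>m n" using P matrix_repD(2)[OF \<rho>] by simp
  moreover have "Q * \<rho> a * P \<in> carrier_mat n n" if "a \<in> carrier A" for a using c[OF that] P by simp
  ultimately show ?thesis unfolding matrix_rep_def by simp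
qed

lemma matrix_rep_diagonal_block:
  assumes \<sigma>: "matrix_rep A n \<sigma>" and k: "p + k \<le> n"
    and zero: "\<And>a b i j l. a \<in> carrier A \<Longrightarrow> b \<in> carrier A \<Longrightarrow> i \<in> {p..<p + k} \<Longrightarrow> j \<in> {p..<p + k} \<Longrightarrow>
      l < n \<Longrightarrow> l \<notin> {p..<p + k} \<Longrightarrow> \<sigma> a $$ (i, l) * \<sigma> b $$ (l, j) = 0"
  shows "matrix_rep A k (\<lambda>a. mat k k (\<lambda>(i, j). \<sigma> a $$ (i + p, j + p)))"
proof -
  have c: "\<sigma> a \<in> carrier_mat n n" if "a \<in> carrier A" for a using matrix_repD(1)[OF \<sigma> that] .
  have dims: "dim_row (\<sigma> a) = n" "dim_col (\<sigma> a) = n" if "a \<in> carrier A" for a using c[OF that] by auto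
  have mult: "\<sigma> (a \<otimes> b) $$ (i + p, j + p) = (\<Sum>l<k. \<sigma> a $$ (i + p, l + p) * \<sigma> b $$ (l + p, j + p))"
    if a: "a \<in> carrier A" and b: "b \<in> carrier A" and ij: "i < k" "j < k" for a b i j
  proof -
    have "\<sigma> (a \<otimes> b) $$ (i + p, j + p) = (\<Sum>l<n. \<sigma> a $$ (i + p, l) * \<sigma> b $$ (l, j + p))"
      unfolding matrix_repD(4)[OF \<sigma> a b] using ij k by (intro mult_mat_entry[OF c[OF a] c[OF b]]) auto
    also have "\<dots> = (\<Sum>l\<in>{0 + p..<k + p}. \<sigma> a $$ (i + p, l) * \<sigma> b $$ (l, j + p))"
      using ij k zero[OF a b] by (intro sum.mono_neutral_right) (auto simp: add.commute)
    also have "\<dots> = (\<Sum>l<k. \<sigma> a $$ (i + p, l + p) * \<sigma> b $$ (l + p, j + p))"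
      unfolding sum.shift_bounds_nat_ivl by (simp add: atLeast0LessThan)
    finally show ?thesis .
  qed
  show ?thesis
    unfolding matrix_rep_def using k dims
    by (auto intro!: eq_matI simp: matrix_repD(2,3,5)[OF \<sigma>] mult scalar_prod_def atLeast0LessThan)
qed

text \<open>
  The diagonal blocks of a block upper triangular representation are the subrepresentation and the
  quotient representation.
\<close>

lemma matrix_rep_diagonal_blocks:
  assumes \<sigma>: "matrix_rep A n \<sigma>" and r: "r \<le> n"
    and zero: "\<And>a i j. a \<in> carrier A \<Longrightarrow> r \<le> i \<Longrightarrow> i < n \<Longrightarrow> j < r \<Longrightarrow> \<sigma> a $$ (i, j) = 0"
  obtains \<rho>\<^sub>1 \<rho>\<^sub>2 where "matrix_rep A r \<rho>\<^sub>1" "matrix_rep A (n - r) \<rho>\<^sub>2"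
    "\<And>a. a \<in> carrier A \<Longrightarrow> det (\<sigma> a) = det (\<rho>\<^sub>1 a) * det (\<rho>\<^sub>2 a)"
proof -
  define \<rho>\<^sub>1 where "\<rho>\<^sub>1 a = mat r r (\<lambda>(i, j). \<sigma> a $$ (i + 0, j + 0))" for a
  define \<rho>\<^sub>2 where "\<rho>\<^sub>2 a = mat (n - r) (n - r) (\<lambda>(i, j). \<sigma> a $$ (i + r, j + r))" for a
  have "matrix_rep A r \<rho>\<^sub>1"
    unfolding \<rho>\<^sub>1_def using r zero by (intro matrix_rep_diagonal_block[OF \<sigma>]) auto
  moreover have "matrix_rep A (n - r) \<rho>\<^sub>2"
    unfolding \<rho>\<^sub>2_def using r zero by (intro matrix_rep_diagonal_block[OF \<sigma>]) auto
  moreover have "det (\<sigma> a) = det (\<rho>\<^sub>1 a) * det (\<rho>\<^sub>2 a)" if a: "a \<in> carrier A" for a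
  proof -
    have dims: "dim_row (\<sigma> a) = n" "dim_col (\<sigma> a) = n" using matrix_repD(1)[OF \<sigma> a] by auto
    define A2 where "A2 = mat r (n - r) (\<lambda>(i, j). \<sigma> a $$ (i, j + r))"
    have "\<sigma> a = four_block_mat (\<rho>\<^sub>1 a) A2 (0\<^sub>m (n - r) r) (\<rho>\<^sub>2 a)"
      using dims r zero[OF a] by (intro eq_matI) (auto simp: \<rho>\<^sub>1_def \<rho>\<^sub>2_def A2_def)
    then show ?thesis
      using det_four_block_mat_lower_left_zero[of "\<rho>\<^sub>1 a" r A2 "n - r" "0\<^sub>m (n - r) r" "\<rho>\<^sub>2 a"]
      by (simp add: \<rho>\<^sub>1_def \<rho>\<^sub>2_def A2_def)
  qed
  ultimately show thesis using that by blast
qed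

text \<open>
  If \<open>\<rho>\<close> is not irreducible, some orbit \<open>{\<rho> a *\<^sub>v v | a. a \<in> carrier A}\<close> is a proper nonzero invariant subspace. An
  adapted frame makes \<open>\<rho>\<close> block triangular, and the diagonal blocks are smaller representations. Keeping
  only the product formula for determinants is enough, because invertibility is all that is needed later.
\<close>

lemma composition_factors:
  assumes "matrix_rep A n \<rho>"
  shows "\<exists>L. (\<forall>(k, \<sigma>)\<in>set L. irreducible_rep A k \<sigma>) \<and>
    (\<forall>a\<in>carrier A. det (\<rho> a) = prod_list (map (\<lambda>(k, \<sigma>). det (\<sigma> a)) L))"
  using assms
proof (induction n arbitrary: \<rho> rule: less_induct)
  case (less n)
  note \<rho> = less.prems
  show ?case
  proof (cases "n = 0 \<or> irreducible_rep A n \<rho>")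
    case True
    then show ?thesis
    proof
      assume "n = 0"
      then have "det (\<rho> a) = 1" if "a \<in> carrier A" for a using matrix_repD(1)[OF \<rho> that] by auto
      then show ?thesis by (intro exI[of _ "[]"]) auto
    next
      assume "irreducible_rep A n \<rho>"
      then show ?thesis by (intro exI[of _ "[(n, \<rho>)]"]) auto
    qed
  next
    case False
    then obtain v w where v: "v \<in> carrier_vec n" "v \<noteq> 0\<^sub>v n" and w: "w \<in> carrier_vec n"
      "\<And>a. a \<in> carrier A \<Longrightarrow> \<rho> a *\<^sub>v v \<noteq> w"
      using \<rho> by (auto simp: irreducible_rep_def transitive_on_vectors_def)
    define W where "W = {T *\<^sub>v v | T. T \<in> \<rho> ` carrier A}"
    have W: "vec_subspace n W"
      unfolding W_def by (rule orbit_is_vec_subspace[OF rep_image_of_ideal(1)[OF \<rho> oneideal] v(1)])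
    have Winv: "\<rho> a *\<^sub>v x \<in> W" if a: "a \<in> carrier A" and x: "x \<in> W" for a x
    proof -
      obtain b where b: "b \<in> carrier A" "x = \<rho> b *\<^sub>v v" using x unfolding W_def by blast
      have "\<rho> a *\<^sub>v x = \<rho> (a \<otimes> b) *\<^sub>v v"
        using matrix_repD(1)[OF \<rho> a] matrix_repD(1)[OF \<rho> b(1)] v
        unfolding b(2) matrix_repD(4)[OF \<rho> a b(1)] by (simp add: assoc_mult_mat_vec[of _ n n _ n])
      moreover have "a \<otimes> b \<in> carrier A" using a b by simp
      ultimately show ?thesis unfolding W_def by blast
    qed
    obtain P r where P: "P \<in> carrier_mat n n" "det P \<noteq> 0" "r \<le> n"
      and PW: "\<And>c. c \<in> carrier_vec n \<Longrightarrow> P *\<^sub>v c \<in> W \<longleftrightarrow> (\<forall>i. r \<le> i \<longrightarrow> i < n \<longrightarrow> c $ i = 0)"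
      using subspace_adapted_frame[OF W] by blast
    obtain Q where Q: "Q \<in> carrier_mat n n" "P * Q = 1\<^sub>m n" "Q * P = 1\<^sub>m n"
      and PQv': "\<forall>v\<in>carrier_vec n. P *\<^sub>v (Q *\<^sub>v v) = v" by (rule det_nonzero_inverse[OF P(1,2)])
    note PQv = bspec[OF PQv']
    have "v = \<rho> \<one> *\<^sub>v v" using matrix_repD(2)[OF \<rho>] v by simp
    then have "v \<in> W" unfolding W_def by blast
    have "r \<noteq> 0"
    proof
      assume "r = 0"
      then have "(Q *\<^sub>v v) $ i = 0" if "i < n" for i
        using PW[of "Q *\<^sub>v v"] PQv[OF v(1)] Q v \<open>v \<in> W\<close> that by auto
      then have "Q *\<^sub>v v = 0\<^sub>v n" using Q by (intro eq_vecI) auto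
      then show False using PQv[OF v(1)] mult_mat_zero_vec[OF P(1)] v by simp
    qed
    have "w \<notin> W" using w by (auto simp: W_def)
    have "r \<noteq> n" using PW[of "Q *\<^sub>v w"] PQv[OF w(1)] Q w(1) \<open>w \<notin> W\<close> by auto
    then have r: "0 < r" "r < n" using \<open>r \<noteq> 0\<close> P(3) by auto
    define \<sigma> where "\<sigma> a = Q * \<rho> a * P" for a
    have \<sigma>: "matrix_rep A n \<sigma>" unfolding \<sigma>_def by (rule matrix_rep_conjugate[OF \<rho> P(1) Q])
    have zero: "\<sigma> a $$ (i, j) = 0" if a: "a \<in> carrier A" and ij: "r \<le> i" "i < n" "j < r" for a i j
    proof -
      have \<rho>a: "\<rho> a \<in> carrier_mat n n" and \<sigma>a: "\<sigma> a \<in> carrier_mat n n" using matrix_repD(1)[OF \<rho> a] matrix_repD(1)[OF \<sigma> a] .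
      have "P *\<^sub>v unit_vec n j \<in> W" using PW[of "unit_vec n j"] ij by auto
      then have "\<rho> a *\<^sub>v (P *\<^sub>v unit_vec n j) \<in> W" using Winv a by blast
      moreover have "\<rho> a *\<^sub>v (P *\<^sub>v unit_vec n j) = P *\<^sub>v (\<sigma> a *\<^sub>v unit_vec n j)"
      proof -
        have "\<sigma> a *\<^sub>v unit_vec n j = Q *\<^sub>v (\<rho> a *\<^sub>v (P *\<^sub>v unit_vec n j))"
          unfolding \<sigma>_def using \<rho>a P(1) Q(1) by (simp add: assoc_mult_mat_vec[of _ n n _ n])
        then show ?thesis using PQv[of "\<rho> a *\<^sub>v (P *\<^sub>v unit_vec n j)"] \<rho>a P(1) by auto
      qed
      ultimately have "(\<sigma> a *\<^sub>v unit_vec n j) $ i = 0" using PW[of "\<sigma> a *\<^sub>v unit_vec n j"] \<sigma>a ij by auto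
      then show ?thesis using mult_mat_unit_vec[OF \<sigma>a, of j] ij r \<sigma>a by simp
    qed
    obtain \<rho>\<^sub>1 \<rho>\<^sub>2 where \<rho>12: "matrix_rep A r \<rho>\<^sub>1" "matrix_rep A (n - r) \<rho>\<^sub>2"
      "\<And>a. a \<in> carrier A \<Longrightarrow> det (\<sigma> a) = det (\<rho>\<^sub>1 a) * det (\<rho>\<^sub>2 a)"
      using matrix_rep_diagonal_blocks[OF \<sigma> P(3) zero] by blast
    have det\<sigma>: "det (\<rho> a) = det (\<sigma> a)" if "a \<in> carrier A" for a
    proof -
      have c: "\<rho> a \<in> carrier_mat n n" using matrix_repD(1)[OF \<rho> that] .
      have "det Q * det P = 1" using det_mult[OF Q(1) P(1)] Q(3) by simp
      moreover have "det (\<sigma> a) = det Q * det (\<rho> a) * det P"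
        unfolding \<sigma>_def using c P Q by (simp add: det_mult[of _ n])
      ultimately show ?thesis by (simp add: mult.commute mult.left_commute)
    qed
    obtain L1 where L1: "\<forall>(k, \<sigma>)\<in>set L1. irreducible_rep A k \<sigma>"
      "\<forall>a\<in>carrier A. det (\<rho>\<^sub>1 a) = prod_list (map (\<lambda>(k, \<sigma>). det (\<sigma> a)) L1)"
      using less.IH[OF r(2) \<rho>12(1)] by blast
    obtain L2 where L2: "\<forall>(k, \<sigma>)\<in>set L2. irreducible_rep A k \<sigma>"
      "\<forall>a\<in>carrier A. det (\<rho>\<^sub>2 a) = prod_list (map (\<lambda>(k, \<sigma>). det (\<sigma> a)) L2)"
      using less.IH[OF _ \<rho>12(2)] r by auto
    show ?thesis
      using L1 L2 det\<sigma> \<rho>12(3) by (intro exI[of _ "L1 @ L2"]) auto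
  qed
qed

lemma irreducible_rep_surjective:
  assumes "irreducible_rep A n \<rho>" and X: "X \<in> carrier_mat n n"
  obtains a where "a \<in> carrier A" "\<rho> a = X"
proof -
  have \<rho>: "matrix_rep A n \<rho>" and trans: "transitive_on_vectors n (\<rho> ` carrier A)"
    using assms by (auto simp: irreducible_rep_def)
  have "\<rho> ` carrier A = carrier_mat n n"
    by (rule burnside_transitive_algebra[OF rep_image_of_ideal[OF \<rho> oneideal] trans])
  then have "X \<in> \<rho> ` carrier A" using X by simp
  then show thesis by (elim imageE) (rule that, simp_all)
qed

end


section \<open>Maximal ideals as kernels of irreducible representations\<close>

lemma minus_mat_eq_zero_iff:
  fixes X Y :: "'a :: ab_group_add mat"
  assumes "X \<in> carrier_mat n m" "Y \<in> carrier_mat n m"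
  shows "X - Y = 0\<^sub>m n m \<longleftrightarrow> X = Y"
  using assms by (auto simp: mat_eq_iff)

context fd_complex_algebra
begin

lemma rep_kernel_ideal:
  assumes \<rho>: "matrix_rep A n \<rho>"
  shows "ideal (rep_kernel A n \<rho>) A"
proof (rule idealI)
  show "ring A" by (rule ring_axioms)
  have minus: "\<rho> (\<ominus> a) = 0\<^sub>m n n" if "a \<in> carrier A" "\<rho> a = 0\<^sub>m n n" for a
    using that matrix_repD(5)[OF \<rho>, of a "-1"] by (simp add: uminus_eq_smult)
  show "subgroup (rep_kernel A n \<rho>) (add_monoid A)"
    using matrix_repD(3)[OF \<rho>] matrix_rep_zero[OF \<rho>] minus
    by unfold_locales (auto simp: rep_kernel_def a_inv_def[symmetric])
next
  have zero: "\<rho> x * 0\<^sub>m n n = 0\<^sub>m n n" "0\<^sub>m n n * \<rho> x = 0\<^sub>m n n" if "x \<in> carrier A" for x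
    using matrix_repD(1)[OF \<rho> that] by simp_all
  fix a x assume "a \<in> rep_kernel A n \<rho>" "x \<in> carrier A"
  then show "x \<otimes> a \<in> rep_kernel A n \<rho>" "a \<otimes> x \<in> rep_kernel A n \<rho>"
    using matrix_repD(4)[OF \<rho>] zero by (auto simp: rep_kernel_def)
qed

text \<open>
  Invertibility of \<open>\<rho> a\<close> depends on the kernel of \<open>\<rho>\<close> alone, so representations with the same kernel
  are interchangeable in invertibility criteria.
\<close>

lemma det_nonzero_iff_invertible_modulo_kernel:
  assumes irr: "irreducible_rep A n \<rho>" and a: "a \<in> carrier A"
  shows "det (\<rho> a) \<noteq> 0 \<longleftrightarrow> (\<exists>b\<in>carrier A. a \<otimes> b \<ominus> \<one> \<in> rep_kernel A n \<rho>)"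
proof -
  have \<rho>: "matrix_rep A n \<rho>" using irr by (simp add: irreducible_rep_def)
  have \<rho>a: "\<rho> a \<in> carrier_mat n n" using matrix_repD(1)[OF \<rho> a] .
  have iff: "a \<otimes> b \<ominus> \<one> \<in> rep_kernel A n \<rho> \<longleftrightarrow> \<rho> a * \<rho> b = 1\<^sub>m n" if b: "b \<in> carrier A" for b
  proof -
    have \<rho>b: "\<rho> b \<in> carrier_mat n n" using matrix_repD(1)[OF \<rho> b] .
    have "\<rho> (a \<otimes> b \<ominus> \<one>) = \<rho> a * \<rho> b - 1\<^sub>m n"
      using a b matrix_repD(2,4)[OF \<rho>] by (simp add: matrix_rep_minus[OF \<rho>])
    moreover have "\<rho> a * \<rho> b - 1\<^sub>m n = 0\<^sub>m n n \<longleftrightarrow> \<rho> a * \<rho> b = 1\<^sub>m n"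
      using minus_mat_eq_zero_iff[OF mult_carrier_mat[OF \<rho>a \<rho>b] one_carrier_mat] .
    moreover have "a \<otimes> b \<ominus> \<one> \<in> carrier A" using a b by simp
    ultimately show ?thesis by (simp add: rep_kernel_def)
  qed
  show ?thesis
  proof
    assume "det (\<rho> a) \<noteq> 0"
    then obtain Q where Q: "Q \<in> carrier_mat n n" "\<rho> a * Q = 1\<^sub>m n"
      using det_nonzero_inverse[OF \<rho>a] by blast
    obtain b where "b \<in> carrier A" "\<rho> b = Q" using irreducible_rep_surjective[OF irr Q(1)] by blast
    then show "\<exists>b\<in>carrier A. a \<otimes> b \<ominus> \<one> \<in> rep_kernel A n \<rho>" using iff Q by blast
  next
    assume "\<exists>b\<in>carrier A. a \<otimes> b \<ominus> \<one> \<in> rep_kernel A n \<rho>"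
    then obtain b where b: "b \<in> carrier A" "\<rho> a * \<rho> b = 1\<^sub>m n" using iff by blast
    then have "det (\<rho> a) * det (\<rho> b) = 1"
      using det_mult[OF \<rho>a matrix_repD(1)[OF \<rho> b(1)]] by simp
    then show "det (\<rho> a) \<noteq> 0" by auto
  qed
qed

text \<open>
  An ideal \<open>J\<close> strictly above the kernel has a nonzero image \<open>\<rho> ` J\<close>, which is absorbed by
  multiplication from both sides with the transitive algebra \<open>\<rho> ` carrier A\<close> and is therefore itself
  transitive. By Burnside's theorem it contains the identity matrix, so \<open>J\<close> contains the unit.
\<close>

lemma irreducible_rep_kernel_maximal:
  assumes irr: "irreducible_rep A n \<rho>"
  shows "maximalideal (rep_kernel A n \<rho>) A"
proof (rule maximalidealI)
  have \<rho>: "matrix_rep A n \<rho>" and n: "n > 0" using irr by (auto simp: irreducible_rep_def)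
  show "ideal (rep_kernel A n \<rho>) A" by (rule rep_kernel_ideal[OF \<rho>])
  have "(1\<^sub>m n :: complex mat) \<noteq> 0\<^sub>m n n" using n by (metis index_one_mat(1) index_zero_mat(1) zero_neq_one)
  then have "\<one> \<notin> rep_kernel A n \<rho>" using matrix_repD(2)[OF \<rho>] by (simp add: rep_kernel_def)
  then show "carrier A \<noteq> rep_kernel A n \<rho>" by auto
  fix J assume J: "ideal J A" "rep_kernel A n \<rho> \<subseteq> J" "J \<subseteq> carrier A"
  show "J = rep_kernel A n \<rho> \<or> J = carrier A"
  proof (cases "J = rep_kernel A n \<rho>")
    case False
    then obtain a where a: "a \<in> J" "a \<in> carrier A" "\<rho> a \<noteq> 0\<^sub>m n n" using J by (auto simp: rep_kernel_def)
    have \<rho>a: "\<rho> a \<in> carrier_mat n n" using matrix_repD(1)[OF \<rho> a(2)] .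
    obtain r c where rc: "r < n" "c < n" "\<rho> a $$ (r, c) \<noteq> 0" by (rule nonzero_mat_entry[OF \<rho>a a(3)])
    define y where "y = \<rho> a *\<^sub>v unit_vec n c"
    have "y $ r \<noteq> 0" using rc \<rho>a by (simp add: y_def mult_mat_unit_vec)
    then have "y \<noteq> 0\<^sub>v n" using rc(1) by auto
    moreover have "y \<in> carrier_vec n" using \<rho>a by (auto simp: y_def)
    ultimately have y: "y \<in> carrier_vec n" "y \<noteq> 0\<^sub>v n" by simp_all
    have trans: "\<exists>u\<in>carrier A. \<rho> u *\<^sub>v v = w" if "v \<in> carrier_vec n" "v \<noteq> 0\<^sub>v n" "w \<in> carrier_vec n" for v w
      using irr that by (simp add: irreducible_rep_def transitive_on_vectors_def)
    have "\<rho> ` J = carrier_mat n n"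
    proof (rule burnside_transitive_algebra[OF rep_image_of_ideal[OF \<rho> J(1)]])
      show "transitive_on_vectors n (\<rho> ` J)"
        unfolding transitive_on_vectors_def
      proof (intro ballI impI)
        fix v w :: "complex vec" assume v: "v \<in> carrier_vec n" "v \<noteq> 0\<^sub>v n" and w: "w \<in> carrier_vec n"
        obtain p where p: "p \<in> carrier A" "\<rho> p *\<^sub>v v = unit_vec n c" using trans[OF v unit_vec_carrier] by auto
        obtain u where u: "u \<in> carrier A" "\<rho> u *\<^sub>v y = w" using trans[OF y w] by auto
        have "\<rho> (u \<otimes> (a \<otimes> p)) *\<^sub>v v = w"
          using matrix_repD(1)[OF \<rho> p(1)] matrix_repD(1)[OF \<rho> u(1)] \<rho>a a(2) p u v(1)
          by (simp add: matrix_repD(4)[OF \<rho>] assoc_mult_mat_vec[of _ n n _ n] y_def)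
        moreover have "u \<otimes> (a \<otimes> p) \<in> J"
          by (rule ideal.I_l_closed[OF J(1) ideal.I_r_closed[OF J(1) a(1) p(1)] u(1)])
        ultimately show "\<exists>T\<in>\<rho> ` J. T *\<^sub>v v = w" by blast
      qed
    qed
    then have "1\<^sub>m n \<in> \<rho> ` J" by simp
    then obtain z where z: "z \<in> J" "z \<in> carrier A" "\<rho> z = 1\<^sub>m n" using J(3) by auto
    have "\<rho> (\<one> \<ominus> z) = 0\<^sub>m n n"
      using z by (simp add: matrix_rep_minus[OF \<rho>] matrix_repD(2)[OF \<rho>])
    then have "\<one> \<ominus> z \<in> J" using z J by (auto simp: rep_kernel_def)
    then have "(\<one> \<ominus> z) \<oplus> z \<in> J" using z(1) by (rule ideal_add[OF J(1)])
    moreover have "(\<one> \<ominus> z) \<oplus> z = \<one>" using z(2) by (simp add: a_minus_def a_assoc l_neg)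
    ultimately have "J = carrier A" using ideal.one_imp_carrier[OF J(1)] by simp
    then show ?thesis ..
  qed simp
qed

lemma comaximal:
  assumes "maximalideal I A" "maximalideal J A" "I \<noteq> J"
  obtains x y where "x \<in> I" "y \<in> J" "x \<oplus> y = \<one>"
proof -
  have I: "ideal I A" and J: "ideal J A" using assms by (auto dest: maximalideal.axioms)
  have IC: "I \<subseteq> carrier A" "J \<subseteq> carrier A" using ideal.Icarr[OF I] ideal.Icarr[OF J] by auto
  have sum: "ideal (I <+> J) A" by (rule add_ideals[OF I J])
  have zero: "\<zero> \<in> I" "\<zero> \<in> J" using ideal_zero[OF I] ideal_zero[OF J] .
  have IJ: "I \<subseteq> I <+> J" 
  proof
    fix x assume x: "x \<in> I"
    then have "x = x \<oplus> \<zero>" using IC by auto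
    then show "x \<in> I <+> J" using zero x unfolding set_add_def' by blast
  qed
  have JI: "J \<subseteq> I <+> J" 
  proof
    fix x assume x: "x \<in> J"
    then have "x = \<zero> \<oplus> x" using IC by auto
    then show "x \<in> I <+> J" using zero x unfolding set_add_def' by blast
  qed
  have "I <+> J \<subseteq> carrier A" using ideal.Icarr[OF sum] by auto
  then have "I <+> J = I \<or> I <+> J = carrier A" by (rule maximalideal.I_maximal[OF assms(1) sum IJ])
  moreover have "I <+> J \<noteq> I"
  proof
    assume "I <+> J = I"
    then have "J \<subseteq> I" using JI by simp
    then have "I = J \<or> I = carrier A" by (rule maximalideal.I_maximal[OF assms(2) I _ IC(1)])
    then show False using assms(3) maximalideal.I_notcarr[OF assms(1)] by auto
  qed
  ultimately have "\<one> \<in> I <+> J" by simp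
  then show thesis using that by (auto simp: set_add_def')
qed

text \<open>
  The idempotent of the Chinese remainder theorem, up to congruence: writing \<open>\<one> = x\<^sub>K \<oplus> y\<^sub>K\<close> with \<open>x\<^sub>K \<in> I\<close>
  and \<open>y\<^sub>K \<in> K\<close>, the product of the \<open>y\<^sub>K\<close> lies in every \<open>K\<close> and is congruent to \<open>\<one>\<close> modulo \<open>I\<close>.
\<close>

lemma comaximal_finite_intersection:
  assumes I: "maximalideal I A" and F: "finite F" "\<And>K. K \<in> F \<Longrightarrow> maximalideal K A" "I \<notin> F"
  obtains e where "e \<in> carrier A" "\<forall>K\<in>F. e \<in> K" "\<one> \<ominus> e \<in> I"
proof -
  have iI: "ideal I A" using I by (auto dest: maximalideal.axioms)
  have "\<exists>e\<in>carrier A. (\<forall>K\<in>F. e \<in> K) \<and> \<one> \<ominus> e \<in> I"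
    using F
  proof (induction F)
    case empty
    have "\<one> \<ominus> \<one> \<in> I" using ideal_zero[OF iI] by (simp add: a_minus_def r_neg)
    then show ?case by (intro bexI[of _ \<one>]) auto
  next
    case (insert K F)
    then obtain e where e: "e \<in> carrier A" "\<forall>K\<in>F. e \<in> K" "\<one> \<ominus> e \<in> I" by auto
    have K: "maximalideal K A" "ideal K A" using insert.prems by (auto dest: maximalideal.axioms)
    obtain x y where xy: "x \<in> I" "y \<in> K" "x \<oplus> y = \<one>" using comaximal[OF I K(1)] insert.prems by auto
    have xyA: "x \<in> carrier A" "y \<in> carrier A" using ideal.Icarr[OF iI xy(1)] ideal.Icarr[OF K(2) xy(2)] .
    have "\<one> \<ominus> e \<otimes> y = (\<one> \<ominus> e) \<oplus> e \<otimes> x"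
    proof -
      have "e = e \<otimes> x \<oplus> e \<otimes> y" using e(1) xyA xy(3) r_distr[of x y e] by simp
      then have "\<one> \<ominus> e \<oplus> e \<otimes> x = \<one> \<ominus> (e \<otimes> x \<oplus> e \<otimes> y) \<oplus> e \<otimes> x" by simp
      also have "\<dots> = \<one> \<ominus> e \<otimes> y"
        using e(1) xyA by (simp add: a_minus_def minus_add a_ac r_neg1 r_neg2)
      finally show ?thesis ..
    qed
    moreover have "(\<one> \<ominus> e) \<oplus> e \<otimes> x \<in> I"
      using e by (intro ideal_add[OF iI] ideal.I_l_closed[OF iI xy(1)]) auto
    moreover have "e \<otimes> y \<in> L" if "L \<in> insert K F" for L
    proof (cases "L = K")
      case True
      then show ?thesis using ideal.I_l_closed[OF K(2) xy(2) e(1)] by simp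
    next
      case False
      then have "L \<in> F" using that by simp
      then have L: "ideal L A" "e \<in> L" using insert.prems e by (auto dest: maximalideal.axioms)
      show ?thesis by (rule ideal.I_r_closed[OF L xyA(2)])
    qed
    ultimately show ?case using e(1) xyA by (intro bexI[of _ "e \<otimes> y"]) auto
  qed
  then obtain e where "e \<in> carrier A" "\<forall>K\<in>F. e \<in> K" "\<one> \<ominus> e \<in> I" by (elim bexE conjE)
  then show thesis by (intro that[of e]) auto
qed

lemma maximal_ideal_no_unit:
  assumes "maximalideal I A" "u \<in> Units A"
  shows "u \<notin> I"
proof
  assume u: "u \<in> I"
  have I: "ideal I A" using assms by (auto dest: maximalideal.axioms)
  have "inv u \<otimes> u \<in> I" by (rule ideal.I_l_closed[OF I u Units_inv_closed[OF assms(2)]])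
  then have "\<one> \<in> I" using Units_l_inv[OF assms(2)] by simp
  then show False using ideal.one_imp_carrier[OF I] maximalideal.I_notcarr[OF assms(1)] by auto
qed

text \<open>
  Composition factors of the regular representation detect units, and their kernels are maximal
  ideals. No other maximal ideal \<open>I\<close> exists: an element congruent to \<open>\<zero>\<close> modulo all those kernels and to
  \<open>\<one>\<close> modulo \<open>I\<close> would make \<open>\<one> \<ominus> e\<close> a unit inside \<open>I\<close>. This replaces the Wedderburn
  decomposition of the algebra modulo its radical.
\<close>

theorem irreducible_reps_of_maximal_ideals:
  obtains d \<pi> where "\<And>I. I \<in> Max_ideals A \<Longrightarrow> irreducible_rep A (d I) (\<pi> I) \<and> rep_kernel A (d I) (\<pi> I) = I"
    "\<And>a. a \<in> carrier A \<Longrightarrow> a \<in> Units A \<longleftrightarrow> (\<forall>I\<in>Max_ideals A. det (\<pi> I a) \<noteq> 0)"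
proof -
  obtain n \<rho> where \<rho>: "matrix_rep A n \<rho>" "\<And>a. a \<in> carrier A \<Longrightarrow> a \<in> Units A \<longleftrightarrow> det (\<rho> a) \<noteq> 0"
    using regular_representation by blast
  obtain L where L: "\<And>k \<sigma>. (k, \<sigma>) \<in> set L \<Longrightarrow> irreducible_rep A k \<sigma>"
    "\<And>a. a \<in> carrier A \<Longrightarrow> det (\<rho> a) = prod_list (map (\<lambda>(k, \<sigma>). det (\<sigma> a)) L)"
    using composition_factors[OF \<rho>(1)] by fast
  have units: "a \<in> Units A \<longleftrightarrow> (\<forall>(k, \<sigma>)\<in>set L. det (\<sigma> a) \<noteq> 0)" if "a \<in> carrier A" for a
    unfolding \<rho>(2)[OF that] L(2)[OF that] prod_list_zero_iff by force
  define F where "F = (\<lambda>(k, \<sigma>). rep_kernel A k \<sigma>) ` set L"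
  have Fmax: "maximalideal K A" if "K \<in> F" for K
    using that L(1) irreducible_rep_kernel_maximal by (auto simp: F_def)
  have MaxF: "I \<in> F" if I: "I \<in> Max_ideals A" for I
  proof (rule ccontr)
    assume "I \<notin> F"
    have Im: "maximalideal I A" using I by (simp add: Max_ideals_def)
    have finF: "finite F" by (simp add: F_def)
    obtain e where e: "e \<in> carrier A" "\<forall>K\<in>F. e \<in> K" "\<one> \<ominus> e \<in> I"
      by (rule comaximal_finite_intersection[OF Im finF Fmax \<open>I \<notin> F\<close>])
    have "det (\<sigma> (\<one> \<ominus> e)) \<noteq> 0" if "(k, \<sigma>) \<in> set L" for k \<sigma>
    proof -
      have \<sigma>: "matrix_rep A k \<sigma>" using L(1)[OF that] by (simp add: irreducible_rep_def)
      have "e \<in> rep_kernel A k \<sigma>" using e(2) that by (force simp: F_def)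
      then have "\<sigma> (\<one> \<ominus> e) = 1\<^sub>m k - 0\<^sub>m k k"
        using e(1) by (simp add: matrix_rep_minus[OF \<sigma>] matrix_repD(2)[OF \<sigma>] rep_kernel_def)
      also have "\<dots> = 1\<^sub>m k" by (intro eq_matI) auto
      finally show ?thesis by simp
    qed
    then have "\<one> \<ominus> e \<in> Units A" using units[of "\<one> \<ominus> e"] e(1) by auto
    then show False using maximal_ideal_no_unit[OF Im] e(3) by blast
  qed
  have "\<exists>k \<sigma>. irreducible_rep A k \<sigma> \<and> rep_kernel A k \<sigma> = I" if I: "I \<in> Max_ideals A" for I
    using MaxF[OF I] L(1) by (auto simp: F_def)
  then obtain d \<pi> where d\<pi>: "\<And>I. I \<in> Max_ideals A \<Longrightarrow> irreducible_rep A (d I) (\<pi> I) \<and> rep_kernel A (d I) (\<pi> I) = I"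
    by metis
  show thesis
  proof (rule that[OF d\<pi>])
    fix a assume a: "a \<in> carrier A"
    have \<pi>iff: "det (\<pi> I a) \<noteq> 0 \<longleftrightarrow> (\<exists>b\<in>carrier A. a \<otimes> b \<ominus> \<one> \<in> I)" if "I \<in> Max_ideals A" for I
      using det_nonzero_iff_invertible_modulo_kernel[OF _ a, of "d I" "\<pi> I"] d\<pi>[OF that] by simp
    have "(\<forall>(k, \<sigma>)\<in>set L. det (\<sigma> a) \<noteq> 0) \<longleftrightarrow> (\<forall>K\<in>F. \<exists>b\<in>carrier A. a \<otimes> b \<ominus> \<one> \<in> K)"
    proof -
      have "det (snd x a) \<noteq> 0 \<longleftrightarrow> (\<exists>b\<in>carrier A. a \<otimes> b \<ominus> \<one> \<in> rep_kernel A (fst x) (snd x))" if "x \<in> set L" for x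
        using that by (intro det_nonzero_iff_invertible_modulo_kernel[OF L(1) a]) simp
      then have "(\<forall>x\<in>set L. det (snd x a) \<noteq> 0) \<longleftrightarrow>
          (\<forall>x\<in>set L. \<exists>b\<in>carrier A. a \<otimes> b \<ominus> \<one> \<in> rep_kernel A (fst x) (snd x))" by simp
      then show ?thesis by (simp add: F_def case_prod_unfold)
    qed
    also have "\<dots> \<longleftrightarrow> (\<forall>I\<in>Max_ideals A. det (\<pi> I a) \<noteq> 0)"
      using MaxF Fmax \<pi>iff by (auto simp: Max_ideals_def)
    finally show "a \<in> Units A \<longleftrightarrow> (\<forall>I\<in>Max_ideals A. det (\<pi> I a) \<noteq> 0)" using units[OF a] by simp
  qed
qed

text \<open>
  Chinese remainder theorem together with surjectivity of each representation.
\<close>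

lemma irreducible_reps_jointly_surjective:
  assumes F: "finite F" and irr: "\<And>i. i \<in> F \<Longrightarrow> irreducible_rep A (d i) (\<pi> i)"
    and inj: "inj_on (\<lambda>i. rep_kernel A (d i) (\<pi> i)) F"
    and X: "\<And>i. i \<in> F \<Longrightarrow> X i \<in> carrier_mat (d i) (d i)"
  obtains a where "a \<in> carrier A" "\<And>i. i \<in> F \<Longrightarrow> \<pi> i a = X i"
proof -
  have rep: "matrix_rep A (d i) (\<pi> i)" if "i \<in> F" for i using irr[OF that] by (simp add: irreducible_rep_def)
  have "\<exists>a\<in>carrier A. \<forall>i\<in>F. \<pi> i a = (if i \<in> G then X i else 0\<^sub>m (d i) (d i))" if "finite G" "G \<subseteq> F" for G
    using that
  proof (induction G)
    case empty
    then show ?case using matrix_rep_zero[OF rep] by (intro bexI[of _ \<zero>]) auto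
  next
    case (insert j G)
    then obtain a where a: "a \<in> carrier A" "\<And>i. i \<in> F \<Longrightarrow> \<pi> i a = (if i \<in> G then X i else 0\<^sub>m (d i) (d i))" by auto
    have j: "j \<in> F" using insert by simp
    define K where "K i = rep_kernel A (d i) (\<pi> i)" for i
    have Kmax: "maximalideal (K i) A" if "i \<in> F" for i
      using irreducible_rep_kernel_maximal[OF irr[OF that]] by (simp add: K_def)
    have "K j \<notin> K ` (F - {j})" using inj j by (auto simp: K_def inj_on_def)
    moreover have "finite (K ` (F - {j}))" using F by simp
    moreover have "maximalideal L A" if "L \<in> K ` (F - {j})" for L using Kmax that by auto
    ultimately obtain e where e': "e \<in> carrier A" "\<forall>L\<in>K ` (F - {j}). e \<in> L" "\<one> \<ominus> e \<in> K j"
      using comaximal_finite_intersection[OF Kmax[OF j], of "K ` (F - {j})"] by metis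
    have e: "e \<in> carrier A" "\<And>i. i \<in> F - {j} \<Longrightarrow> e \<in> K i" "\<one> \<ominus> e \<in> K j"
      using e' by auto
    obtain x where x: "x \<in> carrier A" "\<pi> j x = X j" using irreducible_rep_surjective[OF irr[OF j] X[OF j]] by blast
    have "1\<^sub>m (d j) - \<pi> j e = 0\<^sub>m (d j) (d j)"
      using e(1,3) matrix_rep_minus[OF rep[OF j], of \<one> e] matrix_repD(2)[OF rep[OF j]] by (simp add: K_def rep_kernel_def)
    then have \<pi>je: "\<pi> j e = 1\<^sub>m (d j)"
      using minus_mat_eq_zero_iff[OF one_carrier_mat matrix_repD(1)[OF rep[OF j] e(1)]] by simp
    show ?case
    proof (intro bexI[of _ "a \<oplus> e \<otimes> x"] ballI)
      fix i assume i: "i \<in> F"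
      have eq: "\<pi> i (a \<oplus> e \<otimes> x) = \<pi> i a + \<pi> i e * \<pi> i x" using a e x matrix_repD[OF rep[OF i]] by simp
      have c: "\<pi> i x \<in> carrier_mat (d i) (d i)" using matrix_repD(1)[OF rep[OF i] x(1)] .
      show "\<pi> i (a \<oplus> e \<otimes> x) = (if i \<in> insert j G then X i else 0\<^sub>m (d i) (d i))"
      proof (cases "i = j")
        case True
        then show ?thesis using eq a(2)[OF i] insert x \<pi>je X[OF j] by simp
      next
        case False
        then have "\<pi> i e = 0\<^sub>m (d i) (d i)" using e(2)[of i] i by (simp add: K_def rep_kernel_def)
        then show ?thesis using eq a(2)[OF i] c X[OF i] False by simp
      qed
    qed (use a e x in auto)
  qed
  from this[OF F] obtain a where "a \<in> carrier A" "\<forall>i\<in>F. \<pi> i a = X i" by auto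
  then show thesis by (intro that[of a]) auto
qed

end


section \<open>Dimensions of the simple quotients\<close>

context fd_complex_algebra
begin

lemma quotient_algebra_simps:
  shows "carrier (quotient_algebra A I) = a_rcosets\<^bsub>A\<^esub> I"
    "X \<oplus>\<^bsub>quotient_algebra A I\<^esub> Y = X <+>\<^bsub>A\<^esub> Y" "\<zero>\<^bsub>quotient_algebra A I\<^esub> = I"
    "c \<odot>\<^bsub>quotient_algebra A I\<^esub> X = (\<Union>x\<in>X. I +>\<^bsub>A\<^esub> (c \<odot> x))"
  by (simp_all add: quotient_algebra_def FactRing_def ring.extend_def module.fields_def)

lemma quotient_algebra_coset_ops:
  assumes I: "ideal I A" and x: "x \<in> carrier A" and y: "y \<in> carrier A"
  shows "(I +> x) \<oplus>\<^bsub>quotient_algebra A I\<^esub> (I +> y) = I +> (x \<oplus> y)"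
    "c \<odot>\<^bsub>quotient_algebra A I\<^esub> (I +> x) = I +> (c \<odot> x)"
    "I +> x = I \<longleftrightarrow> x \<in> I"
proof -
  interpret I: ideal I A by fact
  show "(I +> x) \<oplus>\<^bsub>quotient_algebra A I\<^esub> (I +> y) = I +> (x \<oplus> y)"
    using I.a_rcos_sum[OF x y] by (simp add: quotient_algebra_simps)
  have "I +> (c \<odot> x') = I +> (c \<odot> x)" if x': "x' \<in> I +> x" for x'
  proof -
    obtain h where h: "h \<in> I" "x' = h \<oplus> x" using x' by (auto simp: a_r_coset_def')
    have hA: "h \<in> carrier A" using h by simp
    have "c \<odot> x' = c \<odot> h \<oplus> c \<odot> x" unfolding h(2) using smult_r_distr[of c h x] hA x by simp
    moreover have "c \<odot> h \<in> I" using ideal_smult_closed[OF I h(1)] .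
    ultimately have "c \<odot> x' \<in> I +> (c \<odot> x)" by (auto simp: a_r_coset_def')
    then show ?thesis using a_repr_independence[of "c \<odot> x'" I "c \<odot> x"] x I.a_subgroup by simp
  qed
  moreover have "x \<in> I +> x" using I.a_rcos_self[OF x] .
  ultimately show "c \<odot>\<^bsub>quotient_algebra A I\<^esub> (I +> x) = I +> (c \<odot> x)"
    unfolding quotient_algebra_simps by blast
  show "I +> x = I \<longleftrightarrow> x \<in> I"
    using a_coset_join2[OF x I.a_subgroup] I.a_rcos_self[OF x] by auto
qed

lemma surjective_image_vectorspace:
  assumes surj: "f ` carrier A = carrier Q" and zero: "\<zero>\<^bsub>Q\<^esub> = f \<zero>"
    and add: "\<And>x y. x \<in> carrier A \<Longrightarrow> y \<in> carrier A \<Longrightarrow> f x \<oplus>\<^bsub>Q\<^esub> f y = f (x \<oplus> y)"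
    and smult: "\<And>c x. x \<in> carrier A \<Longrightarrow> c \<odot>\<^bsub>Q\<^esub> f x = f (c \<odot> x)"
  shows "vectorspace complex_field Q"
proof (rule vs_criteria)
  show "field complex_field" by (rule class_field)
  show "\<forall>v\<in>carrier Q. \<exists>w\<in>carrier Q. v \<oplus>\<^bsub>Q\<^esub> w = \<zero>\<^bsub>Q\<^esub>"
    unfolding surj[symmetric] by (auto simp: zero add r_neg intro!: bexI[of _ "\<ominus> x" for x])
qed (auto simp: surj[symmetric] zero add smult a_ac smult_assoc1[of _ _ x for x, simplified] smult_one[simplified]
      smult_l_distr[simplified] smult_r_distr[simplified])

text \<open>
  Rank-nullity for a surjection. Two surjections from \<open>A\<close> with the same kernel thus have targets of
  equal dimension.
\<close>

lemma surjective_linear_map_dim: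
  assumes W: "vectorspace complex_field W" and T: "T \<in> module_hom complex_field A W"
    and surj: "T ` carrier A = carrier W"
  shows "vectorspace.dim complex_field W
    + vectorspace.dim complex_field (A\<lparr>carrier := {x \<in> carrier A. T x = \<zero>\<^bsub>W\<^esub>}\<rparr>) = dim"
proof -
  interpret W: vectorspace complex_field W by fact
  interpret L: linear_map complex_field A W T by unfold_locales (rule T)
  have "L.imT = carrier W" using surj by (simp add: L.im_def)
  then show ?thesis using L.rank_nullity[OF fin_dim] by (simp add: L.ker_def)
qed

text \<open>
  The coset map \<open>A \<rightarrow> A / ker \<rho>\<close> and the map to the \<open>n * n\<close> entries of \<open>\<rho> a\<close> are surjective linear maps
  with the same kernel. The entries are listed in one vector, position \<open>(i, j)\<close> at index \<open>i * n + j\<close>.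
\<close>

theorem alg_dim_quotient_by_rep_kernel:
  assumes irr: "irreducible_rep A n \<rho>"
  shows "alg_dim (quotient_algebra A (rep_kernel A n \<rho>)) = n * n"
proof -
  have \<rho>: "matrix_rep A n \<rho>" using irr by (simp add: irreducible_rep_def)
  define I where "I = rep_kernel A n \<rho>"
  have I: "ideal I A" unfolding I_def by (rule rep_kernel_ideal[OF \<rho>])
  define T where "T a = vec (n * n) (\<lambda>k. \<rho> a $$ (k div n, k mod n))" for a
  have lt: "k div n < n" "k mod n < n" if "k < n * n" for k
  proof -
    show "k div n < n" using that by (simp add: less_mult_imp_div_less)
    show "k mod n < n" using that by (cases "n = 0") auto
  qed
  have dims: "dim_row (\<rho> a) = n" "dim_col (\<rho> a) = n" if "a \<in> carrier A" for a
    using matrix_repD(1)[OF \<rho> that] by auto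
  have "T \<in> module_hom complex_field A (module_vec TYPE(complex) (n * n))"
    unfolding module_hom_def module_vec_simps
    using lt dims by (auto intro!: eq_vecI simp: T_def matrix_repD[OF \<rho>])
  moreover have "T ` carrier A = carrier (module_vec TYPE(complex) (n * n))"
  proof (intro equalityI subsetI)
    fix v :: "complex vec" assume "v \<in> carrier (module_vec TYPE(complex) (n * n))"
    then have v: "v \<in> carrier_vec (n * n)" by (simp add: module_vec_simps)
    obtain a where a: "a \<in> carrier A" "\<rho> a = mat n n (\<lambda>(i, j). v $ (i * n + j))"
      using irreducible_rep_surjective[OF irr, of "mat n n (\<lambda>(i, j). v $ (i * n + j))"] by auto
    have "T a = v" using v lt by (intro eq_vecI) (auto simp: T_def a(2))
    then show "v \<in> T ` carrier A" using a(1) by blast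
  qed (auto simp: T_def module_vec_simps)
  moreover have "{x \<in> carrier A. T x = \<zero>\<^bsub>module_vec TYPE(complex) (n * n)\<^esub>} = I"
  proof -
    have "T x = 0\<^sub>v (n * n) \<longleftrightarrow> \<rho> x = 0\<^sub>m n n" if x: "x \<in> carrier A" for x
    proof
      assume T0: "T x = 0\<^sub>v (n * n)"
      show "\<rho> x = 0\<^sub>m n n"
      proof (rule eq_matI)
        fix i j assume "i < dim_row (0\<^sub>m n n :: complex mat)" "j < dim_col (0\<^sub>m n n :: complex mat)"
        then have ij: "i < n" "j < n" by auto
        have k: "i * n + j < n * n"
        proof -
          have "i * n + j < Suc i * n" using ij by simp
          also have "\<dots> \<le> n * n" using ij by (intro mult_right_mono) auto
          finally show ?thesis .
        qed
        have "T x $ (i * n + j) = 0" using T0 k by simp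
        then show "\<rho> x $$ (i, j) = 0\<^sub>m n n $$ (i, j)" using ij k by (simp add: T_def)
      qed (use dims x in auto)
    qed (use lt in \<open>auto simp: T_def\<close>)
    then show ?thesis by (auto simp: I_def rep_kernel_def module_vec_simps)
  qed
  ultimately have "vectorspace.dim complex_field (module_vec TYPE(complex) (n * n))
      + vectorspace.dim complex_field (A\<lparr>carrier := I\<rparr>) = dim"
    using surjective_linear_map_dim[OF vec_vs, of T "n * n"] by simp
  then have 1: "n * n + vectorspace.dim complex_field (A\<lparr>carrier := I\<rparr>) = dim"
    using vec_space.dim_is_n[where ?'a = complex] by simp
  define p where "p = (\<lambda>x. I +> x)"
  have "p \<in> module_hom complex_field A (quotient_algebra A I)"
    unfolding module_hom_def p_def
    by (auto simp: quotient_algebra_coset_ops[OF I] quotient_algebra_simps(1) A_RCOSETS_def')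
  moreover have psurj: "p ` carrier A = carrier (quotient_algebra A I)"
    by (auto simp: quotient_algebra_simps(1) A_RCOSETS_def' p_def)
  moreover have "{x \<in> carrier A. p x = \<zero>\<^bsub>quotient_algebra A I\<^esub>} = I"
    using ideal.Icarr[OF I] quotient_algebra_coset_ops(3)[OF I] by (auto simp: p_def quotient_algebra_simps(3))
  moreover have "vectorspace complex_field (quotient_algebra A I)"
  proof (rule surjective_image_vectorspace[OF psurj])
    show "\<zero>\<^bsub>quotient_algebra A I\<^esub> = p \<zero>"
      using quotient_algebra_coset_ops(3)[OF I zero_closed zero_closed] ideal_zero[OF I]
      by (simp add: p_def quotient_algebra_simps(3))
  qed (simp_all add: p_def quotient_algebra_coset_ops[OF I])
  ultimately have 2: "vectorspace.dim complex_field (quotient_algebra A I)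
      + vectorspace.dim complex_field (A\<lparr>carrier := I\<rparr>) = dim"
    using surjective_linear_map_dim[of "quotient_algebra A I" p] by simp
  show ?thesis using 1 2 by (simp add: alg_dim_def I_def)
qed

end


section \<open>The vector topology and linear functionals\<close>

context fd_complex_algebra
begin

context
  fixes T :: "'a topology"
  assumes T: "hausdorff_vector_topology A T"
begin

lemma topspace_eq_carrier: "topspace T = carrier A"
  using T by (simp add: hausdorff_vector_topology_def)

lemma continuous_map_add:
  assumes "continuous_map X T u" "continuous_map X T v"
  shows "continuous_map X T (\<lambda>x. u x \<oplus> v x)"
proof -
  have "continuous_map X (prod_topology T T) (\<lambda>x. (u x, v x))"
    using assms by (intro continuous_map_pairedI)
  moreover have "continuous_map (prod_topology T T) T (\<lambda>(x, y). x \<oplus> y)"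
    using T by (simp add: hausdorff_vector_topology_def)
  ultimately have "continuous_map X T ((\<lambda>(x, y). x \<oplus> y) \<circ> (\<lambda>x. (u x, v x)))"
    by (rule continuous_map_compose)
  then show ?thesis by (simp add: o_def)
qed

lemma continuous_map_smult:
  assumes "continuous_map X euclidean g" "continuous_map X T v"
  shows "continuous_map X T (\<lambda>x. g x \<odot> v x)"
proof -
  have "continuous_map X (prod_topology euclidean T) (\<lambda>x. (g x, v x))"
    using assms by (intro continuous_map_pairedI)
  moreover have "continuous_map (prod_topology euclidean T) T (\<lambda>(c, x). c \<odot> x)"
    using T by (simp add: hausdorff_vector_topology_def)
  ultimately have "continuous_map X T ((\<lambda>(c, x). c \<odot> x) \<circ> (\<lambda>x. (g x, v x)))"
    by (rule continuous_map_compose)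
  then show ?thesis by (simp add: o_def)
qed

lemma continuous_map_lincomb:
  assumes "finite I" "\<And>i. i \<in> I \<Longrightarrow> continuous_map X euclidean (g i)" "\<And>i. i \<in> I \<Longrightarrow> b i \<in> carrier A"
  shows "continuous_map X T (\<lambda>x. \<Oplus>i\<in>I. g i x \<odot> b i)"
  using assms
proof (induction I)
  case empty
  then show ?case by (simp add: topspace_eq_carrier)
next
  case (insert i I)
  have "(\<Oplus>i\<in>insert i I. g i x \<odot> b i) = g i x \<odot> b i \<oplus> (\<Oplus>i\<in>I. g i x \<odot> b i)" for x
    using insert by (intro finsum_insert) auto
  moreover have "continuous_map X T (\<lambda>x. g i x \<odot> b i)"
    using insert by (intro continuous_map_smult) (auto simp: topspace_eq_carrier)
  moreover have "continuous_map X T (\<lambda>x. \<Oplus>i\<in>I. g i x \<odot> b i)"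
    using insert by auto
  ultimately show ?case by (simp add: continuous_map_add)
qed

text \<open>
  For each \<open>i\<close> the vectors whose \<open>i\<close>-th coordinate is \<open>1\<close> and whose other coordinates lie in the closed
  unit disc form a compact, hence closed set that avoids \<open>\<zero>\<close>. A neighbourhood \<open>V\<close> of \<open>\<zero>\<close> with
  \<open>c \<odot> x\<close> outside these sets for \<open>x \<in> V\<close> and small \<open>c\<close> has bounded coordinates: otherwise dividing \<open>x\<close> by its
  largest coordinate would hit one of them.
\<close>

lemma bounded_coordinates_near_zero:
  assumes cs: "coordinate_system A N b f"
  obtains V r where "openin T V" "\<zero> \<in> V" "r > 0" "\<forall>x\<in>V. \<forall>l<N. norm (f l x) < r"
proof -
  note b = coordinate_systemD(1)[OF cs] and f = coordinate_systemD(2)[OF cs]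
    and rep = coordinate_systemD(3)[OF cs] and fb = coordinate_systemD(4)[OF cs]
  define comb where "comb c = (\<Oplus>l\<in>{..<N}. c l \<odot> b l)" for c :: "nat \<Rightarrow> complex"
  define D where "D i l = (if l = i then {1} else cball 0 1 :: complex set)" for i l :: nat
  define K where "K i = comb ` topspace (product_topology (\<lambda>l. top_of_set (D i l)) {..<N})" for i
  have fcomb: "f i (comb c) = c i" if "i < N" for i c
  proof -
    have "f i (comb c) = (\<Sum>l<N. c l * f i (b l))"
      unfolding comb_def using b by (intro linear_functional_sum[OF f[OF that]]) auto
    also have "\<dots> = (\<Sum>l<N. if l = i then c l else 0)" using fb that by (intro sum.cong) auto
    finally show ?thesis using that by simp
  qed
  have "closedin T (K i)" for i
  proof -
    have "compact_space (product_topology (\<lambda>l. top_of_set (D i l)) {..<N})"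
      by (auto simp: compact_space_product_topology compact_space_subtopology D_def)
    moreover have "continuous_map (product_topology (\<lambda>l. top_of_set (D i l)) {..<N}) T comb"
      unfolding comb_def
    proof (rule continuous_map_lincomb)
      fix l assume "l \<in> {..<N}"
      then have "continuous_map (product_topology (\<lambda>l. top_of_set (D i l)) {..<N}) (top_of_set (D i l)) (\<lambda>c. c l)"
        by (rule continuous_map_product_projection)
      then show "continuous_map (product_topology (\<lambda>l. top_of_set (D i l)) {..<N}) euclidean (\<lambda>c. c l)"
        by (simp add: continuous_map_in_subtopology)
    qed (use b in auto)
    ultimately have "compactin T (K i)"
      unfolding K_def by (auto simp: compact_space_def intro: image_compactin)
    then show ?thesis using T by (simp add: compactin_imp_closedin hausdorff_vector_topology_def)
  qed
  note closedK = this
  have zeroK: "\<zero> \<notin> K i" if i: "i < N" for i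
  proof
    assume "\<zero> \<in> K i"
    then obtain c where "c \<in> topspace (product_topology (\<lambda>l. top_of_set (D i l)) {..<N})" "\<zero> = comb c"
      by (auto simp: K_def)
    then have "f i \<zero> = 1" using fcomb[OF i] i by (auto simp: D_def PiE_def Pi_def)
    moreover have "f i \<zero> = 0"
    proof -
      have "f i (0 \<odot> \<zero>) = 0 * f i \<zero>" using f[OF i] zero_closed unfolding linear_functional_def by blast
      moreover have "0 \<odot> \<zero> = \<zero>" using smult_l_null[of \<zero>] by simp
      ultimately show ?thesis by simp
    qed
    ultimately show False by simp
  qed
  define U where "U = topspace T - (\<Union>i<N. K i)"
  have "closedin T (\<Union>i<N. K i)" using closedK by (intro closedin_Union) auto
  then have U: "openin T U" unfolding U_def by (rule openin_diff[OF openin_topspace])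
  have zeroU: "\<zero> \<in> U" using zeroK by (auto simp: U_def topspace_eq_carrier)
  define P where "P = {p \<in> topspace (prod_topology euclidean T). (case p of (c, x) \<Rightarrow> c \<odot> x) \<in> U}"
  have "continuous_map (prod_topology euclidean T) T (\<lambda>(c, x). c \<odot> x)"
    using T by (simp add: hausdorff_vector_topology_def)
  then have "openin (prod_topology euclidean T) P"
    unfolding P_def using U by (rule openin_continuous_map_preimage)
  moreover have "(0, \<zero>) \<in> P"
    using zeroU smult_l_null[of \<zero>] by (simp add: P_def topspace_eq_carrier)
  ultimately have "\<exists>C V. openin euclidean C \<and> openin T V \<and> 0 \<in> C \<and> \<zero> \<in> V \<and> C \<times> V \<subseteq> P"
    by (rule iffD1[OF openin_prod_topology_alt, rule_format])
  then obtain C V where CV: "openin euclidean C" "openin T V" "0 \<in> C" "\<zero> \<in> V" "C \<times> V \<subseteq> P"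
    by (elim exE conjE)
  then obtain \<delta> where \<delta>: "\<delta> > 0" "cball 0 \<delta> \<subseteq> C" by (auto simp: open_contains_cball)
  show thesis
  proof (rule that[of V "1 / \<delta>"])
    show "\<forall>x\<in>V. \<forall>l<N. norm (f l x) < 1 / \<delta>"
    proof (intro ballI allI impI)
      fix x l assume x: "x \<in> V" and l: "l < N"
      have xA: "x \<in> carrier A" using x openin_subset[OF CV(2)] topspace_eq_carrier by auto
      define m where "m = Max ((\<lambda>l. norm (f l x)) ` {..<N})"
      have "m \<in> (\<lambda>l. norm (f l x)) ` {..<N}" unfolding m_def using l by (intro Max_in) auto
      then obtain i where im: "i < N" "m = norm (f i x)" by auto
      have "norm (f l x) \<le> m" if "l < N" for l unfolding m_def using that by (intro Max_ge) auto
      then have i: "i < N" "\<And>l. l < N \<Longrightarrow> norm (f l x) \<le> norm (f i x)" using im by auto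
      have "norm (f i x) < 1 / \<delta>"
      proof (rule ccontr)
        assume "\<not> norm (f i x) < 1 / \<delta>"
        then have ge: "norm (f i x) \<ge> 1 / \<delta>" by simp
        moreover have "1 / \<delta> > 0" using \<delta>(1) by simp
        ultimately have pos: "norm (f i x) > 0" by linarith
        define c where "c = 1 / f i x"
        have "norm c \<le> \<delta>" using ge pos \<delta>(1) by (simp add: c_def norm_divide field_simps)
        then have "(c, x) \<in> P" using CV(5) \<delta>(2) x by auto
        then have "c \<odot> x \<in> U" by (simp add: P_def)
        moreover have "c \<odot> x \<in> K i"
        proof -
          define g where "g = (\<lambda>l\<in>{..<N}. c * f l x)"
          have g: "g \<in> topspace (product_topology (\<lambda>l. top_of_set (D i l)) {..<N})"
            using i pos by (auto simp: g_def D_def c_def norm_divide divide_le_eq_1)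
          have "comb g = c \<odot> x"
          proof -
            have "c \<odot> x = (\<Oplus>l\<in>{..<N}. f l (c \<odot> x) \<odot> b l)" using rep xA by blast
            also have "\<dots> = comb g" unfolding comb_def
              using b f xA by (intro finsum_cong') (auto simp: g_def linear_functional_def)
            finally show ?thesis ..
          qed
          then show ?thesis unfolding K_def using g by (intro image_eqI[of _ comb g]) simp_all
        qed
        ultimately show False using i(1) unfolding U_def by blast
      qed
      then show "norm (f l x) < 1 / \<delta>" using i(2)[OF l] by simp
    qed
  qed (use CV \<delta> in auto)
qed

text \<open>
  Coordinates are continuous at \<open>\<zero>\<close> by rescaling the neighbourhood on which they are bounded, and then
  everywhere by translation.
\<close>

lemma linear_functional_continuous:
  assumes g: "linear_functional A g"
  shows "continuous_map T euclidean g"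
proof -
  obtain N b f where cs: "coordinate_system A N b f" by (rule coordinates_exist)
  note b = coordinate_systemD(1)[OF cs] and f = coordinate_systemD(2)[OF cs]
    and rep = coordinate_systemD(3)[OF cs] and fb = coordinate_systemD(4)[OF cs]
  obtain V r where V: "openin T V" "\<zero> \<in> V" "r > 0" "\<forall>x\<in>V. \<forall>l<N. norm (f l x) < r"
    by (rule bounded_coordinates_near_zero[OF cs])
  have coord: "continuous_map T euclidean (f l)" if l: "l < N" for l
    unfolding continuous_map_def
  proof (intro conjI allI impI)
    show "f l \<in> topspace T \<rightarrow> topspace euclidean" by simp
    fix S :: "complex set" assume S: "openin euclidean S"
    show "openin T {x \<in> topspace T. f l x \<in> S}"
    proof (subst openin_subopen, intro ballI)
      fix x\<^sub>0 assume "x\<^sub>0 \<in> {x \<in> topspace T. f l x \<in> S}"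
      then have x0: "x\<^sub>0 \<in> carrier A" "f l x\<^sub>0 \<in> S" by (auto simp: topspace_eq_carrier)
      then obtain \<epsilon> where \<epsilon>: "\<epsilon> > 0" "ball (f l x\<^sub>0) \<epsilon> \<subseteq> S" using S by (auto simp: open_contains_ball)
      define s where "s = complex_of_real (r / \<epsilon>)"
      have ns: "norm s = r / \<epsilon>" using V(3) \<epsilon>(1) by (simp add: s_def norm_divide)
      \<comment> \<open>\<open>h\<close> moves \<open>x\<^sub>0\<close> to \<open>\<zero>\<close> and magnifies the radius \<open>\<epsilon>\<close> to \<open>r\<close>\<close>
      define h where "h x = s \<odot> (x \<oplus> (- 1) \<odot> x\<^sub>0)" for x
      have "continuous_map T T (\<lambda>x. x)" by simp
      then have "continuous_map T T h" unfolding h_def using x0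
        by (intro continuous_map_smult continuous_map_add) (auto simp: topspace_eq_carrier)
      then have "openin T {x \<in> topspace T. h x \<in> V}" using V(1) by (rule openin_continuous_map_preimage)
      moreover have "x\<^sub>0 \<in> {x \<in> topspace T. h x \<in> V}"
      proof -
        have "x\<^sub>0 \<oplus> (- 1) \<odot> x\<^sub>0 = \<zero>" using x0 uminus_eq_smult[of x\<^sub>0] r_neg by metis
        then have "h x\<^sub>0 = \<zero>" using smult_r_null[of s] by (simp add: h_def)
        then show ?thesis using V(2) x0 by (simp add: topspace_eq_carrier)
      qed
      moreover have "{x \<in> topspace T. h x \<in> V} \<subseteq> {x \<in> topspace T. f l x \<in> S}"
      proof (clarsimp simp: topspace_eq_carrier)
        fix x assume x: "x \<in> carrier A" "h x \<in> V"
        have eq: "f l (h x) = s * (f l x - f l x\<^sub>0)"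
          using f[OF l] x x0 by (simp add: h_def linear_functional_def)
        have "norm (f l (h x)) < r" using V(4) x(2) l by auto
        then have "r / \<epsilon> * norm (f l x - f l x\<^sub>0) < r" unfolding eq norm_mult ns .
        then have "norm (f l x - f l x\<^sub>0) < \<epsilon>" using V(3) \<epsilon>(1) by (simp add: field_simps)
        then show "f l x \<in> S" using \<epsilon>(2) by (auto simp: dist_norm norm_minus_commute)
      qed
      ultimately show "\<exists>U. openin T U \<and> x\<^sub>0 \<in> U \<and> U \<subseteq> {x \<in> topspace T. f l x \<in> S}" by blast
    qed
  qed
  have "continuous_map T euclidean (\<lambda>x. \<Sum>i<N. f i x * g (b i))"
  proof (intro continuous_map_sum)
    fix i assume "i \<in> {..<N}"
    then have "continuous_map T euclidean ((\<lambda>z. z * g (b i)) \<circ> f i)"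
      using coord by (intro continuous_map_compose[of _ euclidean])
        (auto intro!: continuous_intros simp: continuous_map_iff_continuous2)
    then show "continuous_map T euclidean (\<lambda>x. f i x * g (b i))" by (simp add: o_def)
  qed auto
  moreover have "(\<Sum>i<N. f i x * g (b i)) = g x" if "x \<in> topspace T" for x
    using linear_functional_sum[OF g, of "{..<N}" b "\<lambda>i. f i x"] b rep[of x] that
    by (simp add: topspace_eq_carrier)
  ultimately show ?thesis by (rule continuous_map_eq)
qed

text \<open>
  The given topology carries exactly the continuity of coordinates. From here on it enters only through
  this criterion.
\<close>

theorem continuous_map_iff_functionals:
  "continuous_map X T \<gamma> \<longleftrightarrow>
    \<gamma> \<in> topspace X \<rightarrow> carrier A \<and> (\<forall>g. linear_functional A g \<longrightarrow> continuous_map X euclidean (\<lambda>x. g (\<gamma> x)))"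
proof (intro iffI conjI allI impI; (elim conjE)?)
  assume \<gamma>: "continuous_map X T \<gamma>"
  show "\<gamma> \<in> topspace X \<rightarrow> carrier A" using \<gamma> by (simp add: continuous_map_def topspace_eq_carrier)
  fix g assume "linear_functional A g"
  from continuous_map_compose[OF \<gamma> linear_functional_continuous[OF this]]
  show "continuous_map X euclidean (\<lambda>x. g (\<gamma> x))" by (simp add: o_def)
next
  assume \<gamma>: "\<gamma> \<in> topspace X \<rightarrow> carrier A"
    "\<forall>g. linear_functional A g \<longrightarrow> continuous_map X euclidean (\<lambda>x. g (\<gamma> x))"
  obtain N b f where cs: "coordinate_system A N b f" by (rule coordinates_exist)
  note b = coordinate_systemD(1)[OF cs] and f = coordinate_systemD(2)[OF cs]
    and rep = coordinate_systemD(3)[OF cs] and fb = coordinate_systemD(4)[OF cs]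
  have "continuous_map X T (\<lambda>x. \<Oplus>i\<in>{..<N}. f i (\<gamma> x) \<odot> b i)"
    using \<gamma>(2) f b by (intro continuous_map_lincomb) auto
  then show "continuous_map X T \<gamma>"
    by (rule continuous_map_eq) (use rep \<gamma>(1) in \<open>auto simp: Pi_def\<close>)
qed

end
end


section \<open>Characteristic polynomials along paths of matrices\<close>

lemma char_poly_eval:
  fixes X :: "complex mat"
  assumes X: "X \<in> carrier_mat n n"
  shows "poly (char_poly X) t = det (t \<cdot>\<^sub>m 1\<^sub>m n - X)"
proof -
  have "- char_matrix X t = t \<cdot>\<^sub>m 1\<^sub>m n - X"
    using X by (intro eq_matI) (auto simp: char_matrix_def)
  then show ?thesis using char_poly_matrix[OF X, of t] by simp
qed

lemma char_poly_monic:
  fixes X :: "complex mat"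
  assumes X: "X \<in> carrier_mat n n"
  shows "degree (char_poly X) = n" "lead_coeff (char_poly X) = 1" "char_poly X \<noteq> 0"
  using degree_monic_char_poly[OF X] by auto

lemma continuous_on_det:
  fixes F :: "'z::topological_space \<Rightarrow> complex mat"
  assumes F: "\<And>z. z \<in> Z \<Longrightarrow> F z \<in> carrier_mat n n"
    and cont: "\<And>a b. a < n \<Longrightarrow> b < n \<Longrightarrow> continuous_on Z (\<lambda>z. F z $$ (a, b))"
  shows "continuous_on Z (\<lambda>z. det (F z))"
proof -
  have "continuous_on Z (\<lambda>z. \<Sum>p | p permutes {0..<n}. signof p * (\<Prod>i = 0..<n. F z $$ (i, p i)))"
  proof (intro continuous_on_sum continuous_on_mult continuous_on_prod continuous_on_const cont)
    fix p i assume "p \<in> {p. p permutes {0..<n}}" "i \<in> {0..<n}"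
    then show "i < n" "p i < n" using permutes_in_image by fastforce+
  qed
  then show ?thesis by (rule continuous_on_eq) (simp add: det_def'[OF F])
qed

lemma continuous_on_char_poly_eval:
  fixes F :: "'z::topological_space \<Rightarrow> complex mat"
  assumes F: "\<And>z. z \<in> Z \<Longrightarrow> F z \<in> carrier_mat n n"
    and cont: "\<And>a b. a < n \<Longrightarrow> b < n \<Longrightarrow> continuous_on Z (\<lambda>z. F z $$ (a, b))"
  shows "continuous_on Z (\<lambda>z. poly (char_poly (F z)) t)"
proof -
  have "continuous_on Z (\<lambda>z. det (t \<cdot>\<^sub>m 1\<^sub>m n - F z))"
  proof (rule continuous_on_det[where n = n])
    fix a b assume ab: "a < n" "b < n"
    have "continuous_on Z (\<lambda>z. (t \<cdot>\<^sub>m 1\<^sub>m n) $$ (a, b) - F z $$ (a, b))"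
      using cont[OF ab] by (intro continuous_intros)
    moreover have "(t \<cdot>\<^sub>m 1\<^sub>m n) $$ (a, b) - F z $$ (a, b) = (t \<cdot>\<^sub>m 1\<^sub>m n - F z) $$ (a, b)" if "z \<in> Z" for z
      using F[OF that] ab by simp
    ultimately show "continuous_on Z (\<lambda>z. (t \<cdot>\<^sub>m 1\<^sub>m n - F z) $$ (a, b))"
      by (rule continuous_on_eq)
  qed (intro minus_carrier_mat F)
  then show ?thesis
    by (rule continuous_on_eq) (simp add: char_poly_eval[OF F])
qed

text \<open>
  The values of a monic polynomial of degree \<open>n\<close> with roots in the finite set \<open>\<Lambda>\<close> at a fixed point range
  over a finite set, and a continuous function with finite range is constant on a connected set.
\<close>

lemma char_poly_constant_on_connected:
  fixes F :: "'z::topological_space \<Rightarrow> complex mat"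
  assumes Z: "connected Z" and F: "\<And>z. z \<in> Z \<Longrightarrow> F z \<in> carrier_mat n n"
    and cont: "\<And>a b. a < n \<Longrightarrow> b < n \<Longrightarrow> continuous_on Z (\<lambda>z. F z $$ (a, b))"
    and fin: "finite \<Lambda>" and roots: "\<And>z t. z \<in> Z \<Longrightarrow> poly (char_poly (F z)) t = 0 \<Longrightarrow> t \<in> \<Lambda>"
    and zw: "z \<in> Z" "w \<in> Z"
  shows "char_poly (F z) = char_poly (F w)"
proof -
  have "poly (char_poly (F z)) t = poly (char_poly (F w)) t" for t
  proof -
    define g where "g z = poly (char_poly (F z)) t" for z
    have "g ` Z \<subseteq> (\<lambda>as. prod_list (map (\<lambda>a. t - a) as)) ` {as. set as \<subseteq> \<Lambda> \<and> length as = n}"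
    proof
      fix c assume "c \<in> g ` Z"
      then obtain y where y: "y \<in> Z" "c = g y" by auto
      obtain as where as: "char_poly (F y) = (\<Prod>a\<leftarrow>as. [:- a, 1:])" "length as = n"
        using char_poly_factorized[OF F[OF y(1)]] by blast
      have ev: "poly (char_poly (F y)) s = prod_list (map (\<lambda>a. s - a) as)" for s
        unfolding as(1) by (induction as) (auto simp: algebra_simps)
      have "set as \<subseteq> \<Lambda>"
      proof
        fix a assume "a \<in> set as"
        then have "poly (char_poly (F y)) a = 0" unfolding ev by (auto simp: prod_list_zero_iff)
        then show "a \<in> \<Lambda>" using roots y(1) by blast
      qed
      then show "c \<in> (\<lambda>as. prod_list (map (\<lambda>a. t - a) as)) ` {as. set as \<subseteq> \<Lambda> \<and> length as = n}"
        using as(2) y(2) ev[of t] by (auto simp: g_def)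
    qed
    then have "finite (g ` Z)" by (rule finite_surj[OF finite_lists_length_eq[OF fin]])
    moreover have "continuous_on Z g" unfolding g_def using F cont by (rule continuous_on_char_poly_eval)
    ultimately have "g constant_on Z" using Z by (intro continuous_finite_range_constant)
    then have "g z = g w" using zw by (auto simp: constant_on_def)
    then show ?thesis by (simp add: g_def)
  qed
  then show ?thesis by (simp add: poly_eq_poly_eq_iff[symmetric] ext)
qed

lemma connected_complement_finite:
  assumes "finite S"
  shows "connected (- S :: complex set)"
  using connected_open_delete_finite[of "UNIV :: complex set" S] assms connected_UNIV
  by (simp add: Compl_eq_Diff_UNIV)

lemma monic_poly_eq_prod_roots:
  fixes p :: "complex poly"
  assumes p: "p \<noteq> 0" "lead_coeff p = 1" and I: "finite I" "inj_on \<nu> I"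
    and roots: "\<And>t. poly p t = 0 \<Longrightarrow> t \<in> \<nu> ` I"
  shows "p = (\<Prod>i\<in>I. [:- \<nu> i, 1:] ^ Polynomial.order (\<nu> i) p)"
proof -
  have "p = (\<Prod>z | poly p z = 0. [:-z, 1:] ^ Polynomial.order z p)" using complex_poly_decompose[of p] p by simp
  also have "\<dots> = (\<Prod>z\<in>\<nu> ` I. [:-z, 1:] ^ Polynomial.order z p)"
    using I(1) roots by (intro prod.mono_neutral_left) (auto simp: order_root)
  also have "\<dots> = (\<Prod>i\<in>I. [:- \<nu> i, 1:] ^ Polynomial.order (\<nu> i) p)" using I(2) by (simp add: prod.reindex)
  finally show ?thesis .
qed

lemma order_prod_distinct_roots:
  fixes \<nu> :: "'i \<Rightarrow> complex"
  assumes I: "finite I" "inj_on \<nu> I" "i \<in> I"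
  shows "Polynomial.order (\<nu> i) (\<Prod>j\<in>I. [:- \<nu> j, 1:] ^ n j) = n i"
proof -
  define R where "R = (\<Prod>j\<in>I - {i}. [:- \<nu> j, 1:] ^ n j)"
  have "poly R (\<nu> i) \<noteq> 0"
    unfolding R_def poly_prod using I by (auto simp: inj_on_def poly_power)
  then have R: "Polynomial.order (\<nu> i) R = 0" "R \<noteq> 0" by (auto simp: order_root)
  have "(\<Prod>j\<in>I. [:- \<nu> j, 1:] ^ n j) = [:- \<nu> i, 1:] ^ n i * R"
    unfolding R_def using I by (simp add: prod.remove)
  then show ?thesis using R by (simp add: order_mult order_power_n_n)
qed

text \<open>
  The eigenvalues of \<open>F \<nu>\<close> are among the \<open>\<nu> i\<close>, so for pairwise distinct \<open>\<nu> i\<close> each has a well-defined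
  multiplicity. Join \<open>\<nu>\<close> to a fixed injective \<open>\<mu>\<close> by a complex line. All but finitely many points \<open>z\<close> of the
  line have distinct entries; they form a connected dense set \<open>Z\<close>, partitioned into finitely many closed
  pieces according to the multiplicities. Hence the multiplicities are those of \<open>\<mu>\<close> throughout \<open>Z\<close>, and the
  factorization extends to all of the line by continuity.
\<close>

theorem multiplicities_constant_on_diagonal:
  fixes F :: "('i \<Rightarrow> complex) \<Rightarrow> complex mat"
  assumes I: "finite I"
    and F: "\<And>\<nu>. F \<nu> \<in> carrier_mat m m"
    and cont: "\<And>\<nu> \<mu> a b. a < m \<Longrightarrow> b < m \<Longrightarrow> continuous_on UNIV (\<lambda>z. F (\<lambda>i. \<nu> i + z * (\<mu> i - \<nu> i)) $$ (a, b))"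
    and roots: "\<And>\<nu> t. poly (char_poly (F \<nu>)) t = 0 \<Longrightarrow> t \<in> \<nu> ` I"
  shows "\<exists>n :: 'i \<Rightarrow> nat. \<forall>\<nu>. char_poly (F \<nu>) = (\<Prod>i\<in>I. [:- \<nu> i, 1:] ^ n i)"
proof -
  obtain \<mu> :: "'i \<Rightarrow> complex" where \<mu>: "inj_on \<mu> I"
  proof -
    obtain f :: "'i \<Rightarrow> nat" where "inj_on f I" using finite_imp_inj_to_nat_seg[OF I] by auto
    then have "inj_on (\<lambda>i. of_nat (f i) :: complex) I" by (auto simp: inj_on_def)
    then show thesis by (rule that)
  qed
  define n where "n i = Polynomial.order (\<mu> i) (char_poly (F \<mu>))" for i
  have "char_poly (F \<nu>) = (\<Prod>i\<in>I. [:- \<nu> i, 1:] ^ n i)" for \<nu> :: "'i \<Rightarrow> complex"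
  proof -
    define l where "l z i = \<nu> i + z * (\<mu> i - \<nu> i)" for z i
    have l01: "l 0 = \<nu>" "l 1 = \<mu>" by (auto simp: l_def)
    define P where "P z = char_poly (F (l z))" for z
    define Q where "Q k z = (\<Prod>i\<in>I. [:- l z i, 1:] ^ k i)" for k :: "'i \<Rightarrow> nat" and z
    have contP: "continuous_on UNIV (\<lambda>z. poly (P z) t)" for t
      unfolding P_def l_def using F cont by (intro continuous_on_char_poly_eval[where n = m])
    have contQ: "continuous_on UNIV (\<lambda>z. poly (Q k z) t)" for t k
      unfolding Q_def l_def poly_prod poly_power poly_pCons by (intro continuous_intros)
    define Z where "Z = {z. inj_on (l z) I}"
    have "finite (- Z)"
    proof -
      have "- Z \<subseteq> (\<Union>(i, j)\<in>I \<times> I - Id. {z. poly [:\<nu> i - \<nu> j, (\<mu> i - \<nu> i) - (\<mu> j - \<nu> j):] z = 0})"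
        by (auto simp: Z_def inj_on_def l_def algebra_simps)
      moreover have "finite \<dots>"
      proof (intro finite_UN_I)
        fix p assume "p \<in> I \<times> I - Id"
        then obtain i j where ij: "p = (i, j)" "i \<in> I" "j \<in> I" "i \<noteq> j" by auto
        have "poly [:\<nu> i - \<nu> j, (\<mu> i - \<nu> i) - (\<mu> j - \<nu> j):] 1 \<noteq> 0"
          using \<mu> ij by (auto simp: inj_on_def)
        then have "[:\<nu> i - \<nu> j, (\<mu> i - \<nu> i) - (\<mu> j - \<nu> j):] \<noteq> 0" by (metis poly_0)
        then show "finite (case p of (i, j) \<Rightarrow> {z. poly [:\<nu> i - \<nu> j, (\<mu> i - \<nu> i) - (\<mu> j - \<nu> j):] z = 0})"
          unfolding ij(1) split by (rule poly_roots_finite)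
      qed (use I in auto)
      ultimately show ?thesis by (rule finite_subset)
    qed
    then have Zconn: "connected Z" and Zdense: "closure Z = UNIV"
      using connected_complement_finite[of "- Z"] closure_complement[of "- Z"] empty_interior_finite[of "- Z"] by auto
    have PQ: "P z = Q (\<lambda>i. Polynomial.order (l z i) (P z)) z" if "z \<in> Z" for z
      unfolding P_def Q_def using char_poly_monic[OF F] roots that I
      by (intro monic_poly_eq_prod_roots) (auto simp: Z_def)
    define K where "K = (I \<rightarrow>\<^sub>E {..m})"
    have K: "finite K" unfolding K_def using I by (intro finite_PiE) auto
    define U where "U k = {z \<in> Z. P z = Q k z}" for k
    have closedU: "closedin (top_of_set Z) (U k)" for k
    proof -
      have "U k = Z \<inter> (\<Inter>t. {z. poly (P z) t = poly (Q k z) t})"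
        by (auto simp: U_def poly_eq_poly_eq_iff[symmetric])
      moreover have "closed (\<Inter>t. {z. poly (P z) t = poly (Q k z) t})"
        by (intro closed_INT ballI closed_Collect_eq contP contQ)
      ultimately show ?thesis by (simp add: closedin_closed_Int)
    qed
    have Uk: "Polynomial.order (l z i) (P z) = k i" if "z \<in> U k" "i \<in> I" for z k i
      using that I by (auto simp: U_def Q_def Z_def order_prod_distinct_roots)
    have cover: "\<exists>k\<in>K. z \<in> U k" if z: "z \<in> Z" for z
    proof (rule bexI[of _ "restrict (\<lambda>i. Polynomial.order (l z i) (P z)) I"])
      have "P z = Q (restrict (\<lambda>i. Polynomial.order (l z i) (P z)) I) z"
        using PQ[OF z] by (simp add: Q_def)
      then show "z \<in> U (restrict (\<lambda>i. Polynomial.order (l z i) (P z)) I)" using z by (simp add: U_def)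
      have "Polynomial.order c (P z) \<le> m" for c
        using order_degree[of "P z" c] char_poly_monic[OF F] by (simp add: P_def)
      then show "restrict (\<lambda>i. Polynomial.order (l z i) (P z)) I \<in> K" by (auto simp: K_def)
    qed
    have one: "1 \<in> Z" using \<mu> by (simp add: Z_def l01)
    then have oneU: "1 \<in> U n" using PQ[of 1] by (simp add: U_def n_def[abs_def] l01 P_def)
    \<comment> \<open>finitely many pieces, so the union of those with other multiplicities is closed as well\<close>
    define C where "C = (\<Union>k\<in>{k\<in>K. \<not> (\<forall>i\<in>I. k i = n i)}. U k)"
    have "closedin (top_of_set Z) C" unfolding C_def using K closedU by (intro closedin_Union) auto
    moreover have "U n \<inter> C = {}"
    proof -
      have "\<forall>i\<in>I. k i = n i" if "z \<in> U n" "z \<in> U k" for z k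
        using Uk[OF that(1)] Uk[OF that(2)] by auto
      then show ?thesis by (auto simp: C_def)
    qed
    moreover have "U n \<union> C = Z"
    proof (intro equalityI subsetI)
      fix z assume z: "z \<in> Z"
      then obtain k where k: "k \<in> K" "z \<in> U k" using cover by blast
      show "z \<in> U n \<union> C"
      proof (cases "\<forall>i\<in>I. k i = n i")
        case True
        then have "Q k z = Q n z" by (simp add: Q_def)
        then show ?thesis using k by (simp add: U_def)
      next
        case False
        then show ?thesis using k unfolding C_def by blast
      qed
    qed (auto simp: U_def C_def)
    ultimately have "C = {}"
      using Zconn closedU[of n] oneU unfolding connected_closedin_eq by blast
    then have Un: "U n = Z" using \<open>U n \<union> C = Z\<close> by simp
    have "poly (P 0) t = poly (Q n 0) t" for t
    proof -
      have "closed {z. poly (P z) t = poly (Q n z) t}" by (intro closed_Collect_eq contP contQ)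
      moreover have "Z \<subseteq> {z. poly (P z) t = poly (Q n z) t}"
      proof
        fix z assume "z \<in> Z"
        then have "z \<in> U n" using Un by simp
        then show "z \<in> {z. poly (P z) t = poly (Q n z) t}" by (simp add: U_def)
      qed
      ultimately have "closure Z \<subseteq> {z. poly (P z) t = poly (Q n z) t}" by (rule closure_minimal[rotated])
      then show ?thesis using Zdense by auto
    qed
    then have "P 0 = Q n 0" by (simp add: poly_eq_poly_eq_iff[symmetric] ext)
    then show ?thesis by (simp add: P_def Q_def l01)
  qed
  then show ?thesis by (intro exI allI)
qed

text \<open>
  A path of matrices similar to \<open>X\<close> from \<open>X\<close> at \<open>z = 0\<close> to \<open>Y\<close> at \<open>z = 1\<close>, with the complex plane minus a finite
  set as parameter space; such parameter spaces stay connected under finite intersections.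
\<close>

definition similarity_path ::
  "nat \<Rightarrow> complex mat \<Rightarrow> complex mat \<Rightarrow> complex set \<Rightarrow> (complex \<Rightarrow> complex mat) \<Rightarrow> bool" where
  "similarity_path n X Y S F \<longleftrightarrow> finite S \<and> 0 \<notin> S \<and> 1 \<notin> S \<and> F 0 = X \<and> F 1 = Y \<and>
     (\<forall>z. z \<notin> S \<longrightarrow> F z \<in> carrier_mat n n \<and> similar_mat (F z) X) \<and>
     (\<forall>a<n. \<forall>b<n. continuous_on (- S) (\<lambda>z. F z $$ (a, b)))"

text \<open>
  If \<open>P\<close> conjugates \<open>Y\<close> to \<open>X\<close>, conjugate \<open>Y\<close> by \<open>R z = 1 + z (P - 1)\<close>, which is invertible except at the
  finitely many zeros of the polynomial \<open>det (R z)\<close>. Expressing the inverse by the adjugate makes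
  continuity of the entries evident.
\<close>

lemma similarity_path_exists:
  fixes X Y :: "complex mat"
  assumes X: "X \<in> carrier_mat n n" and Y: "Y \<in> carrier_mat n n" and sim: "similar_mat X Y"
  shows "\<exists>S F. similarity_path n Y X S F"
proof -
  obtain P Q where PQ: "P \<in> carrier_mat n n" "Q \<in> carrier_mat n n" "P * Q = 1\<^sub>m n" "Q * P = 1\<^sub>m n" "X = P * Y * Q"
  proof -
    obtain n' P Q where PQ: "{X, Y, P, Q} \<subseteq> carrier_mat n' n'" "P * Q = 1\<^sub>m n'" "Q * P = 1\<^sub>m n'" "X = P * Y * Q"
      using similar_matD[OF sim] by (elim exE conjE)
    have "n' = n" using PQ(1) X by auto
    then show thesis using PQ by (intro that) auto
  qed
  define R where "R z = mat n n (\<lambda>(a, b). 1\<^sub>m n $$ (a, b) + z * (P $$ (a, b) - 1\<^sub>m n $$ (a, b)))" for z :: complex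
  have Rc: "R z \<in> carrier_mat n n" for z by (simp add: R_def)
  have R0: "R 0 = 1\<^sub>m n" and R1: "R 1 = P" using PQ by (auto simp: R_def intro!: eq_matI)
  define S where "S = {z. det (R z) = 0}"
  have "finite S"
  proof -
    define D where "D = det (mat n n (\<lambda>(a, b). [:1\<^sub>m n $$ (a, b), P $$ (a, b) - 1\<^sub>m n $$ (a, b):]))"
    have D: "poly D z = det (R z)" for z
      unfolding D_def by (rule poly_det_cong[OF Rc]) (auto simp: R_def)
    have "D \<noteq> 0" using D[of 0] R0 by auto
    then show ?thesis unfolding S_def using poly_roots_finite[of D] by (simp add: D)
  qed
  have "det P \<noteq> 0" using det_mult[OF PQ(1,2)] PQ(3) by auto
  define F where "F z = (1 / det (R z)) \<cdot>\<^sub>m (R z * Y * adj_mat (R z))" for z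
  have adjc: "adj_mat (R z) \<in> carrier_mat n n" for z using adj_mat(1)[OF Rc] .
  have F_eq: "F z = R z * Y * W" if W: "W \<in> carrier_mat n n" "W * R z = 1\<^sub>m n" and z: "det (R z) \<noteq> 0" for z W
  proof -
    have "adj_mat (R z) = W * R z * adj_mat (R z)" by (simp only: W(2) left_mult_one_mat[OF adjc])
    also have "\<dots> = W * (R z * adj_mat (R z))" by (rule assoc_mult_mat[OF W(1) Rc adjc])
    also have "\<dots> = W * (det (R z) \<cdot>\<^sub>m 1\<^sub>m n)" by (simp only: adj_mat(2)[OF Rc])
    also have "\<dots> = det (R z) \<cdot>\<^sub>m W" using W by (simp add: mult_smult_distrib[of _ n n _ n])
    finally have "F z = (1 / det (R z)) \<cdot>\<^sub>m (R z * Y * (det (R z) \<cdot>\<^sub>m W))" by (simp add: F_def)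
    also have "\<dots> = R z * Y * W"
    proof -
      have "R z * Y * (det (R z) \<cdot>\<^sub>m W) = det (R z) \<cdot>\<^sub>m (R z * Y * W)"
        using mult_carrier_mat[OF Rc Y] W by (simp add: mult_smult_distrib[of _ n n _ n])
      then show ?thesis using z Rc Y W by (intro eq_matI) auto
    qed
    finally show ?thesis .
  qed
  have "similarity_path n Y X S F"
    unfolding similarity_path_def
  proof (intro conjI)
    show "finite S" by fact
    show "0 \<notin> S" by (simp add: S_def R0)
    show "1 \<notin> S" using \<open>det P \<noteq> 0\<close> by (simp add: S_def R1)
    show "F 0 = Y" using F_eq[of "1\<^sub>m n" 0] R0 Y by simp
    show "F 1 = X" using F_eq[of Q 1] R1 PQ \<open>det P \<noteq> 0\<close> by simp
    show "\<forall>z. z \<notin> S \<longrightarrow> F z \<in> carrier_mat n n \<and> similar_mat (F z) Y"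
    proof (intro allI impI)
      fix z assume "z \<notin> S"
      then have z: "det (R z) \<noteq> 0" by (simp add: S_def)
      obtain W where W: "W \<in> carrier_mat n n" "R z * W = 1\<^sub>m n" "W * R z = 1\<^sub>m n"
        by (rule det_nonzero_inverse[OF Rc z])
      have Fz: "F z = R z * Y * W" by (rule F_eq[OF W(1,3) z])
      have Fc: "F z \<in> carrier_mat n n" unfolding Fz by (rule mult_carrier_mat[OF mult_carrier_mat[OF Rc Y] W(1)])
      have "similar_mat_wit (F z) Y (R z) W"
        by (rule similar_mat_witI[OF W(2,3) Fz Fc Y Rc W(1)])
      then have "similar_mat (F z) Y" unfolding similar_mat_def by (intro exI)
      with Fc show "F z \<in> carrier_mat n n \<and> similar_mat (F z) Y" by (rule conjI)
    qed
    have contR: "continuous_on (- S) (\<lambda>z. R z $$ (a, b))" if "a < n" "b < n" for a b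
    proof -
      have "continuous_on (- S) (\<lambda>z. 1\<^sub>m n $$ (a, b) + z * (P $$ (a, b) - 1\<^sub>m n $$ (a, b)))"
        by (intro continuous_intros)
      moreover have "R z $$ (a, b) = 1\<^sub>m n $$ (a, b) + z * (P $$ (a, b) - 1\<^sub>m n $$ (a, b))" for z
        using that by (simp add: R_def)
      ultimately show ?thesis by simp
    qed
    have contadj: "continuous_on (- S) (\<lambda>z. adj_mat (R z) $$ (a, b))" if ab: "a < n" "b < n" for a b
    proof -
      have "continuous_on (- S) (\<lambda>z. det (mat_delete (R z) b a))"
      proof (rule continuous_on_det[where n = "n - 1"])
        show "mat_delete (R z) b a \<in> carrier_mat (n - 1) (n - 1)" for z
          using Rc mat_delete_carrier by blast
        fix i j assume ij: "i < n - 1" "j < n - 1"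
        define i' j' where "i' = (if i < b then i else Suc i)" and "j' = (if j < a then j else Suc j)"
        have "continuous_on (- S) (\<lambda>z. R z $$ (i', j'))" using ij by (intro contR) (auto simp: i'_def j'_def)
        moreover have "mat_delete (R z) b a $$ (i, j) = R z $$ (i', j')" for z
          using ij Rc[of z] by (auto simp: mat_delete_def i'_def j'_def)
        ultimately show "continuous_on (- S) (\<lambda>z. mat_delete (R z) b a $$ (i, j))" by simp
      qed
      then have "continuous_on (- S) (\<lambda>z. (- 1) ^ (b + a) * det (mat_delete (R z) b a))"
        by (intro continuous_intros)
      moreover have "adj_mat (R z) $$ (a, b) = (- 1) ^ (b + a) * det (mat_delete (R z) b a)" for z
        using ab Rc[of z] by (auto simp: adj_mat_def cofactor_def)
      ultimately show ?thesis by simp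
    qed
    have "continuous_on (- S) (\<lambda>z. det (R z))" using Rc contR by (intro continuous_on_det[where n = n])
    then have contF: "continuous_on (- S) (\<lambda>z. 1 / det (R z) *
        (\<Sum>j<n. (\<Sum>i<n. R z $$ (a, i) * Y $$ (i, j)) * adj_mat (R z) $$ (j, b)))" if "a < n" "b < n" for a b
      using that contR contadj by (intro continuous_intros) (auto simp: S_def)
    have entry: "F z $$ (a, b) = 1 / det (R z) *
        (\<Sum>j<n. (\<Sum>i<n. R z $$ (a, i) * Y $$ (i, j)) * adj_mat (R z) $$ (j, b))" if ab: "a < n" "b < n" for a b z
    proof -
      have RY: "R z * Y \<in> carrier_mat n n" using Rc Y by (rule mult_carrier_mat)
      have "F z $$ (a, b) = 1 / det (R z) * (R z * Y * adj_mat (R z)) $$ (a, b)"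
        unfolding F_def using ab RY adjc[of z] Rc[of z] by (intro index_smult_mat(1)) auto
      also have "(R z * Y * adj_mat (R z)) $$ (a, b) = (\<Sum>j<n. (R z * Y) $$ (a, j) * adj_mat (R z) $$ (j, b))"
        by (rule mult_mat_entry[OF RY adjc ab])
      also have "\<dots> = (\<Sum>j<n. (\<Sum>i<n. R z $$ (a, i) * Y $$ (i, j)) * adj_mat (R z) $$ (j, b))"
        using mult_mat_entry[OF Rc Y ab(1)] by (intro sum.cong) auto
      finally show ?thesis .
    qed
    show "\<forall>a<n. \<forall>b<n. continuous_on (- S) (\<lambda>z. F z $$ (a, b))" using contF entry by simp
  qed
then show ?thesis by (intro exI)
qed


section \<open>Characteristic polynomials under spectrum-shrinking maps\<close>

text \<open>
  One irreducible representation for each maximal ideal, jointly detecting units: the projections onto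
  the full matrix blocks of the algebra modulo its radical.
\<close>

definition complete_irreps ::
  "'a complex_alg \<Rightarrow> 'i set \<Rightarrow> ('i \<Rightarrow> nat) \<Rightarrow> ('i \<Rightarrow> 'a \<Rightarrow> complex mat) \<Rightarrow> bool" where
  "complete_irreps A J d \<pi> \<longleftrightarrow> finite J \<and> (\<forall>i\<in>J. irreducible_rep A (d i) (\<pi> i)) \<and>
     inj_on (\<lambda>i. rep_kernel A (d i) (\<pi> i)) J \<and>
     (\<forall>a\<in>carrier A. a \<in> Units A \<longleftrightarrow> (\<forall>i\<in>J. det (\<pi> i a) \<noteq> 0))"

abbreviation block_positions :: "'i set \<Rightarrow> ('i \<Rightarrow> nat) \<Rightarrow> ('i \<times> nat \<times> nat) set" where
  "block_positions J d \<equiv> (SIGMA i:J. {..<d i} \<times> {..<d i})"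

text \<open>
  A linear, hence continuous, way \<open>s\<close> of lifting a family of matrix blocks to the algebra. Linearity
  is recorded by the formula for \<open>g (s X)\<close>, which is the form in which continuity is checked.
\<close>

definition irrep_section ::
  "'a complex_alg \<Rightarrow> 'i set \<Rightarrow> ('i \<Rightarrow> nat) \<Rightarrow> ('i \<Rightarrow> 'a \<Rightarrow> complex mat) \<Rightarrow> (('i \<Rightarrow> complex mat) \<Rightarrow> 'a) \<Rightarrow> bool" where
  "irrep_section A J d \<pi> s \<longleftrightarrow> (\<forall>X. s X \<in> carrier A) \<and>
     (\<forall>X. (\<forall>i\<in>J. X i \<in> carrier_mat (d i) (d i)) \<longrightarrow> (\<forall>i\<in>J. \<pi> i (s X) = X i)) \<and>
     (\<forall>g. linear_functional A g \<longrightarrow>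
        (\<exists>w. \<forall>X. g (s X) = (\<Sum>t\<in>block_positions J d. X (fst t) $$ snd t * w t)))"

context fd_complex_algebra
begin

lemma rep_entry_functional:
  assumes \<rho>: "matrix_rep A n \<rho>" and "r < n" "c < n"
  shows "linear_functional A (\<lambda>x. \<rho> x $$ (r, c))"
proof -
  have "dim_row (\<rho> x) = n" "dim_col (\<rho> x) = n" if "x \<in> carrier A" for x
    using matrix_repD(1)[OF \<rho> that] by auto
  then show ?thesis using assms(2,3) by (simp add: linear_functional_def matrix_repD[OF \<rho>])
qed

lemma complete_irrepsD:
  assumes "complete_irreps A J d \<pi>"
  shows "finite J" "i \<in> J \<Longrightarrow> irreducible_rep A (d i) (\<pi> i)" "i \<in> J \<Longrightarrow> matrix_rep A (d i) (\<pi> i)"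
    "i \<in> J \<Longrightarrow> d i > 0" "i \<in> J \<Longrightarrow> a \<in> carrier A \<Longrightarrow> \<pi> i a \<in> carrier_mat (d i) (d i)"
  using assms by (auto simp: complete_irreps_def irreducible_rep_def matrix_rep_def)

lemma complete_irreps_exist:
  assumes M: "bij_betw M J (Max_ideals A)" and J: "finite J"
  shows "\<exists>d \<pi>. complete_irreps A J d \<pi> \<and> (\<forall>i\<in>J. rep_kernel A (d i) (\<pi> i) = M i)"
proof -
  obtain d \<pi> where d\<pi>: "\<forall>I\<in>Max_ideals A. irreducible_rep A (d I) (\<pi> I) \<and> rep_kernel A (d I) (\<pi> I) = I"
    "\<forall>a\<in>carrier A. a \<in> Units A \<longleftrightarrow> (\<forall>I\<in>Max_ideals A. det (\<pi> I a) \<noteq> 0)"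
    using irreducible_reps_of_maximal_ideals by metis
  have MJ: "M ` J = Max_ideals A" "inj_on M J" using M by (auto simp: bij_betw_def)
  have ker: "rep_kernel A (d (M i)) (\<pi> (M i)) = M i" "irreducible_rep A (d (M i)) (\<pi> (M i))" if "i \<in> J" for i
    using d\<pi>(1) MJ(1) that by auto
  have inj: "inj_on (\<lambda>i. rep_kernel A (d (M i)) (\<pi> (M i))) J"
    using MJ(2) ker(1) by (auto simp: inj_on_def)
  have "a \<in> Units A \<longleftrightarrow> (\<forall>i\<in>J. det (\<pi> (M i) a) \<noteq> 0)" if "a \<in> carrier A" for a
    using d\<pi>(2) that MJ(1)[symmetric] by simp
  then have "complete_irreps A J (\<lambda>i. d (M i)) (\<lambda>i. \<pi> (M i))"
    using J ker(2) inj by (simp add: complete_irreps_def)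
  then show ?thesis using ker(1) by blast
qed

text \<open>
  The spectrum depends only on the image of the element in the matrix blocks.
\<close>

lemma spectrum_eq_char_poly_roots:
  assumes ci: "complete_irreps A J d \<pi>" and a: "a \<in> carrier A"
  shows "c \<in> spectrum_in A a \<longleftrightarrow> (\<exists>i\<in>J. poly (char_poly (\<pi> i a)) c = 0)"
proof -
  have x: "c \<odot> \<one> \<ominus> a \<in> carrier A" using a by simp
  have "det (\<pi> i (c \<odot> \<one> \<ominus> a)) = poly (char_poly (\<pi> i a)) c" if i: "i \<in> J" for i
  proof -
    have \<pi>: "matrix_rep A (d i) (\<pi> i)" using complete_irrepsD(3)[OF ci i] .
    have "\<pi> i (c \<odot> \<one> \<ominus> a) = c \<cdot>\<^sub>m 1\<^sub>m (d i) - \<pi> i a"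
      using a matrix_rep_minus[OF \<pi>, of "c \<odot> \<one>" a] matrix_repD(2)[OF \<pi>] matrix_repD(5)[OF \<pi>, of \<one> c] by simp
    then show ?thesis using char_poly_eval[OF matrix_repD(1)[OF \<pi> a]] by simp
  qed
  moreover have "c \<odot> \<one> \<ominus> a \<in> Units A \<longleftrightarrow> (\<forall>i\<in>J. det (\<pi> i (c \<odot> \<one> \<ominus> a)) \<noteq> 0)"
    using ci x by (simp add: complete_irreps_def)
  ultimately show ?thesis by (auto simp: spectrum_in_def)
qed

text \<open>
  Lift the matrix units of all blocks and take linear combinations.
\<close>

lemma irrep_section_exists:
  assumes ci: "complete_irreps A J d \<pi>"
  shows "\<exists>s. irrep_section A J d \<pi> s"
proof -
  define K where "K = block_positions J d"
  have K: "finite K" unfolding K_def using complete_irrepsD(1)[OF ci] by auto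
  define E :: "'b \<times> nat \<times> nat \<Rightarrow> 'b \<Rightarrow> complex mat"
    where "E t i = (if i = fst t then mat (d i) (d i) (\<lambda>p. if p = snd t then 1 else 0) else 0\<^sub>m (d i) (d i))"
    for t i
  have Ec: "E t i \<in> carrier_mat (d i) (d i)" for t i by (simp add: E_def)
  have "\<exists>a\<in>carrier A. \<forall>i\<in>J. \<pi> i a = E t i" for t
  proof -
    have inj: "inj_on (\<lambda>i. rep_kernel A (d i) (\<pi> i)) J" using ci by (simp add: complete_irreps_def)
    show ?thesis
      by (rule irreducible_reps_jointly_surjective[OF complete_irrepsD(1)[OF ci] complete_irrepsD(2)[OF ci] inj Ec[of t]])
        auto
  qed
  then obtain e where e: "\<And>t. e t \<in> carrier A" "\<And>t i. i \<in> J \<Longrightarrow> \<pi> i (e t) = E t i" by metis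
  define s where "s X = (\<Oplus>t\<in>K. X (fst t) $$ snd t \<odot> e t)" for X
  have gs: "g (s X) = (\<Sum>t\<in>K. X (fst t) $$ snd t * g (e t))" if "linear_functional A g" for g X
    unfolding s_def using K e by (intro linear_functional_sum[OF that]) auto
  have sA: "s X \<in> carrier A" for X unfolding s_def using e by (intro finsum_closed) auto
  have "irrep_section A J d \<pi> s"
    unfolding irrep_section_def
  proof (intro conjI allI impI ballI)
    show "s X \<in> carrier A" for X by (rule sA)
  next
    fix X :: "'b \<Rightarrow> complex mat" and i
    assume X: "\<forall>i\<in>J. X i \<in> carrier_mat (d i) (d i)" and i: "i \<in> J"
    show "\<pi> i (s X) = X i"
    proof (rule eq_matI)
      fix r c assume "r < dim_row (X i)" "c < dim_col (X i)"
      then have rc: "r < d i" "c < d i" using X i by auto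
      have "\<pi> i (s X) $$ (r, c) = (\<Sum>t\<in>K. X (fst t) $$ snd t * \<pi> i (e t) $$ (r, c))"
        by (rule gs[OF rep_entry_functional[OF complete_irrepsD(3)[OF ci i] rc]])
      also have "\<dots> = (\<Sum>t\<in>K. if t = (i, r, c) then X i $$ (r, c) else 0)"
        using i rc by (intro sum.cong) (auto simp: e(2) E_def split: if_splits)
      also have "\<dots> = X i $$ (r, c)" using K i rc by (simp add: K_def)
      finally show "\<pi> i (s X) $$ (r, c) = X i $$ (r, c)" .
    qed (use X i complete_irrepsD(5)[OF ci i sA[of X]] in auto)
  next
    fix g assume "linear_functional A g"
    then show "\<exists>w. \<forall>X. g (s X) = (\<Sum>t\<in>block_positions J d. X (fst t) $$ snd t * w t)"
      using gs by (intro exI[of _ "\<lambda>t. g (e t)"]) (simp add: K_def)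
  qed
  then show ?thesis by blast
qed

end

locale spectrum_shrinking_rep = fd_complex_algebra A for A :: "'a complex_alg" (structure) +
  fixes T :: "'a topology" and J :: "'i set" and d :: "'i \<Rightarrow> nat" and \<pi> :: "'i \<Rightarrow> 'a \<Rightarrow> complex mat"
    and s :: "('i \<Rightarrow> complex mat) \<Rightarrow> 'a" and m :: nat and \<psi> :: "'a \<Rightarrow> complex mat"
  assumes T: "hausdorff_vector_topology A T"
    and irreps: "complete_irreps A J d \<pi>"
    and section_s: "irrep_section A J d \<pi> s"
    and \<psi>_carrier: "\<And>x. x \<in> carrier A \<Longrightarrow> \<psi> x \<in> carrier_mat m m"
    and \<psi>_continuous: "\<And>a b. a < m \<Longrightarrow> b < m \<Longrightarrow> continuous_map T euclidean (\<lambda>x. \<psi> x $$ (a, b))"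
    and \<psi>_shrinks: "\<And>x t. x \<in> carrier A \<Longrightarrow> poly (char_poly (\<psi> x)) t = 0 \<Longrightarrow> t \<in> spectrum_in A x"
begin

lemmas finite_J = complete_irrepsD(1)[OF irreps]
lemmas \<pi>_rep = complete_irrepsD(3)[OF irreps]
lemmas d_pos = complete_irrepsD(4)[OF irreps]
lemmas \<pi>_carrier = complete_irrepsD(5)[OF irreps]

lemma s_closed: "s X \<in> carrier A"
  using section_s by (simp add: irrep_section_def)

lemma \<pi>_s: "(\<And>i. i \<in> J \<Longrightarrow> X i \<in> carrier_mat (d i) (d i)) \<Longrightarrow> i \<in> J \<Longrightarrow> \<pi> i (s X) = X i"
  using section_s by (simp add: irrep_section_def)

lemma functional_s_continuous:
  assumes g: "linear_functional A g"
    and X: "\<And>i r c. i \<in> J \<Longrightarrow> r < d i \<Longrightarrow> c < d i \<Longrightarrow> continuous_on Z (\<lambda>z. X z i $$ (r, c))"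
  shows "continuous_on Z (\<lambda>z. g (s (X z)))"
proof -
  obtain w where w: "\<And>X. g (s X) = (\<Sum>t\<in>block_positions J d. X (fst t) $$ snd t * w t)"
    using section_s g by (auto simp: irrep_section_def)
  show ?thesis unfolding w using X by (intro continuous_intros) auto
qed

lemma finite_roots:
  assumes X: "\<And>i. i \<in> J \<Longrightarrow> X i \<in> carrier_mat (d i) (d i)"
  shows "finite {t :: complex. \<exists>i\<in>J. poly (char_poly (X i)) t = 0}"
proof -
  have "finite {t. poly (char_poly (X i)) t = 0}" if "i \<in> J" for i
    by (rule poly_roots_finite[OF char_poly_monic(3)[OF X[OF that]]])
  then have "finite (\<Union>i\<in>J. {t. poly (char_poly (X i)) t = 0})" using finite_J by auto
  moreover have "{t. \<exists>i\<in>J. poly (char_poly (X i)) t = 0} = (\<Union>i\<in>J. {t. poly (char_poly (X i)) t = 0})" by auto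
  ultimately show ?thesis by simp
qed

text \<open>
  Along a path whose blocks keep their characteristic polynomials the spectrum is a fixed finite set, so
  that the eigenvalues available to \<open>\<psi>\<close> cannot move continuously.
\<close>

lemma char_poly_constant_on_isospectral_path:
  fixes \<gamma> :: "complex \<Rightarrow> 'a"
  assumes Z: "connected Z" and \<gamma>: "\<And>z. z \<in> Z \<Longrightarrow> \<gamma> z \<in> carrier A"
    and cont: "\<And>g. linear_functional A g \<Longrightarrow> continuous_on Z (\<lambda>z. g (\<gamma> z))"
    and X: "\<And>i. i \<in> J \<Longrightarrow> X i \<in> carrier_mat (d i) (d i)"
    and spec: "\<And>z i. z \<in> Z \<Longrightarrow> i \<in> J \<Longrightarrow> char_poly (\<pi> i (\<gamma> z)) = char_poly (X i)"
    and zw: "z \<in> Z" "w \<in> Z"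
  shows "char_poly (\<psi> (\<gamma> z)) = char_poly (\<psi> (\<gamma> w))"
proof (rule char_poly_constant_on_connected[OF Z])
  show "\<psi> (\<gamma> z) \<in> carrier_mat m m" if "z \<in> Z" for z using \<psi>_carrier[OF \<gamma>[OF that]] .
  have "continuous_map (top_of_set Z) T \<gamma>"
    unfolding continuous_map_iff_functionals[OF T] using \<gamma> cont by auto
  fix a b assume ab: "a < m" "b < m"
  have "continuous_map (top_of_set Z) euclidean ((\<lambda>x. \<psi> x $$ (a, b)) \<circ> \<gamma>)"
    using \<open>continuous_map (top_of_set Z) T \<gamma>\<close> \<psi>_continuous[OF ab] by (rule continuous_map_compose)
  then show "continuous_on Z (\<lambda>z. \<psi> (\<gamma> z) $$ (a, b))" by (simp add: o_def)
next
  show "finite {t. \<exists>i\<in>J. poly (char_poly (X i)) t = 0}" by (rule finite_roots[OF X])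
  fix z t assume z: "z \<in> Z" "poly (char_poly (\<psi> (\<gamma> z))) t = 0"
  have "t \<in> spectrum_in A (\<gamma> z)" by (rule \<psi>_shrinks[OF \<gamma>[OF z(1)] z(2)])
  then show "t \<in> {t. \<exists>i\<in>J. poly (char_poly (X i)) t = 0}"
    using spectrum_eq_char_poly_roots[OF irreps \<gamma>[OF z(1)]] spec[OF z(1)] by auto
qed (use zw in auto)

text \<open>
  The segment from \<open>a\<close> to \<open>b\<close> has constant image in the blocks.
\<close>

lemma char_poly_depends_on_blocks:
  assumes a: "a \<in> carrier A" and b: "b \<in> carrier A" and eq: "\<And>i. i \<in> J \<Longrightarrow> \<pi> i a = \<pi> i b"
  shows "char_poly (\<psi> a) = char_poly (\<psi> b)"
proof -
  define \<gamma> where "\<gamma> z = a \<oplus> z \<odot> (b \<ominus> a)" for z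
  have "char_poly (\<psi> (\<gamma> 0)) = char_poly (\<psi> (\<gamma> 1))"
  proof (rule char_poly_constant_on_isospectral_path[where Z = UNIV and X = "\<lambda>i. \<pi> i a"])
    show "\<gamma> z \<in> carrier A" for z using a b by (simp add: \<gamma>_def)
    show "continuous_on UNIV (\<lambda>z. g (\<gamma> z))" if "linear_functional A g" for g
    proof -
      have "g (\<gamma> z) = g a + z * g (b \<ominus> a)" for z
        using that a b by (simp add: \<gamma>_def linear_functional_def)
      then show ?thesis by (auto intro!: continuous_intros)
    qed
    show "char_poly (\<pi> i (\<gamma> z)) = char_poly (\<pi> i a)" if i: "i \<in> J" for i z
    proof -
      have "\<pi> i (\<gamma> z) = \<pi> i a + z \<cdot>\<^sub>m (\<pi> i a - \<pi> i a)"
        using a b matrix_rep_minus[OF \<pi>_rep[OF i] b a] eq[OF i]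
        by (simp add: \<gamma>_def matrix_repD[OF \<pi>_rep[OF i]])
      also have "\<dots> = \<pi> i a" using \<pi>_carrier[OF i a] by (intro eq_matI) auto
      finally show ?thesis by simp
    qed
  qed (use a \<pi>_carrier in auto)
  moreover have "\<gamma> 0 = a" using a b smult_l_null[of "b \<ominus> a"] by (simp add: \<gamma>_def)
  moreover have "\<gamma> 1 = b"
  proof -
    have "\<gamma> 1 = a \<oplus> (b \<ominus> a)" using a b smult_one[of "b \<ominus> a"] by (simp add: \<gamma>_def)
    also have "\<dots> = b" using a b by (simp add: a_minus_def a_lcomm[of a b] r_neg)
    finally show ?thesis .
  qed
  ultimately show ?thesis by simp
qed

lemma char_poly_block_cong:
  assumes X: "\<And>i. i \<in> J \<Longrightarrow> X i \<in> carrier_mat (d i) (d i)" and eq: "\<And>i. i \<in> J \<Longrightarrow> X i = Y i"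
  shows "char_poly (\<psi> (s X)) = char_poly (\<psi> (s Y))"
proof (rule char_poly_depends_on_blocks[OF s_closed s_closed])
  fix i assume i: "i \<in> J"
  have "\<pi> i (s X) = X i" by (rule \<pi>_s[OF X i])
  moreover have "\<pi> i (s Y) = Y i" by (rule \<pi>_s[OF _ i]) (use X eq in auto)
  ultimately show "\<pi> i (s X) = \<pi> i (s Y)" using eq[OF i] by simp
qed

lemma char_poly_constant_on_block_path:
  fixes F :: "complex \<Rightarrow> 'i \<Rightarrow> complex mat"
  assumes Z: "connected Z" and F: "\<And>z i. z \<in> Z \<Longrightarrow> i \<in> J \<Longrightarrow> F z i \<in> carrier_mat (d i) (d i)"
    and cont: "\<And>i r c. i \<in> J \<Longrightarrow> r < d i \<Longrightarrow> c < d i \<Longrightarrow> continuous_on Z (\<lambda>z. F z i $$ (r, c))"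
    and X: "\<And>i. i \<in> J \<Longrightarrow> X i \<in> carrier_mat (d i) (d i)"
    and spec: "\<And>z i. z \<in> Z \<Longrightarrow> i \<in> J \<Longrightarrow> char_poly (F z i) = char_poly (X i)"
    and zw: "z \<in> Z" "w \<in> Z"
  shows "char_poly (\<psi> (s (F z))) = char_poly (\<psi> (s (F w)))"
proof (rule char_poly_constant_on_isospectral_path[OF Z, where \<gamma> = "\<lambda>z. s (F z)" and X = X])
  show "continuous_on Z (\<lambda>z. g (s (F z)))" if "linear_functional A g" for g
    by (rule functional_s_continuous[OF that cont])
  show "char_poly (\<pi> i (s (F z))) = char_poly (X i)" if z: "z \<in> Z" and i: "i \<in> J" for z i
    using \<pi>_s[OF F[OF z] i] spec[OF z i] by simp
qed (use X zw s_closed in auto)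

lemma char_poly_similarity_invariant:
  assumes X: "\<And>i. i \<in> J \<Longrightarrow> X i \<in> carrier_mat (d i) (d i)"
    and Y: "\<And>i. i \<in> J \<Longrightarrow> Y i \<in> carrier_mat (d i) (d i)"
    and sim: "\<And>i. i \<in> J \<Longrightarrow> similar_mat (X i) (Y i)"
  shows "char_poly (\<psi> (s X)) = char_poly (\<psi> (s Y))"
proof -
  have "\<exists>S F. similarity_path (d i) (Y i) (X i) S F" if i: "i \<in> J" for i
    by (rule similarity_path_exists[OF X[OF i] Y[OF i] sim[OF i]])
  then obtain S F where "\<And>i. i \<in> J \<Longrightarrow> similarity_path (d i) (Y i) (X i) (S i) (F i)" by metis
  then have SF: "finite (S i)" "0 \<notin> S i" "1 \<notin> S i" "F i 0 = Y i" "F i 1 = X i"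
      "z \<notin> S i \<Longrightarrow> F i z \<in> carrier_mat (d i) (d i)" "z \<notin> S i \<Longrightarrow> similar_mat (F i z) (Y i)"
      "a < d i \<Longrightarrow> b < d i \<Longrightarrow> continuous_on (- S i) (\<lambda>z. F i z $$ (a, b))"
    if "i \<in> J" for i z a b using that unfolding similarity_path_def by blast+
  define Z where "Z = - (\<Union>i\<in>J. S i)"
  have "finite (\<Union>i\<in>J. S i)" using finite_J SF(1) by auto
  then have Z: "connected Z" unfolding Z_def by (rule connected_complement_finite)
  have Fz: "F i z \<in> carrier_mat (d i) (d i)" "similar_mat (F i z) (Y i)" if "z \<in> Z" "i \<in> J" for z i
    using SF(6,7)[OF that(2)] that by (auto simp: Z_def)
  have Z01: "0 \<in> Z" "1 \<in> Z" using SF(2,3) by (auto simp: Z_def)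
  have "char_poly (\<psi> (s X)) = char_poly (\<psi> (s (\<lambda>i. F i 1)))"
    by (rule char_poly_block_cong[OF X]) (use SF(5) in auto)
  also have "\<dots> = char_poly (\<psi> (s (\<lambda>i. F i 0)))"
  proof (rule char_poly_constant_on_block_path[OF Z, where X = Y])
    fix i r c assume i: "i \<in> J" and rc: "r < d i" "c < d i"
    show "continuous_on Z (\<lambda>z. F i z $$ (r, c))"
      by (rule continuous_on_subset[OF SF(8)[OF i rc]]) (use i in \<open>auto simp: Z_def\<close>)
  qed (use Y Fz(1) char_poly_similar[OF Fz(2)] Z01 in auto)
  also have "\<dots> = char_poly (\<psi> (s Y))"
    by (rule char_poly_block_cong[OF Y, symmetric]) (use SF(4) in auto)
  finally show ?thesis .
qed

definition diag_block :: "('i \<times> nat \<Rightarrow> complex) \<Rightarrow> 'i \<Rightarrow> complex mat" where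
  "diag_block \<nu> i = mat (d i) (d i) (\<lambda>(a, b). if a = b then \<nu> (i, a) else 0)"

lemma diag_block_carrier: "diag_block \<nu> i \<in> carrier_mat (d i) (d i)"
  by (simp add: diag_block_def)

lemma char_poly_upper_triangular_prod:
  fixes Y :: "complex mat"
  assumes Y: "Y \<in> carrier_mat n n" "upper_triangular Y"
  shows "char_poly Y = (\<Prod>a<n. [:- Y $$ (a, a), 1:])"
proof -
  have "char_poly Y = (\<Prod>a\<leftarrow>map (\<lambda>i. Y $$ (i, i)) [0..<n]. [:- a, 1:])"
    using char_poly_upper_triangular[OF Y] Y(1) by (simp add: diag_mat_def)
  also have "\<dots> = (\<Prod>a<n. [:- Y $$ (a, a), 1:])"
    by (simp add: prod.list_conv_set_nth atLeast0LessThan)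
  finally show ?thesis .
qed

lemma char_poly_diag_block: "char_poly (diag_block \<nu> i) = (\<Prod>a<d i. [:- \<nu> (i, a), 1:])"
proof -
  have "upper_triangular (diag_block \<nu> i)" by (auto simp: diag_block_def upper_triangular_def)
  from char_poly_upper_triangular_prod[OF diag_block_carrier this] show ?thesis by (simp add: diag_block_def)
qed

text \<open>
  Scaling the entries above the diagonal by \<open>z\<close> keeps the characteristic polynomial of every block.
\<close>

lemma char_poly_triangular_eq_diagonal:
  assumes Y: "\<And>i. i \<in> J \<Longrightarrow> Y i \<in> carrier_mat (d i) (d i)" "\<And>i. i \<in> J \<Longrightarrow> upper_triangular (Y i)"
    and \<nu>: "\<And>i a. i \<in> J \<Longrightarrow> a < d i \<Longrightarrow> \<nu> (i, a) = Y i $$ (a, a)"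
  shows "char_poly (\<psi> (s Y)) = char_poly (\<psi> (s (diag_block \<nu>)))"
proof -
  define F where "F i z = mat (d i) (d i) (\<lambda>(a, b). if a = b then Y i $$ (a, a) else z * Y i $$ (a, b))" for i and z :: complex
  have Fc: "F i z \<in> carrier_mat (d i) (d i)" for i z by (simp add: F_def)
  have triangular: "upper_triangular (F i z)" if "i \<in> J" for i z
    using Y[OF that] by (auto simp: F_def upper_triangular_def)
  have "char_poly (\<psi> (s Y)) = char_poly (\<psi> (s (\<lambda>i. F i 1)))"
  proof (rule char_poly_block_cong[OF Y(1)])
    show "Y i = F i 1" if "i \<in> J" for i
      using Y(1)[OF that] by (intro eq_matI) (auto simp: F_def)
  qed
  also have "\<dots> = char_poly (\<psi> (s (\<lambda>i. F i 0)))"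
  proof (rule char_poly_constant_on_block_path[where Z = UNIV and X = Y])
    show "continuous_on UNIV (\<lambda>z. F i z $$ (r, c))" if "i \<in> J" "r < d i" "c < d i" for i r c
      using that by (cases "r = c") (auto simp: F_def intro!: continuous_intros)
    show "char_poly (F i z) = char_poly (Y i)" if i: "i \<in> J" for i z
      using char_poly_upper_triangular_prod[OF Y[OF i]] char_poly_upper_triangular_prod[OF Fc triangular[OF i]]
      by (simp add: F_def)
  qed (use Y Fc in auto)
  also have "\<dots> = char_poly (\<psi> (s (diag_block \<nu>)))"
    by (rule char_poly_block_cong[OF Fc]) (use \<nu> in \<open>auto intro!: eq_matI simp: F_def diag_block_def\<close>)
  finally show ?thesis .
qed

definition diag_positions :: "('i \<times> nat) set" where
  "diag_positions = (SIGMA i:J. {..<d i})"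

lemma finite_diag_positions: "finite diag_positions"
  unfolding diag_positions_def using finite_J by auto

lemma diagonal_multiplicities:
  "\<exists>n :: 'i \<times> nat \<Rightarrow> nat.
    \<forall>\<nu>. char_poly (\<psi> (s (diag_block \<nu>))) = (\<Prod>p\<in>diag_positions. [:- \<nu> p, 1:] ^ n p)"
proof (rule multiplicities_constant_on_diagonal[OF finite_diag_positions, where F = "\<lambda>\<nu>. \<psi> (s (diag_block \<nu>))" and m = m])
  show "\<psi> (s (diag_block \<nu>)) \<in> carrier_mat m m" for \<nu> by (rule \<psi>_carrier[OF s_closed])
  show "continuous_on UNIV (\<lambda>z. \<psi> (s (diag_block (\<lambda>i. \<nu> i + z * (\<mu> i - \<nu> i)))) $$ (a, b))"
    if ab: "a < m" "b < m" for \<nu> \<mu> a b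
  proof -
    define \<gamma> where "\<gamma> z = s (diag_block (\<lambda>i. \<nu> i + z * (\<mu> i - \<nu> i)))" for z :: complex
    have "continuous_on UNIV (\<lambda>z. g (\<gamma> z))" if g: "linear_functional A g" for g
      unfolding \<gamma>_def
    proof (rule functional_s_continuous[OF g])
      fix i r c assume "i \<in> J" "r < d i" "c < d i"
      then show "continuous_on UNIV (\<lambda>z. diag_block (\<lambda>i. \<nu> i + z * (\<mu> i - \<nu> i)) i $$ (r, c))"
        by (cases "r = c") (auto simp: diag_block_def intro!: continuous_intros)
    qed
    then have "continuous_map euclidean T \<gamma>"
      unfolding continuous_map_iff_functionals[OF T] using s_closed by (auto simp: \<gamma>_def)
    from continuous_map_compose[OF this \<psi>_continuous[OF ab]]
    show ?thesis by (simp add: o_def \<gamma>_def)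
  qed
  fix \<nu> t assume "poly (char_poly (\<psi> (s (diag_block \<nu>)))) t = 0"
  then have "t \<in> spectrum_in A (s (diag_block \<nu>))" by (rule \<psi>_shrinks[OF s_closed])
  then obtain i where i: "i \<in> J" "poly (char_poly (diag_block \<nu> i)) t = 0"
    using spectrum_eq_char_poly_roots[OF irreps s_closed] \<pi>_s[OF diag_block_carrier] by auto
  then obtain a where "a < d i" "t = \<nu> (i, a)" by (auto simp: char_poly_diag_block poly_prod)
  then show "t \<in> \<nu> ` diag_positions" using i(1) by (auto simp: diag_positions_def)
qed

text \<open>
  Schur triangularization puts the eigenvalues of each block on the diagonal in any prescribed order. It is
  a similarity, and the entries above the diagonal can then be scaled to zero. The freedom in the
  order is what relates different diagonal positions of the same block.
\<close>

lemma char_poly_eq_diagonal: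
  assumes a: "a \<in> carrier A"
    and \<nu>: "\<And>i. i \<in> J \<Longrightarrow> char_poly (\<pi> i a) = (\<Prod>r<d i. [:- \<nu> (i, r), 1:])"
  shows "char_poly (\<psi> a) = char_poly (\<psi> (s (diag_block \<nu>)))"
proof -
  define es where "es i = map (\<lambda>r. \<nu> (i, r)) [0..<d i]" for i
  define Y where "Y i = fst (schur_decomposition (\<pi> i a) (es i))" for i
  have Y: "similar_mat (\<pi> i a) (Y i)" "upper_triangular (Y i)" "diag_mat (Y i) = es i"
    "Y i \<in> carrier_mat (d i) (d i)" if i: "i \<in> J" for i
  proof -
    have "char_poly (\<pi> i a) = (\<Prod>c\<leftarrow>es i. [:- c, 1:])"
      unfolding \<nu>[OF i] es_def by (simp add: prod.list_conv_set_nth atLeast0LessThan)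
    moreover obtain B P Q where B: "schur_decomposition (\<pi> i a) (es i) = (B, P, Q)" by (rule prod_cases3)
    ultimately have sd: "similar_mat_wit (\<pi> i a) B P Q" "upper_triangular B" "diag_mat B = es i"
      using schur_decomposition[OF \<pi>_carrier[OF i a] _ B] by simp_all
    have "Y i = B" by (simp add: Y_def B)
    then show "similar_mat (\<pi> i a) (Y i)" "upper_triangular (Y i)" "diag_mat (Y i) = es i"
      "Y i \<in> carrier_mat (d i) (d i)"
      using sd similar_mat_witD2(5)[OF \<pi>_carrier[OF i a] sd(1)] by (auto simp: similar_mat_def)
  qed
  have diag: "\<nu> (i, r) = Y i $$ (r, r)" if "i \<in> J" "r < d i" for i r
    using arg_cong[OF Y(3)[OF that(1)], of "\<lambda>l. l ! r"] Y(4)[OF that(1)] that(2)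
    by (simp add: es_def diag_mat_def)
  have "char_poly (\<psi> a) = char_poly (\<psi> (s (\<lambda>i. \<pi> i a)))"
    using \<pi>_s[OF \<pi>_carrier[OF _ a], symmetric] by (intro char_poly_depends_on_blocks[OF a s_closed])
  also have "\<dots> = char_poly (\<psi> (s Y))"
    by (rule char_poly_similarity_invariant[OF \<pi>_carrier[OF _ a] Y(4) Y(1)])
  also have "\<dots> = char_poly (\<psi> (s (diag_block \<nu>)))"
    by (rule char_poly_triangular_eq_diagonal[OF Y(4) Y(2) diag])
  finally show ?thesis .
qed

text \<open>
  Exchanging two eigenvalues of one block changes only the order in which they are listed, which \<open>\<psi>\<close>
  does not notice. Comparing the order of the same root before and after the exchange equates the two
  multiplicities.
\<close>

lemma multiplicities_constant_on_blocks:
  assumes n: "\<And>\<nu>. char_poly (\<psi> (s (diag_block \<nu>))) = (\<Prod>p\<in>diag_positions. [:- \<nu> p, 1:] ^ n p)"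
    and i: "i \<in> J" and ab: "a < d i" "b < d i"
  shows "n (i, a) = n (i, b)"
proof -
  \<comment> \<open>any pairwise distinct diagonal entries will do\<close>
  obtain f :: "'i \<times> nat \<Rightarrow> nat" where f: "inj_on f diag_positions"
    using finite_imp_inj_to_nat_seg[OF finite_diag_positions] by auto
  define \<nu> where "\<nu> p = (of_nat (f p) :: complex)" for p
  have \<nu>: "inj_on \<nu> diag_positions" using f by (auto simp: inj_on_def \<nu>_def)
  define \<tau> where "\<tau> = Transposition.transpose (i, a) (i, b)"
  have pos: "(i, a) \<in> diag_positions" "(i, b) \<in> diag_positions" using i ab by (auto simp: diag_positions_def)
  have \<nu>\<tau>: "inj_on (\<nu> \<circ> \<tau>) diag_positions"
  proof (rule comp_inj_on)
    show "inj_on \<tau> diag_positions" by (rule inj_on_inverseI[of _ \<tau>]) (simp add: \<tau>_def)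
    have "\<tau> ` diag_positions \<subseteq> diag_positions" using pos by (auto simp: \<tau>_def Transposition.transpose_def)
    then show "inj_on \<nu> (\<tau> ` diag_positions)" by (rule inj_on_subset[OF \<nu>])
  qed
  have "char_poly (\<psi> (s (diag_block \<nu>))) = char_poly (\<psi> (s (diag_block (\<nu> \<circ> \<tau>))))"
  proof (rule char_poly_eq_diagonal[OF s_closed])
    fix j assume j: "j \<in> J"
    define p where "p = (if j = i then Transposition.transpose a b else id)"
    have p: "p permutes {..<d j}" using ab by (auto simp: p_def permutes_id intro!: permutes_swap_id)
    have "\<tau> (j, r) = (j, p r)" for r by (auto simp: \<tau>_def p_def Transposition.transpose_def)
    then have "(\<Prod>r<d j. [:- (\<nu> \<circ> \<tau>) (j, r), 1:]) = (\<Prod>r<d j. [:- \<nu> (j, r), 1:])"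
      using prod.permute[OF p, of "\<lambda>r. [:- \<nu> (j, r), 1:]"] by (simp add: o_def)
    then show "char_poly (\<pi> j (s (diag_block \<nu>))) = (\<Prod>r<d j. [:- (\<nu> \<circ> \<tau>) (j, r), 1:])"
      using \<pi>_s[OF diag_block_carrier j] by (simp add: char_poly_diag_block)
  qed
  then have eq: "(\<Prod>p\<in>diag_positions. [:- (\<nu> \<circ> \<tau>) p, 1:] ^ n p) = (\<Prod>p\<in>diag_positions. [:- \<nu> p, 1:] ^ n p)"
    unfolding n by simp
  have "n (i, b) = Polynomial.order ((\<nu> \<circ> \<tau>) (i, b)) (\<Prod>p\<in>diag_positions. [:- (\<nu> \<circ> \<tau>) p, 1:] ^ n p)"
    by (rule order_prod_distinct_roots[OF finite_diag_positions \<nu>\<tau> pos(2), symmetric])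
  also have "(\<nu> \<circ> \<tau>) (i, b) = \<nu> (i, a)" by (simp add: \<tau>_def)
  also have "Polynomial.order (\<nu> (i, a)) (\<Prod>p\<in>diag_positions. [:- (\<nu> \<circ> \<tau>) p, 1:] ^ n p) = n (i, a)"
    unfolding eq by (rule order_prod_distinct_roots[OF finite_diag_positions \<nu> pos(1)])
  finally show ?thesis by simp
qed

text \<open>
  Isospectral paths move every element to a diagonal one. On diagonal elements the multiplicities are
  constant, and equal for positions in the same block, so that the linear factors of a block combine to
  its characteristic polynomial.
\<close>

theorem char_poly_of_spectrum_shrinking:
  "\<exists>x :: 'i \<Rightarrow> nat. \<forall>a\<in>carrier A. char_poly (\<psi> a) = (\<Prod>i\<in>J. char_poly (\<pi> i a) ^ x i)"
proof -
  obtain n where n: "\<And>\<nu>. char_poly (\<psi> (s (diag_block \<nu>))) = (\<Prod>p\<in>diag_positions. [:- \<nu> p, 1:] ^ n p)"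
    using diagonal_multiplicities by blast
  define x where "x i = n (i, 0)" for i
  have diag: "char_poly (\<psi> (s (diag_block \<nu>))) = (\<Prod>i\<in>J. char_poly (diag_block \<nu> i) ^ x i)" for \<nu>
  proof -
    have "char_poly (\<psi> (s (diag_block \<nu>))) = (\<Prod>i\<in>J. \<Prod>a<d i. [:- \<nu> (i, a), 1:] ^ n (i, a))"
      unfolding n diag_positions_def using finite_J by (subst prod.Sigma) (auto simp: case_prod_unfold)
    also have "\<dots> = (\<Prod>i\<in>J. \<Prod>a<d i. [:- \<nu> (i, a), 1:] ^ x i)"
    proof (intro prod.cong refl)
      fix i a assume "i \<in> J" "a \<in> {..<d i}"
      then have "n (i, a) = x i"
        unfolding x_def using d_pos by (intro multiplicities_constant_on_blocks[OF n]) auto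
      then show "[:- \<nu> (i, a), 1:] ^ n (i, a) = [:- \<nu> (i, a), 1:] ^ x i" by simp
    qed
    also have "\<dots> = (\<Prod>i\<in>J. char_poly (diag_block \<nu> i) ^ x i)"
      by (simp add: char_poly_diag_block prod_power_distrib)
    finally show ?thesis .
  qed
  have "char_poly (\<psi> a) = (\<Prod>i\<in>J. char_poly (\<pi> i a) ^ x i)" if a: "a \<in> carrier A" for a
  proof -
    have "\<exists>l. char_poly (\<pi> i a) = (\<Prod>c\<leftarrow>l. [:- c, 1:]) \<and> length l = d i" if i: "i \<in> J" for i
      by (rule char_poly_factorized[OF \<pi>_carrier[OF i a]])
    then obtain l where l: "\<And>i. i \<in> J \<Longrightarrow> char_poly (\<pi> i a) = (\<Prod>c\<leftarrow>l i. [:- c, 1:]) \<and> length (l i) = d i" by metis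
    define \<nu> where "\<nu> p = l (fst p) ! snd p" for p
    have \<nu>: "char_poly (\<pi> i a) = (\<Prod>r<d i. [:- \<nu> (i, r), 1:])" if "i \<in> J" for i
      using l[OF that] by (simp add: \<nu>_def prod.list_conv_set_nth atLeast0LessThan)
    have "char_poly (\<psi> a) = char_poly (\<psi> (s (diag_block \<nu>)))" by (rule char_poly_eq_diagonal[OF a \<nu>])
    also have "\<dots> = (\<Prod>i\<in>J. char_poly (diag_block \<nu> i) ^ x i)" by (rule diag)
    also have "\<dots> = (\<Prod>i\<in>J. char_poly (\<pi> i a) ^ x i)" using \<nu> by (simp add: char_poly_diag_block)
    finally show ?thesis .
  qed
  then show ?thesis by blast
qed

end


section \<open>Representations with prescribed multiplicities\<close>

context fd_complex_algebra
begin

lemma rep_direct_sum: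
  assumes \<rho>1: "matrix_rep A n\<^sub>1 \<rho>\<^sub>1" and \<rho>2: "matrix_rep A n\<^sub>2 \<rho>\<^sub>2"
  shows "\<exists>\<sigma>. matrix_rep A (n\<^sub>1 + n\<^sub>2) \<sigma> \<and>
    (\<forall>a\<in>carrier A. char_poly (\<sigma> a) = char_poly (\<rho>\<^sub>1 a) * char_poly (\<rho>\<^sub>2 a))"
proof -
  define \<sigma> where "\<sigma> a = four_block_mat (\<rho>\<^sub>1 a) (0\<^sub>m n\<^sub>1 n\<^sub>2) (0\<^sub>m n\<^sub>2 n\<^sub>1) (\<rho>\<^sub>2 a)" for a
  have c1: "\<rho>\<^sub>1 a \<in> carrier_mat n\<^sub>1 n\<^sub>1" and c2: "\<rho>\<^sub>2 a \<in> carrier_mat n\<^sub>2 n\<^sub>2" if "a \<in> carrier A" for a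
    using matrix_repD(1)[OF \<rho>1 that] matrix_repD(1)[OF \<rho>2 that] .
  have \<sigma>c: "\<sigma> a \<in> carrier_mat (n\<^sub>1 + n\<^sub>2) (n\<^sub>1 + n\<^sub>2)" if "a \<in> carrier A" for a
    unfolding \<sigma>_def using c1[OF that] c2[OF that] by simp
  have d1: "dim_row (\<rho>\<^sub>1 a) = n\<^sub>1" "dim_col (\<rho>\<^sub>1 a) = n\<^sub>1" "dim_row (\<rho>\<^sub>2 a) = n\<^sub>2" "dim_col (\<rho>\<^sub>2 a) = n\<^sub>2"
    if "a \<in> carrier A" for a using c1[OF that] c2[OF that] by auto
  have "matrix_rep A (n\<^sub>1 + n\<^sub>2) \<sigma>"
    unfolding matrix_rep_def
  proof (intro conjI ballI)
    show "\<sigma> a \<in> carrier_mat (n\<^sub>1 + n\<^sub>2) (n\<^sub>1 + n\<^sub>2)" if "a \<in> carrier A" for a by (rule \<sigma>c[OF that])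
    show "\<sigma> \<one> = 1\<^sub>m (n\<^sub>1 + n\<^sub>2)"
      unfolding \<sigma>_def matrix_repD(2)[OF \<rho>1] matrix_repD(2)[OF \<rho>2] by (intro eq_matI) auto
    show "\<forall>c. \<forall>a\<in>carrier A. \<sigma> (c \<odot> a) = c \<cdot>\<^sub>m \<sigma> a"
      using d1 by (auto intro!: eq_matI simp: \<sigma>_def matrix_repD(5)[OF \<rho>1] matrix_repD(5)[OF \<rho>2])
    fix a b assume ab: "a \<in> carrier A" "b \<in> carrier A"
    show "\<sigma> (a \<oplus> b) = \<sigma> a + \<sigma> b"
      using d1[OF ab(1)] d1[OF ab(2)]
      by (intro eq_matI) (auto simp: \<sigma>_def matrix_repD(3)[OF \<rho>1 ab] matrix_repD(3)[OF \<rho>2 ab])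
    have "\<sigma> a * \<sigma> b = four_block_mat (\<rho>\<^sub>1 a * \<rho>\<^sub>1 b + 0\<^sub>m n\<^sub>1 n\<^sub>2 * 0\<^sub>m n\<^sub>2 n\<^sub>1) (\<rho>\<^sub>1 a * 0\<^sub>m n\<^sub>1 n\<^sub>2 + 0\<^sub>m n\<^sub>1 n\<^sub>2 * \<rho>\<^sub>2 b)
        (0\<^sub>m n\<^sub>2 n\<^sub>1 * \<rho>\<^sub>1 b + \<rho>\<^sub>2 a * 0\<^sub>m n\<^sub>2 n\<^sub>1) (0\<^sub>m n\<^sub>2 n\<^sub>1 * 0\<^sub>m n\<^sub>1 n\<^sub>2 + \<rho>\<^sub>2 a * \<rho>\<^sub>2 b)"
      unfolding \<sigma>_def
      by (rule mult_four_block_mat[OF c1[OF ab(1)] zero_carrier_mat zero_carrier_mat c2[OF ab(1)]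
            c1[OF ab(2)] zero_carrier_mat zero_carrier_mat c2[OF ab(2)]])
    also have "\<dots> = \<sigma> (a \<otimes> b)"
    proof -
      have "\<rho>\<^sub>1 a * \<rho>\<^sub>1 b \<in> carrier_mat n\<^sub>1 n\<^sub>1" "\<rho>\<^sub>2 a * \<rho>\<^sub>2 b \<in> carrier_mat n\<^sub>2 n\<^sub>2"
        using c1[OF ab(1)] c1[OF ab(2)] c2[OF ab(1)] c2[OF ab(2)] by auto
      then show ?thesis
        unfolding \<sigma>_def matrix_repD(4)[OF \<rho>1 ab] matrix_repD(4)[OF \<rho>2 ab]
        using c1[OF ab(1)] c1[OF ab(2)] c2[OF ab(1)] c2[OF ab(2)] by simp
    qed
    finally show "\<sigma> (a \<otimes> b) = \<sigma> a * \<sigma> b" ..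
  qed
  moreover have "char_poly (\<sigma> a) = char_poly (\<rho>\<^sub>1 a) * char_poly (\<rho>\<^sub>2 a)" if a: "a \<in> carrier A" for a
  proof -
    have "poly (char_poly (\<sigma> a)) t = poly (char_poly (\<rho>\<^sub>1 a) * char_poly (\<rho>\<^sub>2 a)) t" for t
    proof -
      have "t \<cdot>\<^sub>m 1\<^sub>m (n\<^sub>1 + n\<^sub>2) - \<sigma> a =
          four_block_mat (t \<cdot>\<^sub>m 1\<^sub>m n\<^sub>1 - \<rho>\<^sub>1 a) (0\<^sub>m n\<^sub>1 n\<^sub>2) (0\<^sub>m n\<^sub>2 n\<^sub>1) (t \<cdot>\<^sub>m 1\<^sub>m n\<^sub>2 - \<rho>\<^sub>2 a)"
        using d1[OF a] by (intro eq_matI) (auto simp: \<sigma>_def)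
      then have "det (t \<cdot>\<^sub>m 1\<^sub>m (n\<^sub>1 + n\<^sub>2) - \<sigma> a) = det (t \<cdot>\<^sub>m 1\<^sub>m n\<^sub>1 - \<rho>\<^sub>1 a) * det (t \<cdot>\<^sub>m 1\<^sub>m n\<^sub>2 - \<rho>\<^sub>2 a)"
        using det_four_block_mat_lower_left_zero[OF minus_carrier_mat[OF c1[OF a]] zero_carrier_mat refl
            minus_carrier_mat[OF c2[OF a]]] by simp
      then show ?thesis
        using char_poly_eval[OF \<sigma>c[OF a]] char_poly_eval[OF c1[OF a]] char_poly_eval[OF c2[OF a]] by simp
    qed
    then show ?thesis by (simp add: poly_eq_poly_eq_iff[symmetric] ext)
  qed
  ultimately show ?thesis by blast
qed

lemma empty_rep: "\<exists>\<sigma>. matrix_rep A 0 \<sigma> \<and> (\<forall>a\<in>carrier A. char_poly (\<sigma> a) = 1)"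
proof -
  have "matrix_rep A 0 (\<lambda>_. 0\<^sub>m 0 0)" by (auto simp: matrix_rep_def intro!: eq_matI)
  moreover have "char_poly (0\<^sub>m 0 0 :: complex mat) = 1"
    using char_poly_monic[of "0\<^sub>m 0 0 :: complex mat" 0] by (auto elim: degree_eq_zeroE)
  ultimately show ?thesis by (intro exI[of _ "\<lambda>_. 0\<^sub>m 0 0"]) simp
qed

lemma rep_multiple:
  assumes \<rho>: "matrix_rep A n \<rho>"
  shows "\<exists>\<sigma>. matrix_rep A (x * n) \<sigma> \<and> (\<forall>a\<in>carrier A. char_poly (\<sigma> a) = char_poly (\<rho> a) ^ x)"
proof (induction x)
  case 0
  then show ?case using empty_rep by simp
next
  case (Suc x)
  then obtain \<sigma> where \<sigma>: "matrix_rep A (x * n) \<sigma>" "\<forall>a\<in>carrier A. char_poly (\<sigma> a) = char_poly (\<rho> a) ^ x"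
    by (elim exE conjE)
  from rep_direct_sum[OF \<rho> \<sigma>(1)] show ?case using \<sigma>(2) by simp
qed

text \<open>
  Block diagonal sum of \<open>x i\<close> copies of each \<open>\<pi> i\<close>.
\<close>

lemma rep_with_multiplicities:
  fixes x :: "'i \<Rightarrow> nat"
  assumes "finite J" "\<And>i. i \<in> J \<Longrightarrow> matrix_rep A (d i) (\<pi> i)"
  shows "\<exists>\<sigma>. matrix_rep A (\<Sum>i\<in>J. x i * d i) \<sigma> \<and>
    (\<forall>a\<in>carrier A. char_poly (\<sigma> a) = (\<Prod>i\<in>J. char_poly (\<pi> i a) ^ x i))"
  using assms
proof (induction J)
  case empty
  then show ?case using empty_rep by simp
next
  case (insert i J)
  obtain \<sigma> where \<sigma>: "matrix_rep A (\<Sum>i\<in>J. x i * d i) \<sigma>"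
    "\<forall>a\<in>carrier A. char_poly (\<sigma> a) = (\<Prod>i\<in>J. char_poly (\<pi> i a) ^ x i)"
    using insert by auto
  obtain \<tau> where \<tau>: "matrix_rep A (x i * d i) \<tau>" "\<forall>a\<in>carrier A. char_poly (\<tau> a) = char_poly (\<pi> i a) ^ x i"
    using rep_multiple[OF insert.prems(1)[of i]] by auto
  from rep_direct_sum[OF \<tau>(1) \<sigma>(1)] show ?case using \<sigma>(2) \<tau>(2) insert.hyps by simp
qed

text \<open>
  An element with block \<open>i\<close> the identity and all other blocks zero shows whether block \<open>i\<close> contributes to
  a spectrum.
\<close>

lemma block_separating_element:
  assumes ci: "complete_irreps A J d \<pi>" and i: "i \<in> J"
  obtains a where "a \<in> carrier A" "\<forall>l\<in>J. poly (char_poly (\<pi> l a)) 1 = 0 \<longleftrightarrow> l = i"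
proof -
  obtain s where s: "irrep_section A J d \<pi> s" using irrep_section_exists[OF ci] by blast
  define X where "X l = (if l = i then 1\<^sub>m (d l) else 0\<^sub>m (d l) (d l) :: complex mat)" for l
  have X: "X l \<in> carrier_mat (d l) (d l)" for l by (simp add: X_def)
  have a: "s X \<in> carrier A" "\<And>l. l \<in> J \<Longrightarrow> \<pi> l (s X) = X l" using s X by (auto simp: irrep_section_def)
  show thesis
  proof (rule that[OF a(1)], rule ballI)
    fix l assume l: "l \<in> J"
    have dl: "d l > 0" using complete_irrepsD(4)[OF ci l] .
    have "poly (char_poly (X l)) 1 = det (1 \<cdot>\<^sub>m 1\<^sub>m (d l) - X l)" by (rule char_poly_eval[OF X])
    moreover have "1 \<cdot>\<^sub>m 1\<^sub>m (d l) - X l = (if l = i then 0\<^sub>m (d l) (d l) else 1\<^sub>m (d l))"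
      by (auto simp: X_def intro!: eq_matI)
    ultimately show "poly (char_poly (\<pi> l (s X))) 1 = 0 \<longleftrightarrow> l = i" using dl a(2)[OF l] by (cases "l = i") simp_all
  qed
qed

end

text \<open>
  In terms of eigenvalues: block \<open>j\<close> of \<open>\<phi> a\<close> has the eigenvalues of block \<open>i\<close> of \<open>a\<close>, repeated
  \<open>x j i\<close> times, for all \<open>i\<close>.
\<close>

definition block_char_poly_relation where
  "block_char_poly_relation A J \<pi> L \<rho> x \<phi> \<longleftrightarrow>
     (\<forall>j\<in>L. \<forall>a\<in>carrier A. char_poly (\<rho> j (\<phi> a)) = (\<Prod>i\<in>J. char_poly (\<pi> i a :: complex mat) ^ x j i))"

text \<open>
  Apply the previous analysis to each block \<open>\<rho> j (\<phi> a)\<close>; comparing degrees gives the Diophantine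
  equations.
\<close>

theorem spectrum_shrinking_imp_block_relation:
  assumes A: "fd_complex_algebra A" and B: "fd_complex_algebra B"
    and TA: "hausdorff_vector_topology A TA" and TB: "hausdorff_vector_topology B TB"
    and ciA: "complete_irreps A J d \<pi>" and ciB: "complete_irreps B L e \<rho>"
    and \<phi>: "continuous_map TA TB \<phi>" "spectrum_shrinking A B \<phi>"
  shows "\<exists>x. block_char_poly_relation A J \<pi> L \<rho> x \<phi> \<and> (\<forall>j\<in>L. (\<Sum>i\<in>J. x j i * d i) = e j)"
proof -
  interpret A: fd_complex_algebra A by fact
  interpret B: fd_complex_algebra B by fact
  have \<phi>B: "\<phi> a \<in> carrier B" if "a \<in> carrier A" for a
    using \<phi>(1) that A.topspace_eq_carrier[OF TA] B.topspace_eq_carrier[OF TB] by (auto simp: continuous_map_def)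
  obtain s where s: "irrep_section A J d \<pi> s" using A.irrep_section_exists[OF ciA] by blast
  have "\<exists>x. \<forall>a\<in>carrier A. char_poly (\<rho> j (\<phi> a)) = (\<Prod>i\<in>J. char_poly (\<pi> i a) ^ x i)" if j: "j \<in> L" for j
  proof -
    interpret spectrum_shrinking_rep A TA J d \<pi> s "e j" "\<lambda>a. \<rho> j (\<phi> a)"
    proof
      show "\<rho> j (\<phi> a) \<in> carrier_mat (e j) (e j)" if "a \<in> carrier A" for a
        by (rule B.complete_irrepsD(5)[OF ciB j \<phi>B[OF that]])
      show "continuous_map TA euclidean (\<lambda>x. \<rho> j (\<phi> x) $$ (a, b))" if ab: "a < e j" "b < e j" for a b
        using B.continuous_map_iff_functionals[OF TB, of TA \<phi>] \<phi>(1)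
          B.rep_entry_functional[OF B.complete_irrepsD(3)[OF ciB j] ab] by blast
      fix a t assume a: "a \<in> carrier A" and "poly (char_poly (\<rho> j (\<phi> a))) t = 0"
      then have "t \<in> spectrum_in B (\<phi> a)"
        using B.spectrum_eq_char_poly_roots[OF ciB \<phi>B[OF a]] j by auto
      then show "t \<in> spectrum_in A a" using \<phi>(2) a by (auto simp: spectrum_shrinking_def)
    qed (use TA ciA s in auto)
    show ?thesis by (rule char_poly_of_spectrum_shrinking)
  qed
  then obtain x where x: "\<And>j. j \<in> L \<Longrightarrow>
      \<forall>a\<in>carrier A. char_poly (\<rho> j (\<phi> a)) = (\<Prod>i\<in>J. char_poly (\<pi> i a) ^ x j i)" by metis
  have "(\<Sum>i\<in>J. x j i * d i) = e j" if j: "j \<in> L" for j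
  proof -
    have eq: "char_poly (\<rho> j (\<phi> \<one>\<^bsub>A\<^esub>)) = (\<Prod>i\<in>J. char_poly (\<pi> i \<one>\<^bsub>A\<^esub>) ^ x j i)" using x[OF j] by simp
    have \<pi>c: "\<pi> i \<one>\<^bsub>A\<^esub> \<in> carrier_mat (d i) (d i)" if "i \<in> J" for i
      by (rule A.complete_irrepsD(5)[OF ciA that A.one_closed])
    have nz: "char_poly (\<pi> i \<one>\<^bsub>A\<^esub>) ^ x j i \<noteq> 0" if "i \<in> J" for i
      using char_poly_monic(3)[OF \<pi>c[OF that]] by simp
    have "e j = degree (char_poly (\<rho> j (\<phi> \<one>\<^bsub>A\<^esub>)))"
      using char_poly_monic(1)[OF B.complete_irrepsD(5)[OF ciB j \<phi>B[OF A.one_closed]]] by simp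
    also have "\<dots> = (\<Sum>i\<in>J. degree (char_poly (\<pi> i \<one>\<^bsub>A\<^esub>) ^ x j i))"
      unfolding eq by (rule degree_prod_sum_eq[OF nz])
    also have "\<dots> = (\<Sum>i\<in>J. x j i * d i)"
      using char_poly_monic[OF \<pi>c] by (intro sum.cong) (auto simp: degree_power_eq)
    finally show ?thesis ..
  qed
  then show ?thesis using x by (intro exI[of _ x]) (simp add: block_char_poly_relation_def)
qed

text \<open>
  The block diagonal representation of size \<open>e j\<close> with multiplicities \<open>x j i\<close> prescribes the blocks of
  \<open>\<phi> a\<close>, and the linear section \<open>s\<close> lifts them to \<open>B\<close>. The spectrum sees only the blocks, so \<open>\<phi>\<close> need not be
  multiplicative, and no multiplicative lifting modulo the radical of \<open>B\<close> is involved.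
\<close>

theorem block_relation_realizable:
  assumes A: "fd_complex_algebra A" and B: "fd_complex_algebra B"
    and TA: "hausdorff_vector_topology A TA" and TB: "hausdorff_vector_topology B TB"
    and ciA: "complete_irreps A J d \<pi>" and ciB: "complete_irreps B L e \<rho>"
    and x: "\<forall>j\<in>L. (\<Sum>i\<in>J. x j i * d i) = e j"
  shows "\<exists>\<phi>. continuous_map TA TB \<phi> \<and> block_char_poly_relation A J \<pi> L \<rho> x \<phi>"
proof -
  interpret A: fd_complex_algebra A by fact
  interpret B: fd_complex_algebra B by fact
  obtain s where s: "irrep_section B L e \<rho> s" using B.irrep_section_exists[OF ciB] by blast
  have "\<exists>\<sigma>. matrix_rep A (e j) \<sigma> \<and> (\<forall>a\<in>carrier A. char_poly (\<sigma> a) = (\<Prod>i\<in>J. char_poly (\<pi> i a) ^ x j i))"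
    if j: "j \<in> L" for j
  proof -
    have "\<exists>\<sigma>. matrix_rep A (\<Sum>i\<in>J. x j i * d i) \<sigma> \<and>
        (\<forall>a\<in>carrier A. char_poly (\<sigma> a) = (\<Prod>i\<in>J. char_poly (\<pi> i a) ^ x j i))"
      by (rule A.rep_with_multiplicities) (use A.complete_irrepsD(1,3)[OF ciA] in auto)
    then show ?thesis unfolding bspec[OF x j] .
  qed
  then have "\<forall>j\<in>L. \<exists>\<sigma>. matrix_rep A (e j) \<sigma> \<and>
      (\<forall>a\<in>carrier A. char_poly (\<sigma> a) = (\<Prod>i\<in>J. char_poly (\<pi> i a) ^ x j i))" by (intro ballI)
  from bchoice[OF this] obtain \<sigma> where "\<forall>j\<in>L. matrix_rep A (e j) (\<sigma> j) \<and>
      (\<forall>a\<in>carrier A. char_poly (\<sigma> j a) = (\<Prod>i\<in>J. char_poly (\<pi> i a) ^ x j i))" by (elim exE)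
  then have \<sigma>: "\<And>j. j \<in> L \<Longrightarrow> matrix_rep A (e j) (\<sigma> j)"
    "\<And>j. j \<in> L \<Longrightarrow> \<forall>a\<in>carrier A. char_poly (\<sigma> j a) = (\<Prod>i\<in>J. char_poly (\<pi> i a) ^ x j i)" by simp_all
  define \<phi> where "\<phi> a = s (\<lambda>j. \<sigma> j a)" for a
  have "continuous_map TA TB \<phi>"
    unfolding B.continuous_map_iff_functionals[OF TB]
  proof (intro conjI allI impI)
    show "\<phi> \<in> topspace TA \<rightarrow> carrier B" using s by (simp add: \<phi>_def irrep_section_def)
    fix g assume "linear_functional B g"
    then obtain w where w: "\<And>X. g (s X) = (\<Sum>t\<in>block_positions L e. X (fst t) $$ snd t * w t)"
      using s unfolding irrep_section_def by blast
    show "continuous_map TA euclidean (\<lambda>a. g (\<phi> a))"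
      unfolding \<phi>_def w
    proof (intro continuous_map_sum)
      show "finite (block_positions L e)" using B.complete_irrepsD(1)[OF ciB] by auto
      fix t assume "t \<in> block_positions L e"
      then obtain j r c where t: "t = (j, r, c)" "j \<in> L" "r < e j" "c < e j" by auto
      have "continuous_map TA euclidean (\<lambda>a. \<sigma> j a $$ (r, c))"
        by (rule A.linear_functional_continuous[OF TA A.rep_entry_functional[OF \<sigma>(1)[OF t(2)] t(3,4)]])
      then have "continuous_map TA euclidean ((\<lambda>z. z * w t) \<circ> (\<lambda>a. \<sigma> j a $$ (r, c)))"
        by (rule continuous_map_compose) (auto intro!: continuous_intros simp: continuous_map_iff_continuous2)
      then show "continuous_map TA euclidean (\<lambda>a. \<sigma> (fst t) a $$ snd t * w t)" by (simp add: o_def t(1))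
    qed
  qed
  moreover have "block_char_poly_relation A J \<pi> L \<rho> x \<phi>"
    unfolding block_char_poly_relation_def
  proof (intro ballI)
    fix j a assume j: "j \<in> L" and a: "a \<in> carrier A"
    have "\<forall>j\<in>L. \<sigma> j a \<in> carrier_mat (e j) (e j)" using matrix_repD(1)[OF \<sigma>(1) a] by blast
    moreover have "\<forall>X. (\<forall>j\<in>L. X j \<in> carrier_mat (e j) (e j)) \<longrightarrow> (\<forall>j\<in>L. \<rho> j (s X) = X j)"
      using s by (simp add: irrep_section_def)
    ultimately have "\<rho> j (\<phi> a) = \<sigma> j a" using j unfolding \<phi>_def by simp
    then show "char_poly (\<rho> j (\<phi> a)) = (\<Prod>i\<in>J. char_poly (\<pi> i a) ^ x j i)" using \<sigma>(2)[OF j] a by simp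
  qed
  ultimately show ?thesis by blast
qed

text \<open>
  The spectrum of \<open>\<phi> a\<close> is the union of the spectra of those blocks of \<open>a\<close> that occur with positive
  multiplicity.
\<close>

theorem block_relation_spectrum:
  assumes A: "fd_complex_algebra A" and B: "fd_complex_algebra B"
    and ciA: "complete_irreps A J d \<pi>" and ciB: "complete_irreps B L e \<rho>"
    and \<phi>: "\<And>a. a \<in> carrier A \<Longrightarrow> \<phi> a \<in> carrier B" and rel: "block_char_poly_relation A J \<pi> L \<rho> x \<phi>"
  shows "spectrum_shrinking A B \<phi>"
    and "spectrum_preserving A B \<phi> \<longleftrightarrow> (\<forall>i\<in>J. \<exists>j\<in>L. 0 < x j i)"
proof -
  interpret A: fd_complex_algebra A by fact
  interpret B: fd_complex_algebra B by fact
  have spB: "c \<in> spectrum_in B (\<phi> a) \<longleftrightarrow> (\<exists>j\<in>L. \<exists>i\<in>J. 0 < x j i \<and> poly (char_poly (\<pi> i a)) c = 0)"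
    if a: "a \<in> carrier A" for a c
  proof -
    have "poly (char_poly (\<rho> j (\<phi> a))) c = 0 \<longleftrightarrow> (\<exists>i\<in>J. 0 < x j i \<and> poly (char_poly (\<pi> i a)) c = 0)" if j: "j \<in> L" for j
    proof -
      have "char_poly (\<rho> j (\<phi> a)) = (\<Prod>i\<in>J. char_poly (\<pi> i a) ^ x j i)"
        using rel j a by (simp add: block_char_poly_relation_def)
      then show ?thesis using A.complete_irrepsD(1)[OF ciA] by (auto simp: poly_prod poly_power)
    qed
    then show ?thesis using B.spectrum_eq_char_poly_roots[OF ciB \<phi>[OF a]] by simp
  qed
  have spA: "c \<in> spectrum_in A a \<longleftrightarrow> (\<exists>i\<in>J. poly (char_poly (\<pi> i a)) c = 0)" if "a \<in> carrier A" for a c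
    by (rule A.spectrum_eq_char_poly_roots[OF ciA that])
  show "spectrum_shrinking A B \<phi>"
    unfolding spectrum_shrinking_def by (auto simp: spA spB)
  show "spectrum_preserving A B \<phi> \<longleftrightarrow> (\<forall>i\<in>J. \<exists>j\<in>L. 0 < x j i)"
  proof
    assume cover: "\<forall>i\<in>J. \<exists>j\<in>L. 0 < x j i"
    have "c \<in> spectrum_in B (\<phi> a)" if a: "a \<in> carrier A" and c: "c \<in> spectrum_in A a" for a c
    proof -
      obtain i where i: "i \<in> J" "poly (char_poly (\<pi> i a)) c = 0" using c by (auto simp: spA[OF a])
      then obtain j where "j \<in> L" "0 < x j i" using cover by auto
      then show ?thesis using i by (auto simp: spB[OF a])
    qed
    then show "spectrum_preserving A B \<phi>"
      using \<open>spectrum_shrinking A B \<phi>\<close> by (auto simp: spectrum_preserving_def spectrum_shrinking_def)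
  next
    assume pres: "spectrum_preserving A B \<phi>"
    show "\<forall>i\<in>J. \<exists>j\<in>L. 0 < x j i"
    proof
      fix i assume i: "i \<in> J"
      obtain a where a: "a \<in> carrier A" "\<forall>l\<in>J. poly (char_poly (\<pi> l a)) 1 = 0 \<longleftrightarrow> l = i"
        by (rule A.block_separating_element[OF ciA i])
      have "1 \<in> spectrum_in A a" using spA[OF a(1)] a(2) i by auto
      then have "1 \<in> spectrum_in B (\<phi> a)" using pres a(1) by (simp add: spectrum_preserving_def)
      then show "\<exists>j\<in>L. 0 < x j i" using spB[OF a(1)] a(2) by auto
    qed
  qed
qed


section \<open>Existence of spectrum-shrinking and spectrum-preserving maps\<close>

theorem theorem1p1:
  fixes A :: "'a complex_alg" and B :: "'b complex_alg"
    and TA :: "'a topology" and TB :: "'b topology"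
    and p q :: nat
    and M :: "nat \<Rightarrow> 'a set" and N :: "nat \<Rightarrow> 'b set"
    and k m :: "nat \<Rightarrow> real"
  assumes "fd_complex_algebra A" and "fd_complex_algebra B"
    and "hausdorff_vector_topology A TA" and "hausdorff_vector_topology B TB"
    and "bij_betw M {1..p} (Max_ideals A)" and "bij_betw N {1..q} (Max_ideals B)"
    and "\<And>i. i \<in> {1..p} \<Longrightarrow> k i = sqrt (real (alg_dim (quotient_algebra A (M i))))"
    and "\<And>j. j \<in> {1..q} \<Longrightarrow> m j = sqrt (real (alg_dim (quotient_algebra B (N j))))"
  shows
    "((\<forall>i\<in>{1..p}. \<exists>r::nat. 0 < r \<and> k i = real r) \<and>
      (\<forall>j\<in>{1..q}. \<exists>r::nat. 0 < r \<and> m j = real r)) \<and>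
     \<comment> \<open>(a)\<close>
     ((\<exists>\<phi>. continuous_map TA TB \<phi> \<and> spectrum_shrinking A B \<phi>) \<longleftrightarrow>
        (\<forall>j\<in>{1..q}. \<exists>x. solves_linear_eq p k (m j) x)) \<and>
     \<comment> \<open>(b)\<close>
     ((\<exists>\<phi>. continuous_map TA TB \<phi> \<and> spectrum_preserving A B \<phi>) \<longleftrightarrow>
        (\<exists>x :: nat \<Rightarrow> nat \<Rightarrow> nat. (\<forall>j\<in>{1..q}. solves_linear_eq p k (m j) (x j)) \<and>
           (\<forall>i\<in>{1..p}. \<exists>j\<in>{1..q}. 0 < x j i))) \<and>
     \<comment> \<open>(c)\<close>
     ((\<forall>\<phi>. continuous_map TA TB \<phi> \<and> spectrum_shrinking A B \<phi> \<longrightarrow> spectrum_preserving A B \<phi>) \<longrightarrow>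
        (\<forall>x :: nat \<Rightarrow> nat \<Rightarrow> nat. (\<forall>j\<in>{1..q}. solves_linear_eq p k (m j) (x j)) \<longrightarrow>
           (\<forall>i\<in>{1..p}. \<exists>j\<in>{1..q}. 0 < x j i))) \<and>
     (isomorphic_to_SMA A \<longrightarrow>
        (\<forall>x :: nat \<Rightarrow> nat \<Rightarrow> nat. (\<forall>j\<in>{1..q}. solves_linear_eq p k (m j) (x j)) \<longrightarrow>
           (\<forall>i\<in>{1..p}. \<exists>j\<in>{1..q}. 0 < x j i)) \<longrightarrow>
        (\<forall>\<phi>. continuous_map TA TB \<phi> \<and> spectrum_shrinking A B \<phi> \<longrightarrow> spectrum_preserving A B \<phi>))"
proof -
  note A = assms(1) and B = assms(2) and TA = assms(3) and TB = assms(4)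
  interpret A: fd_complex_algebra A by (rule A)
  interpret B: fd_complex_algebra B by (rule B)
  obtain d \<pi> where ciA: "complete_irreps A {1..p} d \<pi>" and kerA: "\<forall>i\<in>{1..p}. rep_kernel A (d i) (\<pi> i) = M i"
    using A.complete_irreps_exist[OF assms(5)] by auto
  obtain e \<rho> where ciB: "complete_irreps B {1..q} e \<rho>" and kerB: "\<forall>j\<in>{1..q}. rep_kernel B (e j) (\<rho> j) = N j"
    using B.complete_irreps_exist[OF assms(6)] by auto
  have k: "k i = real (d i)" "0 < d i" if i: "i \<in> {1..p}" for i
    using A.alg_dim_quotient_by_rep_kernel[OF A.complete_irrepsD(2)[OF ciA i]] kerA i assms(7)[OF i]
      A.complete_irrepsD(4)[OF ciA i] by (auto simp: real_sqrt_mult_self)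
  have m: "m j = real (e j)" "0 < e j" if j: "j \<in> {1..q}" for j
    using B.alg_dim_quotient_by_rep_kernel[OF B.complete_irrepsD(2)[OF ciB j]] kerB j assms(8)[OF j]
      B.complete_irrepsD(4)[OF ciB j] by (auto simp: real_sqrt_mult_self)
  have solves: "solves_linear_eq p k (m j) x \<longleftrightarrow> (\<Sum>i\<in>{1..p}. x i * d i) = e j" if j: "j \<in> {1..q}" for j x
  proof -
    have "(\<Sum>i = 1..p. k i * real (x i)) = real (\<Sum>i\<in>{1..p}. x i * d i)"
      using k(1) by (simp add: mult.commute)
    then show ?thesis using m(1)[OF j] by (simp add: solves_linear_eq_def del: of_nat_sum)
  qed
  have \<phi>B: "\<phi> a \<in> carrier B" if "continuous_map TA TB \<phi>" "a \<in> carrier A" for \<phi> a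
    using that A.topspace_eq_carrier[OF TA] B.topspace_eq_carrier[OF TB] by (auto simp: continuous_map_def)
  define covers where "covers x \<longleftrightarrow> (\<forall>i\<in>{1..p}. \<exists>j\<in>{1..q}. 0 < x j i)" for x :: "nat \<Rightarrow> nat \<Rightarrow> nat"
  define family where "family x \<longleftrightarrow> (\<forall>j\<in>{1..q}. solves_linear_eq p k (m j) (x j))" for x :: "nat \<Rightarrow> nat \<Rightarrow> nat"
  have necessary: "\<exists>x. family x \<and> (spectrum_preserving A B \<phi> \<longleftrightarrow> covers x)"
    if \<phi>: "continuous_map TA TB \<phi>" "spectrum_shrinking A B \<phi>" for \<phi>
  proof -
    obtain x where x: "block_char_poly_relation A {1..p} \<pi> {1..q} \<rho> x \<phi>"
      "\<forall>j\<in>{1..q}. (\<Sum>i\<in>{1..p}. x j i * d i) = e j"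
      using spectrum_shrinking_imp_block_relation[OF A B TA TB ciA ciB \<phi>] by (elim exE conjE)
    have "family x" using x(2) solves by (simp add: family_def)
    moreover have "spectrum_preserving A B \<phi> \<longleftrightarrow> covers x"
      unfolding covers_def by (rule block_relation_spectrum(2)[OF A B ciA ciB \<phi>B[OF \<phi>(1)] x(1)])
    ultimately show ?thesis by blast
  qed
  have sufficient: "\<exists>\<phi>. continuous_map TA TB \<phi> \<and> spectrum_shrinking A B \<phi> \<and> (spectrum_preserving A B \<phi> \<longleftrightarrow> covers x)"
    if x: "family x" for x
  proof -
    have "\<forall>j\<in>{1..q}. (\<Sum>i\<in>{1..p}. x j i * d i) = e j"
      using x solves by (simp add: family_def)
    from block_relation_realizable[OF A B TA TB ciA ciB this]
    obtain \<phi> where \<phi>: "continuous_map TA TB \<phi>" "block_char_poly_relation A {1..p} \<pi> {1..q} \<rho> x \<phi>"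
      by (elim exE conjE)
    note sp = block_relation_spectrum[OF A B ciA ciB \<phi>B[OF \<phi>(1)] \<phi>(2)]
    show ?thesis using \<phi>(1) sp unfolding covers_def by blast
  qed
  have choose: "(\<forall>j\<in>{1..q}. \<exists>x. solves_linear_eq p k (m j) x) \<longleftrightarrow> (\<exists>x. family x)"
    unfolding family_def by (rule bchoice_iff)
  have pres_shr: "spectrum_shrinking A B \<phi>" if "spectrum_preserving A B \<phi>" for \<phi>
    using that by (simp add: spectrum_shrinking_def spectrum_preserving_def)
  show ?thesis
    unfolding choose unfolding covers_def[symmetric] family_def[symmetric]
  proof (intro conjI)
    show "\<forall>i\<in>{1..p}. \<exists>r::nat. 0 < r \<and> k i = real r" using k by blast
    show "\<forall>j\<in>{1..q}. \<exists>r::nat. 0 < r \<and> m j = real r" using m by blast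
    show "(\<exists>\<phi>. continuous_map TA TB \<phi> \<and> spectrum_shrinking A B \<phi>) \<longleftrightarrow> (\<exists>x. family x)"
      using necessary sufficient by meson
    show "(\<exists>\<phi>. continuous_map TA TB \<phi> \<and> spectrum_preserving A B \<phi>) \<longleftrightarrow> (\<exists>x. family x \<and> covers x)"
      using necessary sufficient pres_shr by meson
    show "(\<forall>\<phi>. continuous_map TA TB \<phi> \<and> spectrum_shrinking A B \<phi> \<longrightarrow> spectrum_preserving A B \<phi>) \<longrightarrow>
        (\<forall>x. family x \<longrightarrow> covers x)"
      using sufficient by meson
    show "isomorphic_to_SMA A \<longrightarrow> (\<forall>x. family x \<longrightarrow> covers x) \<longrightarrow>
        (\<forall>\<phi>. continuous_map TA TB \<phi> \<and> spectrum_shrinking A B \<phi> \<longrightarrow> spectrum_preserving A B \<phi>)"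
      using necessary by meson
  qed
qed

end
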